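(* Let $\mathbb{K}$ be a field of characteristic $0$, let $A=A(\alpha,\beta,0)$ be a down-up algebra with $(\alpha,\beta)\neq(0,0)$, and assume $\mathbb{K}$ contains both roots of $t^2-\alpha t-\beta$. Then the Hilbert series, for the usual grading, of the reduced cyclic homology and the Hochschild homology of $A$ satisfy $$\overline{HC}_0(A)(t)=\overline{HH}_0(A)(t),$$ $$\overline{HC}_1(A)(t)=\overline{HH}_0(A)(t)+HH_3(A)(t)-\frac{t(2+3t)}{1-t^2},$$ $$\overline{HC}_2(A)(t)=HH_3(A)(t),$$ $$HH_1(A)(t)=2\,\overline{HH}_0(A)(t)+HH_3(A)(t)-\frac{t(2+3t)}{1-t^2},$$ $$HH_2(A)(t)=\overline{HH}_0(A)(t)+2\,HH_3(A)(t)-\frac{t(2+3t)}{1-t^2}.$$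
   Context: The down-up algebra $A=A(\alpha,\beta,0)$ over $\mathbb{K}$ is the quotient of $\mathbb{K}\langle u,d\rangle$ by the relations $d^2u=\alpha dud+\beta ud^2$ and $du^2=\alpha udu+\beta u^2d$, graded by the usual grading with $u,d$ in degree $1$. $\overline{HC}_\bullet(A)$ and $\overline{HH}_\bullet(A)$ denote the reduced cyclic and reduced Hochschild homology of the connected graded algebra $A$ (i.e. relative to $\mathbb{K}$); $\overline{HH}_i(A)=HH_i(A)$ for $i\ge1$ and $\overline{HH}_0(A)(t)=HH_0(A)(t)-1$. For a graded vector space $M$, $M(t)=\sum_m\dim_{\mathbb{K}}(M_m)\,t^m$. *)

theory Defs
  imports
    "HOL-Algebra.Algebraic_Closure_Type"
    "HOL-Algebra.QuotRing"
    "HOL-Algebra.Module"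
    "HOL-Library.Poly_Mapping"
    "HOL-Computational_Algebra.Polynomial"
    "HOL-Computational_Algebra.Formal_Power_Series"
begin

section \<open>Free vector spaces and quotient dimensions\<close>

text \<open>\<^typ>\<open>'b \<Rightarrow>\<^sub>0 'k\<close> is the vector space with basis \<^typ>\<open>'b\<close>, the basis vector of
  \<open>b\<close> being \<open>single b 1\<close>.\<close>

definition scal :: "'k \<Rightarrow> ('b \<Rightarrow>\<^sub>0 'k) \<Rightarrow> ('b \<Rightarrow>\<^sub>0 'k::field)" where
  "scal c = Poly_Mapping.map ((*) c)"

lemma lookup_scal [simp]: "Poly_Mapping.lookup (scal c x) b = c * Poly_Mapping.lookup x b"
  unfolding scal_def by (rule Poly_Mapping.map.rep_eq [THEN fun_cong, THEN trans]) (simp add: when_def)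

interpretation free_vs: vector_space scal
  by unfold_locales (auto intro!: poly_mapping_eqI simp: lookup_add algebra_simps)

definition lin_ext :: "('b \<Rightarrow> ('c \<Rightarrow>\<^sub>0 'k)) \<Rightarrow> ('b \<Rightarrow>\<^sub>0 'k) \<Rightarrow> ('c \<Rightarrow>\<^sub>0 'k::field)" where
  "lin_ext f x = (\<Sum>b\<in>Poly_Mapping.keys x. scal (Poly_Mapping.lookup x b) (f b))"

text \<open>\<open>quot_dim V W\<close> is the dimension of \<open>V / (V \<inter> W)\<close>, computed as the dimension of
  a linear complement of \<open>V \<inter> W\<close> in \<open>V\<close>; it does not depend on the complement.\<close>

definition quot_dim :: "('b \<Rightarrow>\<^sub>0 'k::field) set \<Rightarrow> ('b \<Rightarrow>\<^sub>0 'k) set \<Rightarrow> nat" where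
  "quot_dim V W = free_vs.dim
     (SOME C. free_vs.subspace C \<and> C \<inter> (V \<inter> W) = {0} \<and>
              {c + w | c w. c \<in> C \<and> w \<in> V \<inter> W} = V)"

text \<open>The dimension of the \<open>n\<close>-th homology of the quotient of the complex \<open>(C, bd)\<close> by its
  subcomplex \<open>C n \<inter> R\<close>: classes of those \<open>x \<in> C n\<close> with \<open>bd x\<close> zero modulo \<open>R\<close>,
  modulo boundaries and \<open>R\<close>.  The subspace \<open>R\<close> contains the relations of all degrees at once; it is
  the direct sum of its parts in the single degrees.\<close>

definition homology_dim ::
  "(nat \<Rightarrow> ('b \<Rightarrow>\<^sub>0 'k::field) set) \<Rightarrow> (('b \<Rightarrow>\<^sub>0 'k) \<Rightarrow> ('b \<Rightarrow>\<^sub>0 'k)) \<Rightarrow> ('b \<Rightarrow>\<^sub>0 'k) set \<Rightarrow> nat \<Rightarrow> nat"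
  where
  "homology_dim C bd R n =
     quot_dim {x \<in> C n. bd x \<in> R} (free_vs.span (bd ` C (Suc n) \<union> R))"


section \<open>Hochschild homology of a graded algebra\<close>

text \<open>An associative unital algebra over the field \<^typ>\<open>'k\<close> is given as a record \<open>A\<close> of
  type \<^typ>\<open>('k, 'a) module\<close> (ring operations and scalar multiplication), a grading of it as the
  family \<open>G\<close> of its homogeneous components.  The tensor power \<open>A\<^sup>\<otimes>\<^sup>(\<^sup>n\<^sup>+\<^sup>1\<^sup>)\<close> over \<^typ>\<open>'k\<close> is the
  free vector space on lists of \<open>n + 1\<close> elements of \<open>A\<close> modulo the relations expressing
  multilinearity.\<close>

definition tensor_rels :: "('k::field, 'a) module \<Rightarrow> ('a list \<Rightarrow>\<^sub>0 'k) set" where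
  "tensor_rels A =
     {Poly_Mapping.single (xs @ (a \<oplus>\<^bsub>A\<^esub> b) # ys) 1
        - Poly_Mapping.single (xs @ a # ys) 1 - Poly_Mapping.single (xs @ b # ys) 1
      | xs a b ys. set xs \<subseteq> carrier A \<and> a \<in> carrier A \<and> b \<in> carrier A \<and> set ys \<subseteq> carrier A}
   \<union> {Poly_Mapping.single (xs @ (c \<odot>\<^bsub>A\<^esub> a) # ys) 1 - Poly_Mapping.single (xs @ a # ys) c
      | xs c a ys. set xs \<subseteq> carrier A \<and> a \<in> carrier A \<and> set ys \<subseteq> carrier A}"

definition homog_tensors :: "(nat \<Rightarrow> 'a set) \<Rightarrow> nat \<Rightarrow> nat \<Rightarrow> 'a list set" where
  "homog_tensors G m n =
     {xs. length xs = n + 1 \<and> (\<exists>ds. list_all2 (\<lambda>x d. x \<in> G d) xs ds \<and> sum_list ds = m)}"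

definition bar_bd :: "('k::field, 'a) module \<Rightarrow> 'a list \<Rightarrow> ('a list \<Rightarrow>\<^sub>0 'k)" where
  "bar_bd A xs =
     (\<Sum>i<length xs - 1.
        Poly_Mapping.single (take i xs @ (xs ! i \<otimes>\<^bsub>A\<^esub> xs ! Suc i) # drop (i + 2) xs) ((- 1) ^ i))"

definition hochschild_bd :: "('k::field, 'a) module \<Rightarrow> 'a list \<Rightarrow> ('a list \<Rightarrow>\<^sub>0 'k)" where
  "hochschild_bd A xs = bar_bd A xs +
     (if length xs \<le> 1 then 0
      else Poly_Mapping.single ((last xs \<otimes>\<^bsub>A\<^esub> hd xs) # butlast (tl xs)) ((- 1) ^ (length xs - 1)))"

definition HH_dim :: "('k::field, 'a) module \<Rightarrow> (nat \<Rightarrow> 'a set) \<Rightarrow> nat \<Rightarrow> nat \<Rightarrow> nat" where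
  "HH_dim A G n m =
     homology_dim (\<lambda>n. free_vs.span ((\<lambda>xs. Poly_Mapping.single xs 1) ` homog_tensors G m n))
       (lin_ext (hochschild_bd A)) (free_vs.span (tensor_rels A)) n"


section \<open>Reduced cyclic homology\<close>

text \<open>Cyclic homology is the homology of the total complex of the cyclic (Tsygan) bicomplex
  with \<open>A\<^sup>\<otimes>\<^sup>(\<^sup>q\<^sup>+\<^sup>1\<^sup>)\<close> in position \<open>(p, q)\<close>, \<open>p, q \<ge> 0\<close>: the even columns carry \<open>b\<close>, the odd ones
  \<open>- b'\<close>, and the horizontal maps are alternately \<open>1 - t\<close> (from odd \<open>p\<close>) and the norm
  (from even \<open>p > 0\<close>).  A pair \<open>(p, xs)\<close> denotes the tensor \<open>xs\<close> in column \<open>p\<close>.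
  Reduced cyclic homology is that of the quotient of the total complex of \<open>A\<close> by that
  of the ground field, embedded through the unit.\<close>

definition cyclic_op :: "'a list \<Rightarrow> ('a list \<Rightarrow>\<^sub>0 'k::field)" where
  "cyclic_op xs = Poly_Mapping.single (last xs # butlast xs) ((- 1) ^ (length xs - 1))"

definition cyclic_norm :: "'a list \<Rightarrow> ('a list \<Rightarrow>\<^sub>0 'k::field)" where
  "cyclic_norm xs = (\<Sum>k<length xs. (lin_ext cyclic_op ^^ k) (Poly_Mapping.single xs 1))"

definition in_column :: "nat \<Rightarrow> ('a list \<Rightarrow>\<^sub>0 'k) \<Rightarrow> (nat \<times> 'a list \<Rightarrow>\<^sub>0 'k::field)" where
  "in_column p = lin_ext (\<lambda>xs. Poly_Mapping.single (p, xs) 1)"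

definition cyclic_bd ::
  "('k::field, 'a) module \<Rightarrow> nat \<times> 'a list \<Rightarrow> (nat \<times> 'a list \<Rightarrow>\<^sub>0 'k)" where
  "cyclic_bd A = (\<lambda>(p, xs).
     in_column p (if even p then hochschild_bd A xs else - bar_bd A xs) +
     (if p = 0 then 0
      else in_column (p - 1)
             (if odd p then Poly_Mapping.single xs 1 - cyclic_op xs else cyclic_norm xs)))"

definition HC_red_dim :: "('k::field, 'a) module \<Rightarrow> (nat \<Rightarrow> 'a set) \<Rightarrow> nat \<Rightarrow> nat \<Rightarrow> nat" where
  "HC_red_dim A G n m =
     homology_dim
       (\<lambda>n. free_vs.span {Poly_Mapping.single (p, xs) 1 | p q xs. p + q = n \<and> xs \<in> homog_tensors G m q})
       (lin_ext (cyclic_bd A))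
       (free_vs.span ((\<Union>p. in_column p ` tensor_rels A)
          \<union> {Poly_Mapping.single (p, replicate (q + 1) \<one>\<^bsub>A\<^esub>) 1 | p q. True})) n"


section \<open>Hilbert series\<close>

definition HH_series :: "('k::field, 'a) module \<Rightarrow> (nat \<Rightarrow> 'a set) \<Rightarrow> nat \<Rightarrow> rat fps" where
  "HH_series A G n = Abs_fps (\<lambda>m. of_nat (HH_dim A G n m))"

definition HH_red_series :: "('k::field, 'a) module \<Rightarrow> (nat \<Rightarrow> 'a set) \<Rightarrow> nat \<Rightarrow> rat fps" where
  "HH_red_series A G n = (if n = 0 then HH_series A G 0 - 1 else HH_series A G n)"

definition HC_red_series :: "('k::field, 'a) module \<Rightarrow> (nat \<Rightarrow> 'a set) \<Rightarrow> nat \<Rightarrow> rat fps" where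
  "HC_red_series A G n = Abs_fps (\<lambda>m. of_nat (HC_red_dim A G n m))"


section \<open>Down-up algebras\<close>

text \<open>Words with concatenation form the free monoid, so \<^typ>\<open>'g list \<Rightarrow>\<^sub>0 'k\<close> with the
  convolution product is the free algebra on \<^typ>\<open>'g\<close>.\<close>

instantiation list :: (type) monoid_add
begin

definition zero_list :: "'a list" where "zero_list = []"

definition plus_list :: "'a list \<Rightarrow> 'a list \<Rightarrow> 'a list" where "plus_list xs ys = xs @ ys"

instance by standard (simp_all add: zero_list_def plus_list_def)

end

datatype gen = Gen_u | Gen_d

type_synonym 'k free_alg = "gen list \<Rightarrow>\<^sub>0 'k"

definition free_u :: "'k::field free_alg" where "free_u = Poly_Mapping.single [Gen_u] 1"

definition free_d :: "'k::field free_alg" where "free_d = Poly_Mapping.single [Gen_d] 1"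

abbreviation free_ring :: "'k::field free_alg ring" where
  "free_ring \<equiv> ring_of_type_algebra"

definition down_up_ideal :: "'k::field \<Rightarrow> 'k \<Rightarrow> 'k free_alg set" where
  "down_up_ideal \<alpha> \<beta> = genideal free_ring
     {free_d * free_d * free_u
        - (scal \<alpha> (free_d * free_u * free_d) + scal \<beta> (free_u * free_d * free_d)),
      free_d * free_u * free_u
        - (scal \<alpha> (free_u * free_d * free_u) + scal \<beta> (free_u * free_u * free_d))}"

text \<open>The algebra \<open>A(\<alpha>, \<beta>, 0)\<close>.  A scalar \<open>c\<close> acts as multiplication by the class of \<open>c \<cdot> 1\<close>.\<close>

definition down_up :: "'k::field \<Rightarrow> 'k \<Rightarrow> ('k, 'k free_alg set) module" where
  "down_up \<alpha> \<beta> =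
     (let I = down_up_ideal \<alpha> \<beta>; Q = free_ring Quot I in
      \<lparr>carrier = carrier Q, monoid.mult = (\<otimes>\<^bsub>Q\<^esub>), one = \<one>\<^bsub>Q\<^esub>,
       zero = \<zero>\<^bsub>Q\<^esub>, add = (\<oplus>\<^bsub>Q\<^esub>),
       module.smult = (\<lambda>c a. (I +>\<^bsub>free_ring\<^esub> Poly_Mapping.single 0 c) \<otimes>\<^bsub>Q\<^esub> a)\<rparr>)"

definition down_up_grading :: "'k::field \<Rightarrow> 'k \<Rightarrow> nat \<Rightarrow> 'k free_alg set set" where
  "down_up_grading \<alpha> \<beta> m =
     {down_up_ideal \<alpha> \<beta> +>\<^bsub>free_ring\<^esub> x | x. \<forall>w\<in>Poly_Mapping.keys x. length w = m}"

end

theory Submission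
  imports Defs "HOL-Number_Theory.Totient"
begin

text \<open>Rewriting \<open>d d u\<close> and \<open>d u u\<close> is confluent, so the words without a subword \<open>d b u\<close> form a basis
  of \<open>A\<close>; tensor powers of \<open>A\<close> are free on lists of such words.

  In degree \<open>m > 0\<close> the weight of the zeroth tensor factor, divided by \<open>m\<close>, splits the norm map as
  a map of complexes.  Hence \<open>HH\<^sub>n = HC\<^sub>n \<oplus> HC\<^sub>n\<^sub>-\<^sub>1\<close>, the rows of the
  cyclic bicomplex being exact; the same holds for the complex of tensors without unit factors, in
  which the reduced cyclic homology can be computed.  There the complex is contracted in high
  degrees by toggling a cut at a gap of the concatenated word not covered by a forbidden subword,
  so that \<open>HH\<^sub>n = 0\<close> for \<open>n \<ge> 4\<close> and \<open>HC\<^sub>n = 0\<close> for \<open>n \<ge> 3\<close>.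

  It remains to know \<open>HC\<^sub>0 - HC\<^sub>1 + HC\<^sub>2\<close>.  This Euler characteristic counts lists of words up
  to signed rotation; summed over the rotations it becomes a totient sum of coefficients of
  the logarithm of the Hilbert series of \<open>A\<close>, that is of \<open>(1 - t)\<^sup>-\<^sup>2 (1 - t\<^sup>2)\<^sup>-\<^sup>1\<close>, and equals 3
  for even and 2 for odd \<open>m\<close>.\<close>

section \<open>Linear maps between free vector spaces\<close>

text \<open>In a degree \<open>m > 0\<close> only three numbers are unknown, the dimensions c0, c1,
  c2 of cyclic homology: the Hochschild dimensions are c0, c0 + c1, c1 + c2, c2, so all five
  identities reduce to the value of c0 - c1 + c2, and t(2 + 3t)/(1 - t^2) is the series of these
  values. Two cyclic complexes are used because their merits are complementary. With unit factors
  allowed, inserting a unit contracts \<open>bp\<close>, but there are nonzero chains of weight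
  \<open>m\<close> in every degree and no Euler characteristic. Without unit factors a tensor of
  weight \<open>m\<close> has at most \<open>m\<close> factors, but \<open>bp\<close> need not be
  exact. The two are compared through dimensions: the Hochschild complex of all tensors is the sum
  of a contractible degenerate part and a normalised part, and the latter is a cone built from
  tensors without units. The obstacle in the vanishing is that toggling a cut respects only leading
  terms: a product of irreducible words is their concatenation only up to smaller words. Hence the
  filtration by length and value of the concatenated tail.\<close>

abbreviation lin :: "(('b \<Rightarrow>\<^sub>0 'k::field) \<Rightarrow> ('c \<Rightarrow>\<^sub>0 'k)) \<Rightarrow> bool" where
  "lin f \<equiv> Vector_Spaces.linear scal scal f"

abbreviation bas :: "'b \<Rightarrow> ('b \<Rightarrow>\<^sub>0 'k::field)" where
  "bas x \<equiv> Poly_Mapping.single x 1"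

abbreviation "keys \<equiv> Poly_Mapping.keys"
abbreviation "lookup \<equiv> Poly_Mapping.lookup"

interpretation free_pair: vector_space_pair scal scal ..

lemma linI:
  assumes "\<And>x y. f (x + y) = f x + f y" "\<And>c x. f (scal c x) = scal c (f x)"
  shows "lin f"
  by unfold_locales (auto simp: assms)

lemma lin_add: "lin f \<Longrightarrow> f (x + y) = f x + f y"
  and lin_scal: "lin f \<Longrightarrow> f (scal c x) = scal c (f x)"
  and lin_0: "lin f \<Longrightarrow> f 0 = 0"
  and lin_minus: "lin f \<Longrightarrow> f (- x) = - f x"
  and lin_diff: "lin f \<Longrightarrow> f (x - y) = f x - f y"
  and lin_sum: "lin f \<Longrightarrow> f (sum g A) = (\<Sum>a\<in>A. f (g a))"
  unfolding linear_iff_module_hom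
  by (rule module_hom.add module_hom.scale module_hom.zero module_hom.neg module_hom.diff module_hom.sum, assumption)+

lemmas lin_simps = lin_add lin_scal lin_0 lin_minus lin_diff lin_sum

lemma lin_comp: "lin f \<Longrightarrow> lin g \<Longrightarrow> lin (\<lambda>x. f (g x))"
  by (rule linI) (simp_all only: lin_add[of f] lin_add[of g] lin_scal[of f] lin_scal[of g])

lemma lin_plus: "lin f \<Longrightarrow> lin g \<Longrightarrow> lin (\<lambda>x. f x + g x)"
  by (rule linI) (simp_all add: lin_simps[of f] lin_simps[of g] algebra_simps)

lemma lin_minus_fun: "lin f \<Longrightarrow> lin g \<Longrightarrow> lin (\<lambda>x. f x - g x)"
  by (rule linI) (simp_all add: lin_simps[of f] lin_simps[of g] algebra_simps)

lemma lin_scal_fun: "lin f \<Longrightarrow> lin (\<lambda>x. scal c (f x))"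
  by (rule linI) (simp_all add: lin_simps[of f] free_vs.scale_right_distrib mult.commute)

lemma lin_id: "lin (\<lambda>x. x)"
  by (rule linI) simp_all

lemma lin_sum_fun: "(\<And>i. i \<in> I \<Longrightarrow> lin (f i)) \<Longrightarrow> lin (\<lambda>x. \<Sum>i\<in>I. f i x)"
proof (rule linI)
  fix x y c assume *: "\<And>i. i \<in> I \<Longrightarrow> lin (f i)"
  show "(\<Sum>i\<in>I. f i (x + y)) = (\<Sum>i\<in>I. f i x) + (\<Sum>i\<in>I. f i y)"
    unfolding sum.distrib[symmetric] by (rule sum.cong[OF refl]) (rule lin_add[OF *])
  show "(\<Sum>i\<in>I. f i (scal c x)) = scal c (\<Sum>i\<in>I. f i x)"
    unfolding free_vs.scale_sum_right by (rule sum.cong[OF refl]) (rule lin_scal[OF *])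
qed

lemma lin_funpow:
  fixes f :: "('b \<Rightarrow>\<^sub>0 'k::field) \<Rightarrow> ('b \<Rightarrow>\<^sub>0 'k)"
  shows "lin f \<Longrightarrow> lin (f ^^ k)"
proof (induction k)
  case 0
  show ?case unfolding funpow.simps id_def by (rule lin_id)
next
  case (Suc k)
  then show ?case using lin_comp[of f "f ^^ k"] by (simp add: o_def)
qed

lemma scal_single [simp]: "scal c (Poly_Mapping.single b a) = Poly_Mapping.single b (c * a)"
  by (rule poly_mapping_eqI) (simp add: lookup_single when_def)

lemma keys_scal: "keys (scal c x) \<subseteq> keys x"
  by (auto simp: in_keys_iff)

lemma lin_ext_superset:
  assumes "finite K" "keys x \<subseteq> K"
  shows "lin_ext f x = (\<Sum>b\<in>K. scal (lookup x b) (f b))"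
  unfolding lin_ext_def by (rule sum.mono_neutral_left) (use assms in \<open>auto simp: in_keys_iff\<close>)

lemma lin_lin_ext: "lin (lin_ext (f :: 'a \<Rightarrow> 'b \<Rightarrow>\<^sub>0 'c::field))"
proof (rule linI)
  fix x y :: "'a \<Rightarrow>\<^sub>0 'c"
  let ?K = "keys x \<union> keys y"
  show "lin_ext f (x + y) = lin_ext f x + lin_ext f y"
    by (subst (1 2 3) lin_ext_superset[where K = ?K])
      (use keys_add[of x y] in \<open>auto simp: lookup_add sum.distrib free_vs.scale_left_distrib\<close>)
next
  fix c and x :: "'a \<Rightarrow>\<^sub>0 'c"
  show "lin_ext f (scal c x) = scal c (lin_ext f x)"
    by (subst (1 2) lin_ext_superset[where K = "keys x"])
      (use keys_scal[of c x] in \<open>auto simp: free_vs.scale_sum_right\<close>)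
qed

lemmas lin_ext_simps = lin_simps[OF lin_lin_ext]

lemma lin_ext_single [simp]: "lin_ext f (Poly_Mapping.single b c) = scal c (f b)"
  by (subst lin_ext_superset[where K = "{b}"]) auto

lemma basis_expansion: "(\<Sum>b\<in>keys x. scal (lookup x b) (bas b)) = x"
  by (rule poly_mapping_eqI)
    (auto simp: lookup_sum lookup_single when_def in_keys_iff if_distrib[of "(*) _"] cong: if_cong)

lemma lin_expand: "lin f \<Longrightarrow> f x = (\<Sum>b\<in>keys x. scal (lookup x b) (f (bas b)))"
  by (subst basis_expansion[of x, symmetric]) (simp only: lin_sum[of f] lin_scal[of f])

lemma lin_eqI:
  assumes "lin f" "lin g" "\<And>b. b \<in> keys x \<Longrightarrow> f (bas b) = g (bas b)"
  shows "f x = g x"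
  using assms by (simp add: lin_expand[OF assms(1), of x] lin_expand[OF assms(2), of x])

lemma keys_lin:
  assumes "lin f" shows "keys (f x) \<subseteq> (\<Union>b\<in>keys x. keys (f (bas b)))"
  by (subst lin_expand[OF assms]) (rule subset_trans[OF keys_sum], rule UN_mono[OF order_refl keys_scal])

lemma keys_lin_ext: "keys (lin_ext f x) \<subseteq> (\<Union>b\<in>keys x. keys (f b))"
  using keys_lin[OF lin_lin_ext, of f x] by simp

lemma lin_ext_bas [simp]: "lin_ext bas x = x"
  using lin_eqI[OF lin_lin_ext lin_id, of x bas] by simp

lemma lin_imageI: "lin f \<Longrightarrow> free_vs.subspace S \<Longrightarrow> free_vs.subspace (f ` S)"
  by (simp add: linear_iff_module_hom module_hom.subspace_image)

lemma lin_kernelI: "lin f \<Longrightarrow> free_vs.subspace S \<Longrightarrow> free_vs.subspace {x \<in> S. f x = 0}"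
  by (auto simp: free_vs.subspace_def lin_simps[of f])

lemma lin_preimageI: 
  "lin f \<Longrightarrow> free_vs.subspace S \<Longrightarrow> free_vs.subspace T \<Longrightarrow> free_vs.subspace {x \<in> S. f x \<in> T}"
  by (auto simp: free_vs.subspace_def lin_simps[of f])

text \<open>The span of the basis vectors in \<open>S\<close>, encoded by supports, so that
  membership is a subset test.\<close>

definition spn :: "'b set \<Rightarrow> ('b \<Rightarrow>\<^sub>0 'k::field) set" where
  "spn S = {x. keys x \<subseteq> S}"

lemma subspace_spn [simp]: "free_vs.subspace (spn S :: ('a \<Rightarrow>\<^sub>0 'b::field) set)"
proof (unfold free_vs.subspace_def spn_def, intro conjI ballI allI CollectI; (elim CollectE)?)
  show "keys (0 :: 'a \<Rightarrow>\<^sub>0 'b) \<subseteq> S" by simp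
  show "keys (x + y) \<subseteq> S" if "keys x \<subseteq> S" "keys y \<subseteq> S" for x y :: "'a \<Rightarrow>\<^sub>0 'b"
    using keys_add[of x y] that by blast
  show "keys (scal c x) \<subseteq> S" if "keys x \<subseteq> S" for c and x :: "'a \<Rightarrow>\<^sub>0 'b"
    using keys_scal[of c x] that by blast
qed

lemma spn_mono: "S \<subseteq> T \<Longrightarrow> spn S \<subseteq> spn T"
  by (auto simp: spn_def)

lemma bas_in_spn [simp]: "bas b \<in> spn S \<longleftrightarrow> b \<in> S"
  by (simp add: spn_def)

lemma span_bas: "free_vs.span (bas ` S :: ('a \<Rightarrow>\<^sub>0 'b::field) set) = spn S"
proof (rule free_vs.span_subspace[of "bas ` S :: ('a \<Rightarrow>\<^sub>0 'b) set"])
  show "spn S \<subseteq> free_vs.span (bas ` S :: ('a \<Rightarrow>\<^sub>0 'b) set)"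
  proof
    fix x :: "'a \<Rightarrow>\<^sub>0 'b" assume "x \<in> spn S"
    then have "(\<Sum>b\<in>keys x. scal (lookup x b) (bas b)) \<in> free_vs.span (bas ` S)"
      unfolding spn_def by (intro free_vs.span_sum free_vs.span_scale free_vs.span_base) auto
    then show "x \<in> free_vs.span (bas ` S)" by (simp only: basis_expansion)
  qed
qed auto

lemma lin_spnI:
  assumes "lin f" "x \<in> spn S" "free_vs.subspace V" "\<And>b. b \<in> S \<Longrightarrow> f (bas b) \<in> V"
  shows "f x \<in> V"
  using assms by (subst lin_expand[OF assms(1)])
    (auto intro!: free_vs.subspace_sum free_vs.subspace_scale simp: spn_def)

lemma lin_spn_eqI:
  assumes "x \<in> spn S" "lin f" "lin g" "\<And>b. b \<in> S \<Longrightarrow> f (bas b) = g (bas b)"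
  shows "f x = g x"
  by (rule lin_eqI) (use assms in \<open>auto simp: spn_def\<close>)

section \<open>Dimensions of finitely spanned subspaces\<close>

text \<open>The ambient spaces are infinite-dimensional, and \<open>free_vs.dim\<close> is 0 on a
  subspace without a finite basis; this predicate guards every dimension count.\<close>

definition fd :: "('b \<Rightarrow>\<^sub>0 'k::field) set \<Rightarrow> bool" where
  "fd V \<longleftrightarrow> free_vs.subspace V \<and> (\<exists>B. finite B \<and> V \<subseteq> free_vs.span B)"

lemma fd_subspace: "fd V \<Longrightarrow> free_vs.subspace V"
  by (simp add: fd_def)

lemma fd_mono: "fd V \<Longrightarrow> free_vs.subspace U \<Longrightarrow> U \<subseteq> V \<Longrightarrow> fd U"
  unfolding fd_def by blast

lemma fd_spn: "finite S \<Longrightarrow> fd (spn S)"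
  unfolding fd_def by (metis finite_imageI order_refl span_bas subspace_spn)

lemma fd_image: "lin f \<Longrightarrow> fd V \<Longrightarrow> fd (f ` V)"
  unfolding fd_def
  by (metis finite_imageI image_mono lin_imageI linear_iff_module_hom module_hom.span_image)

lemma independent_bas: "free_vs.independent (bas ` S :: ('b \<Rightarrow>\<^sub>0 'k::field) set)"
  unfolding free_vs.dependent_def
proof safe
  fix b :: 'b assume "b \<in> S" and *: "(bas b :: 'b \<Rightarrow>\<^sub>0 'k) \<in> free_vs.span (bas ` S - {bas b})"
  have "bas ` S - {bas b :: 'b \<Rightarrow>\<^sub>0 'k} \<subseteq> bas ` (S - {b})" by auto
  with * have "(bas b :: 'b \<Rightarrow>\<^sub>0 'k) \<in> spn (S - {b})"
    unfolding span_bas[symmetric] using free_vs.span_mono by blast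
  then show False by simp
qed

lemma dim_spn: "finite S \<Longrightarrow> free_vs.dim (spn S :: ('b \<Rightarrow>\<^sub>0 'k::field) set) = card S"
proof -
  assume "finite S"
  have "free_vs.dim (spn S :: ('b \<Rightarrow>\<^sub>0 'k::field) set) = card (bas ` S :: ('b \<Rightarrow>\<^sub>0 'k) set)"
    unfolding span_bas[symmetric] by (rule free_vs.dim_span_eq_card_independent[OF independent_bas])
  also have "\<dots> = card S"
    by (rule card_image) (auto intro!: inj_onI dest: arg_cong[where f = keys])
  finally show ?thesis .
qed

text \<open>A basis of \<open>U\<close> is extended to the whole space; \<open>g\<close> kills the
  first part and fixes the rest. This replaces quotient spaces: working modulo \<open>U\<close>
  becomes applying \<open>g\<close>.\<close>

lemma exists_projection:
  fixes U :: "('b \<Rightarrow>\<^sub>0 'k::field) set"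
  assumes "free_vs.subspace U"
  obtains g where "lin g" "\<And>x. g (g x) = g x" "\<And>x. g x = 0 \<longleftrightarrow> x \<in> U" "\<And>x. x - g x \<in> U"
proof -
  obtain B0 where B0: "B0 \<subseteq> U" "free_vs.independent B0" "U \<subseteq> free_vs.span B0"
    using free_vs.maximal_independent_subset .
  obtain B where B: "B0 \<subseteq> B" "free_vs.independent B" "UNIV \<subseteq> free_vs.span B"
    using free_vs.maximal_independent_subset_extend[OF subset_UNIV B0(2)] by metis
  obtain g :: "('b \<Rightarrow>\<^sub>0 'k) \<Rightarrow> ('b \<Rightarrow>\<^sub>0 'k)"
    where g: "lin g" "\<forall>x\<in>B. g x = (if x \<in> B0 then 0 else x)"
    using free_pair.linear_independent_extend[OF B(2), of "\<lambda>x. if x \<in> B0 then 0 else x"] by blast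
  have inB: "x \<in> free_vs.span B" for x using B(3) by auto
  have gg: "g (g x) = g x" for x
    using inB[of x] by (induction rule: free_vs.span_induct_alt) (use g in \<open>auto simp: lin_simps[of g]\<close>)
  have gU: "x - g x \<in> U" for x
    using inB[of x]
  proof (induction rule: free_vs.span_induct_alt)
    case base
    then show ?case using assms g(1) by (simp add: lin_0[of g] free_vs.subspace_0)
  next
    case (step c a y)
    have "a - g a \<in> U" using step(1) g(2) B0(1) assms by (auto simp: free_vs.subspace_0)
    then have "scal c (a - g a) + (y - g y) \<in> U"
      using step assms by (metis free_vs.subspace_add free_vs.subspace_scale)
    then show ?case using g(1) by (simp add: lin_simps[of g] algebra_simps)
  qed
  have "g x = 0" if "x \<in> U" for x
  proof -
    have "x \<in> free_vs.span B0" using that B0(3) by auto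
    then show ?thesis
      by (induction rule: free_vs.span_induct_alt) (use g B(1) in \<open>auto simp: lin_simps[of g]\<close>)
  qed
  with gU have "g x = 0 \<longleftrightarrow> x \<in> U" for x by (metis diff_zero)
  with that g(1) gg gU show thesis by blast
qed

lemma rank_nullity:
  fixes f :: "('b \<Rightarrow>\<^sub>0 'k::field) \<Rightarrow> ('c \<Rightarrow>\<^sub>0 'k)"
  assumes f: "lin f" and V: "fd V"
  shows "free_vs.dim V = free_vs.dim (f ` V) + free_vs.dim {x \<in> V. f x = 0}"
proof -
  let ?K = "{x \<in> V. f x = 0}"
  have sV: "free_vs.subspace V" using V by (simp add: fd_def)
  obtain S where S: "finite S" "V \<subseteq> free_vs.span S" using V by (auto simp: fd_def)
  have sK: "free_vs.subspace ?K" by (rule lin_kernelI[OF f sV])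
  obtain B0 where B0: "B0 \<subseteq> ?K" "free_vs.independent B0" "?K \<subseteq> free_vs.span B0"
    using free_vs.maximal_independent_subset .
  obtain B where B: "B0 \<subseteq> B" "B \<subseteq> V" "free_vs.independent B" "V \<subseteq> free_vs.span B"
    using free_vs.maximal_independent_subset_extend[of B0 V] B0 by blast
  have finB: "finite B" using free_vs.independent_span_bound[OF S(1) B(3)] B(2) S(2) by auto
  obtain g :: "('b \<Rightarrow>\<^sub>0 'k) \<Rightarrow> ('b \<Rightarrow>\<^sub>0 'k)"
    where g: "lin g" "\<forall>x\<in>B. g x = (if x \<in> B0 then 0 else x)"
    using free_pair.linear_independent_extend[OF B(3), of "\<lambda>x. if x \<in> B0 then 0 else x"] by blast
  have g0: "g x = 0" if "x \<in> free_vs.span B0" for x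
    using that by (induction rule: free_vs.span_induct_alt) (use g B(1) in \<open>auto simp: lin_simps[of g]\<close>)
  have g1: "g x = x" if "x \<in> free_vs.span (B - B0)" for x
    using that by (induction rule: free_vs.span_induct_alt) (use g B(1) in \<open>auto simp: lin_simps[of g]\<close>)
  have spV: "free_vs.span (B - B0) \<subseteq> V"
    by (rule free_vs.span_minimal) (use B sV in auto)
  have inj: "inj_on f (free_vs.span (B - B0))"
  proof (rule inj_onI)
    fix x y assume xy: "x \<in> free_vs.span (B - B0)" "y \<in> free_vs.span (B - B0)" "f x = f y"
    then have d: "x - y \<in> free_vs.span (B - B0)" by (simp add: free_vs.span_diff)
    moreover have "f (x - y) = 0" using xy f by (simp add: lin_diff[of f])
    ultimately have "x - y \<in> free_vs.span B0" using spV B0(3) by blast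
    with d g0 g1 have "x - y = 0" by metis
    then show "x = y" by simp
  qed
  have fm: "module_hom scal scal f" using f by (simp add: linear_iff_module_hom)
  have ind: "free_vs.independent (f ` (B - B0))"
    by (rule module_hom.independent_injective_image[OF fm _ inj])
      (rule free_vs.independent_mono[OF B(3)], auto)
  have "f ` V = free_vs.span (f ` (B - B0))"
  proof
    show "f ` V \<subseteq> free_vs.span (f ` (B - B0))"
    proof -
      have "f ` V \<subseteq> free_vs.span (f ` B)" using module_hom.spans_image[OF fm B(4)] .
      also have "f ` B \<subseteq> insert 0 (f ` (B - B0))" using B0(1) by auto
      then have "free_vs.span (f ` B) \<subseteq> free_vs.span (f ` (B - B0))"
        by (metis free_vs.span_insert_0 free_vs.span_mono)
      finally show ?thesis .
    qed
    show "free_vs.span (f ` (B - B0)) \<subseteq> f ` V"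
      by (rule free_vs.span_minimal) (use B lin_imageI[OF f sV] in auto)
  qed
  then have "free_vs.dim (f ` V) = card (f ` (B - B0))"
    using free_vs.dim_span_eq_card_independent[OF ind] by simp
  also have "\<dots> = card (B - B0)"
    by (rule card_image) (rule inj_on_subset[OF inj free_vs.span_superset])
  finally have 1: "free_vs.dim (f ` V) = card (B - B0)" .
  have 2: "free_vs.dim ?K = card B0" using free_vs.basis_card_eq_dim[OF B0(1,3,2)] by simp
  have 3: "free_vs.dim V = card B" using free_vs.basis_card_eq_dim[OF B(2,4,3)] by simp
  show ?thesis unfolding 1 2 3 using B(1) finB
    by (metis card_Diff_subset card_mono finite_subset le_add_diff_inverse2)
qed

lemma dim_inj_image:
  fixes f :: "('b \<Rightarrow>\<^sub>0 'k::field) \<Rightarrow> ('c \<Rightarrow>\<^sub>0 'k)"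
  assumes "lin f" "fd V" "\<And>x. x \<in> V \<Longrightarrow> f x = 0 \<Longrightarrow> x = 0"
  shows "free_vs.dim (f ` V) = free_vs.dim V"
proof -
  have "{x \<in> V. f x = 0} = {0}"
    using assms fd_subspace[OF assms(2)] by (auto simp: free_vs.subspace_0 lin_0[OF assms(1)])
  moreover have "free_vs.dim {0 :: 'b \<Rightarrow>\<^sub>0 'k} = 0"
    by (metis card.empty free_vs.dim_span_eq_card_independent free_vs.independent_empty free_vs.span_empty)
  ultimately show ?thesis using rank_nullity[OF assms(1,2)] by simp
qed

lemma dim_fd_mono: "fd (V :: ('b \<Rightarrow>\<^sub>0 'k::field) set) \<Longrightarrow> free_vs.subspace U \<Longrightarrow> U \<subseteq> V \<Longrightarrow> free_vs.dim U \<le> free_vs.dim V"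
proof -
  assume V: "fd V" and U: "free_vs.subspace U" "U \<subseteq> V"
  obtain g :: "('b \<Rightarrow>\<^sub>0 'k) \<Rightarrow> ('b \<Rightarrow>\<^sub>0 'k)" where g: "lin g" "\<And>x. g x = 0 \<longleftrightarrow> x \<in> U" using exists_projection[OF U(1)] by metis
  have "{x \<in> V. g x = 0} = U" using U g by auto
  then show ?thesis using rank_nullity[OF g(1) V] by simp
qed

lemma dim_complement:
  fixes V :: "('b \<Rightarrow>\<^sub>0 'k::field) set"
  assumes V: "fd V" and C: "free_vs.subspace C" and U: "free_vs.subspace U"
    and CU: "C \<inter> U = {0}" "{c + u | c u. c \<in> C \<and> u \<in> U} = V"
  shows "free_vs.dim V = free_vs.dim C + free_vs.dim U"
proof -
  have CV: "C \<subseteq> V" and UV: "U \<subseteq> V" using CU(2) C U free_vs.subspace_0 by force+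
  obtain g :: "('b \<Rightarrow>\<^sub>0 'k) \<Rightarrow> ('b \<Rightarrow>\<^sub>0 'k)" where g: "lin g" "\<And>x. g x = 0 \<longleftrightarrow> x \<in> U" using exists_projection[OF U] by metis
  have 1: "{x \<in> V. g x = 0} = U" using UV g by auto
  have "g (c + u) = g c" if "u \<in> U" for c u using that g by (simp add: lin_add[of g])
  then have 2: "g ` V = g ` C" unfolding CU(2)[symmetric]
    by (auto simp: image_iff) (metis U free_vs.subspace_0)
  have "free_vs.dim (g ` C) = free_vs.dim C"
    by (rule dim_inj_image[OF g(1) fd_mono[OF V C CV]]) (use g CU(1) in auto)
  then show ?thesis using rank_nullity[OF g(1) V] 1 2 by simp
qed

text \<open>\<open>V\<close> may be infinite-dimensional, as spaces of lists of algebra elements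
  are. Homology becomes computable through a linear \<open>L\<close> onto a finite-dimensional
  \<open>V'\<close> under which \<open>W\<close> corresponds to \<open>W'\<close>: the chosen
  complement of \<open>V \<inter> W\<close> is carried isomorphically onto a complement of
  \<open>W'\<close>. The additive form avoids subtraction of natural numbers.\<close>

lemma quot_dim_transfer:
  fixes L :: "('b \<Rightarrow>\<^sub>0 'k::field) \<Rightarrow> ('c \<Rightarrow>\<^sub>0 'k)"
  assumes L: "lin L" and V: "free_vs.subspace V" and W: "free_vs.subspace W"
    and V': "fd V'" and W': "free_vs.subspace W'" "W' \<subseteq> V'" and im: "L ` V = V'"
    and iff: "\<And>x. x \<in> V \<Longrightarrow> x \<in> W \<longleftrightarrow> L x \<in> W'"
  shows "quot_dim V W + free_vs.dim W' = free_vs.dim V'"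
proof -
  have VW: "free_vs.subspace (V \<inter> W)" using V W by (rule free_vs.subspace_inter)
  let ?P = "\<lambda>C. free_vs.subspace C \<and> C \<inter> (V \<inter> W) = {0} \<and> {c + w | c w. c \<in> C \<and> w \<in> V \<inter> W} = V"
  obtain g where g: "lin g" "\<And>x. g (g x) = g x" "\<And>x. g x = 0 \<longleftrightarrow> x \<in> V \<inter> W" "\<And>x. x - g x \<in> V \<inter> W"
    using exists_projection[OF VW] by metis
  have gV: "g x \<in> V" if "x \<in> V" for x
    using free_vs.subspace_diff[OF V that, of "x - g x"] g(4)[of x] by simp
  \<comment> \<open>A complement exists, so the choice in \<open>quot_dim\<close> really picks
    one.\<close>
  have "?P (g ` V)"
  proof (intro conjI)
    show "free_vs.subspace (g ` V)" by (rule lin_imageI[OF g(1) V])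
    show "g ` V \<inter> (V \<inter> W) = {0}"
      proof -
      have "0 \<in> V \<inter> W" using VW by (rule free_vs.subspace_0)
      moreover from this have "g 0 = 0" using g(3) by blast
      moreover have "g x = 0" if "g x \<in> V \<inter> W" for x using that g(2,3) by metis
      ultimately show ?thesis by (force simp: image_iff)
    qed
    show "{c + w | c w. c \<in> g ` V \<and> w \<in> V \<inter> W} = V"
    proof
      show "{c + w | c w. c \<in> g ` V \<and> w \<in> V \<inter> W} \<subseteq> V" using gV V by (auto intro: free_vs.subspace_add)
      show "V \<subseteq> {c + w | c w. c \<in> g ` V \<and> w \<in> V \<inter> W}"
      proof
        fix x assume x: "x \<in> V"
        have "x = g x + (x - g x)" by simp
        with x g(4)[of x] show "x \<in> {c + w | c w. c \<in> g ` V \<and> w \<in> V \<inter> W}" by blast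
      qed
    qed
  qed
  then have P: "?P (SOME C. ?P C)" by (rule someI[of ?P])
  define C where "C = (SOME C. ?P C)"
  have C: "free_vs.subspace C" "C \<inter> (V \<inter> W) = {0}" "{c + w | c w. c \<in> C \<and> w \<in> V \<inter> W} = V"
    using P unfolding C_def by auto
  have CV: "C \<subseteq> V" using C(3) VW free_vs.subspace_0[OF VW] by force
  have inj0: "c = 0" if "c \<in> C" "L c \<in> W'" for c using that C(2) CV iff by auto
  obtain B where B: "B \<subseteq> C" "free_vs.independent B" "C \<subseteq> free_vs.span B"
    using free_vs.maximal_independent_subset .
  have spB: "free_vs.span B = C" using B C(1) by (simp add: free_vs.span_subspace)
  have inj: "inj_on L (free_vs.span B)" unfolding spB
  proof (rule inj_onI)
    fix x y assume "x \<in> C" "y \<in> C" "L x = L y"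
    then show "x = y" using inj0[of "x - y"] C(1) L W'(1)
      by (simp add: free_vs.subspace_diff lin_diff[of L] free_vs.subspace_0)
  qed
  have Lm: "module_hom scal scal L" using L by (simp add: linear_iff_module_hom)
  have ind: "free_vs.independent (L ` B)" by (rule module_hom.independent_injective_image[OF Lm B(2) inj])
  obtain S where S: "finite S" "V' \<subseteq> free_vs.span S" using V' by (auto simp: fd_def)
  \<comment> \<open>\<open>V\<close> gives no bound on \<open>B\<close>; finiteness comes from its
    injective image in \<open>V'\<close>.\<close>
  have "finite (L ` B)" using free_vs.independent_span_bound[OF S(1) ind] B(1) CV im S(2) by blast
  then have "finite B" using inj inj_on_subset[OF inj free_vs.span_superset] finite_imageD by blast
  then have fdC: "fd C" using C(1) B(3) by (auto simp: fd_def)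
  have "free_vs.dim (L ` C) = free_vs.dim C"
    by (rule dim_inj_image[OF L fdC]) (use inj0 W' free_vs.subspace_0[OF W'(1)] in auto)
  moreover have "free_vs.dim V' = free_vs.dim (L ` C) + free_vs.dim W'"
  proof (rule dim_complement[OF V' _ W'(1)])
    show "free_vs.subspace (L ` C)" by (rule lin_imageI[OF L C(1)])
    show "L ` C \<inter> W' = {0}"
      proof -
      have "0 \<in> C" "0 \<in> W'" "L 0 = 0" using C(1) W'(1) L by (auto simp: free_vs.subspace_0 lin_0[of L])
      then show ?thesis using inj0 by (force simp: image_iff)
    qed
    show "{c + u | c u. c \<in> L ` C \<and> u \<in> W'} = V'"
    proof
      show "{c + u | c u. c \<in> L ` C \<and> u \<in> W'} \<subseteq> V'"
        using im CV W'(2) fd_subspace[OF V'] by (auto intro!: free_vs.subspace_add)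
      show "V' \<subseteq> {c + u | c u. c \<in> L ` C \<and> u \<in> W'}"
      proof
        fix y assume "y \<in> V'"
        then obtain x where x: "x \<in> V" "y = L x" using im by auto
        then obtain c w where cw: "c \<in> C" "w \<in> V" "w \<in> W" "x = c + w" using C(3) by blast
        then show "y \<in> {c + u | c u. c \<in> L ` C \<and> u \<in> W'}" using x L iff by (auto simp: lin_add[of L])
      qed
    qed
  qed
  ultimately show ?thesis unfolding quot_dim_def C_def[symmetric] by simp
qed

text \<open>The trace of a projection is its rank. The equation lives in the field and determines
  the rank in characteristic 0; the dimension of the invariants under signed rotation is later read
  off from fixed lists in this way.\<close>

lemma trace_idempotent:
  fixes P :: "('b \<Rightarrow>\<^sub>0 'k::field) \<Rightarrow> ('b \<Rightarrow>\<^sub>0 'k)"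
  assumes P: "lin P" and S: "finite S" and PV: "P ` spn S \<subseteq> spn S"
    and PP: "\<And>x. x \<in> spn S \<Longrightarrow> P (P x) = P x"
  shows "of_nat (free_vs.dim (P ` spn S)) = (\<Sum>s\<in>S. lookup (P (bas s)) s)"
proof -
  have fdV: "fd (P ` spn S)" by (rule fd_image[OF P fd_spn[OF S]])
  obtain B where B: "B \<subseteq> P ` spn S" "free_vs.independent B" "P ` spn S \<subseteq> free_vs.span B"
    using free_vs.maximal_independent_subset .
  obtain T where T: "finite T" "P ` spn S \<subseteq> free_vs.span T" using fdV by (auto simp: fd_def)
  have finB: "finite B" using free_vs.independent_span_bound[OF T(1) B(2)] B(1) T(2) by auto
  \<comment> \<open>Coordinates with respect to the basis \<open>B\<close> of the image. The trace
    over \<open>S\<close> is rewritten as a trace over \<open>B\<close>, on which \<open>P\<close>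
    is the identity.\<close>
  define F where "F b v = free_vs.representation B v b" for b v
  have Fadd: "F b (x + y) = F b x + F b y"
    if "x \<in> free_vs.span B" "y \<in> free_vs.span B" for b x y
    using that by (simp add: F_def free_vs.representation_add[OF B(2)])
  have Fscal: "F b (scal c x) = c * F b x" if "x \<in> free_vs.span B" for b x c
    using that by (simp add: F_def free_vs.representation_scale[OF B(2)])
  have inB: "P (bas s) \<in> free_vs.span B" if "s \<in> S" for s by (rule subsetD[OF B(3)], rule imageI) (simp add: that)
  have "(\<Sum>s\<in>S. lookup (P (bas s)) s)
      = (\<Sum>s\<in>S. \<Sum>b\<in>B. F b (P (bas s)) * lookup b s)"
  proof (rule sum.cong[OF refl])
    fix s assume "s \<in> S"
    have "P (bas s) = (\<Sum>b\<in>B. scal (F b (P (bas s))) b)"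
      unfolding F_def by (rule free_vs.sum_representation_eq[symmetric, OF B(2) inB[OF \<open>s \<in> S\<close>] finB]) auto
    then show "lookup (P (bas s)) s = (\<Sum>b\<in>B. F b (P (bas s)) * lookup b s)"
      by (metis (mono_tags, lifting) lookup_scal lookup_sum sum.cong)
  qed
  also have "\<dots> = (\<Sum>b\<in>B. \<Sum>s\<in>S. F b (P (bas s)) * lookup b s)" by (rule sum.swap)
  also have "\<dots> = (\<Sum>b\<in>B. 1)"
  proof (rule sum.cong[OF refl])
    fix b assume b: "b \<in> B"
    then have bS: "b \<in> spn S" using B(1) PV by auto
    have Pb: "P b = b" using b B(1) PP by auto
    have fsum: "F b (\<Sum>s\<in>A. scal (lookup b s) (P (bas s)))
       = (\<Sum>s\<in>A. lookup b s * F b (P (bas s)))" if "A \<subseteq> S" for A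
      using finite_subset[OF that S] that
    proof (induction A rule: finite_induct)
      case empty then show ?case by (simp add: F_def free_vs.representation_zero)
    next
      case (insert a A)
      then show ?case
        by (simp add: Fadd Fscal inB free_vs.span_scale free_vs.span_sum subset_iff)
    qed
    have "b = P (\<Sum>s\<in>S. scal (lookup b s) (bas s))"
      using lin_ext_superset[OF S, of b bas] bS Pb by (simp add: spn_def)
    also have "\<dots> = (\<Sum>s\<in>S. scal (lookup b s) (P (bas s)))"
      using P by (simp add: lin_sum[of P] lin_scal[of P] del: scal_single)
    finally have "F b b = F b (\<Sum>s\<in>S. scal (lookup b s) (P (bas s)))" by (rule arg_cong)
    then have "F b b = (\<Sum>s\<in>S. lookup b s * F b (P (bas s)))" unfolding fsum[OF order_refl] .
    moreover have "F b b = 1" unfolding F_def using free_vs.representation_basis[OF B(2) b] by simp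
    ultimately show "(\<Sum>s\<in>S. F b (P (bas s)) * lookup b s) = 1" by (simp add: mult.commute)
  qed
  also have "\<dots> = of_nat (card B)" by simp
  also have "card B = free_vs.dim (P ` spn S)" by (rule free_vs.basis_card_eq_dim[OF B(1,3,2)])
  finally show ?thesis by simp
qed

section \<open>Normal forms in the down-up algebra\<close>

lemma single_mult_list [simp]:
  "Poly_Mapping.single (xs :: 'g list) a * Poly_Mapping.single ys b = Poly_Mapping.single (xs @ ys) (a * b)"
  by (simp add: mult_single plus_list_def)

lemma one_eq_bas: "(1 :: 'g list \<Rightarrow>\<^sub>0 'k::field) = bas []"
  by (metis single_one zero_list_def)

lemma scal_mult_left: "scal c x * y = scal c (x * y :: 'g list \<Rightarrow>\<^sub>0 'k::field)"
  unfolding scal_def mult_map_scale_conv_mult by (simp add: mult.assoc)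

lemma lin_mult_right: "lin f \<Longrightarrow> lin (\<lambda>x. f x * (y :: 'g list \<Rightarrow>\<^sub>0 'k::field))"
  by (rule linI) (simp_all add: lin_add[of f] lin_scal[of f] scal_mult_left distrib_right)

lemma scal_mult_right: "x * scal c y = scal c (x * y :: 'g list \<Rightarrow>\<^sub>0 'k::field)"
proof -
  have "x * Poly_Mapping.single [] c = scal c x"
    using lin_eqI[OF lin_mult_right[OF lin_id, of "Poly_Mapping.single [] c"] lin_scal_fun[OF lin_id, of c], of x]
    by simp
  moreover have "scal c y = Poly_Mapping.single [] c * y"
    by (metis mult_map_scale_conv_mult scal_def zero_list_def)
  ultimately show ?thesis by (metis mult.assoc scal_mult_left)
qed

lemma lin_mult_left: "lin f \<Longrightarrow> lin (\<lambda>x. (y :: 'g list \<Rightarrow>\<^sub>0 'k::field) * f x)"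
  by (rule linI) (simp_all add: lin_add[of f] lin_scal[of f] scal_mult_right distrib_left)

lemmas scal_mult = scal_mult_left scal_mult_right

lemma spn_mult:
  fixes x y :: "'g list \<Rightarrow>\<^sub>0 'k::field"
  assumes "x \<in> spn S" "y \<in> spn T" "\<And>p q. p \<in> S \<Longrightarrow> q \<in> T \<Longrightarrow> p @ q \<in> U"
  shows "x * y \<in> spn U"
  unfolding spn_def
proof (intro CollectI subsetI)
  fix b assume "b \<in> keys (x * y)"
  then obtain p q where "b = p @ q" "p \<in> keys x" "q \<in> keys y"
    using keys_mult[of x y] unfolding plus_list_def by blast
  then show "b \<in> U" using assms unfolding spn_def by blast
qed

text \<open>A word read as a binary number with \<open>d\<close> as 1 and \<open>u\<close> as 0.
  Both reducts of \<open>d b u\<close> have the same length and a smaller value, which gives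
  termination and, later, the notion of a leading term.\<close>

fun bval :: "gen list \<Rightarrow> nat" where
  "bval [] = 0"
| "bval (x # q) = (if x = Gen_d then 2 ^ length q else 0) + bval q"

lemma bval_append: "bval (p @ q) = bval p * 2 ^ length q + bval q"
  by (induction p) (auto simp: power_add algebra_simps)

lemma bval_less: "bval w < 2 ^ length w"
  by (induction w) auto

text \<open>The two relations have the uniform shape \<open>d b u = \<alpha> \<cdot> mid b + \<beta> \<cdot> u b d\<close>.\<close>

definition mid :: "gen \<Rightarrow> gen list" where
  "mid b = (if b = Gen_d then [Gen_d, Gen_u, Gen_d] else [Gen_u, Gen_d, Gen_u])"

lemma length_mid [simp]: "length (mid b) = 3" by (simp add: mid_def)

lemma gen_neq: "x \<noteq> Gen_d \<longleftrightarrow> x = Gen_u" "x \<noteq> Gen_u \<longleftrightarrow> x = Gen_d"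
  by (cases x; simp)+

text \<open>One step at the leftmost forbidden subword; the two results are the words that receive
  the coefficients \<alpha> and \<beta>.\<close>

fun red :: "gen list \<Rightarrow> (gen list \<times> gen list) option" where
  "red (x # b # z # q) = (if x = Gen_d \<and> z = Gen_u then Some (mid b @ q, [Gen_u, b, Gen_d] @ q)
     else map_option (map_prod ((#) x) ((#) x)) (red (b # z # q)))"
| "red q = None"

lemma red_Some:
  "red w = Some (x, y) \<Longrightarrow>
   \<exists>p b q. w = p @ [Gen_d, b, Gen_u] @ q \<and> x = p @ mid b @ q \<and> y = p @ [Gen_u, b, Gen_d] @ q"
proof (induction w arbitrary: x y rule: red.induct)
  case (1 a b z q)
  show ?case
  proof (cases "a = Gen_d \<and> z = Gen_u")
    case True
    then show ?thesis using 1(2) by (intro exI[of _ "[]"] exI[of _ b] exI[of _ q]) auto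
  next
    case False
    then obtain x' y' where "red (b # z # q) = Some (x', y')" "x = a # x'" "y = a # y'" using 1(2) by (auto split: if_splits)
    with 1(1)[OF False] obtain p b' q' where "b # z # q = p @ [Gen_d, b', Gen_u] @ q'"
      "x' = p @ mid b' @ q'" "y' = p @ [Gen_u, b', Gen_d] @ q'" by blast
    then show ?thesis using \<open>x = _\<close> \<open>y = _\<close>
      by (intro exI[of _ "a # p"] exI[of _ b'] exI[of _ q']) auto
  qed
qed auto

definition irr :: "gen list \<Rightarrow> bool" where "irr w \<longleftrightarrow> red w = None"

lemma red_None: "red w = None \<longleftrightarrow> (\<forall>i. i + 2 < length w \<longrightarrow> \<not> (w ! i = Gen_d \<and> w ! (i + 2) = Gen_u))"
proof (induction w rule: red.induct)
  case (1 a b z q)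
  have split: "(\<forall>i. P i) \<longleftrightarrow> P 0 \<and> (\<forall>i. P (Suc i))" for P :: "nat \<Rightarrow> bool"
    by (metis not0_implies_Suc)
  show ?case using 1 by (subst split) auto
qed auto

lemma irr_iff: "irr w \<longleftrightarrow> (\<forall>i. i + 2 < length w \<longrightarrow> \<not> (w ! i = Gen_d \<and> w ! (i + 2) = Gen_u))"
  by (simp add: irr_def red_None)

lemma not_irr_redex: "\<not> irr (p @ [Gen_d, b, Gen_u] @ q)"
  unfolding irr_iff by (auto intro!: exI[of _ "length p"] simp: nth_append)

lemma irr_factor: "irr (p @ w @ q) \<Longrightarrow> irr w"
  unfolding irr_def using red_Some[of w] not_irr_redex[unfolded irr_def]
  by (cases "red w") (force, metis append.assoc surj_pair)

lemma irr_Nil [simp]: "irr []" and irr_single [simp]: "irr [x]"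
  by (simp_all add: irr_def)

text \<open>An overlap in one letter would identify the final \<open>u\<close> of one forbidden
  subword with the initial \<open>d\<close> of the other. So two of them are disjoint or share two
  letters inside \<open>d d u u\<close>.\<close>

lemma redex_cases:
  assumes "p0 @ [Gen_d, b0, Gen_u] @ q0 = p @ [Gen_d, b, Gen_u] @ q" "length p0 < length p"
  obtains "p = p0 @ [Gen_d]" "b0 = Gen_d" "b = Gen_u" "q0 = Gen_u # q"
    | s where "p = p0 @ [Gen_d, b0, Gen_u] @ s" "q0 = s @ [Gen_d, b, Gen_u] @ q"
proof -
  obtain s where s: "p = p0 @ s" "[Gen_d, b0, Gen_u] @ q0 = s @ [Gen_d, b, Gen_u] @ q"
    using assms by (auto simp: append_eq_append_conv2)
  have "s \<noteq> []" using s assms(2) by auto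
  show thesis
    using s \<open>s \<noteq> []\<close> that by (auto simp: Cons_eq_append_conv append_eq_Cons_conv)
qed

locale down_up_algebra =
  fixes \<alpha> \<beta> :: "'k::field_char_0"
begin

function nf :: "gen list \<Rightarrow> (gen list \<Rightarrow>\<^sub>0 'k)" where
  "nf w = (case red w of None \<Rightarrow> bas w | Some (x, y) \<Rightarrow> scal \<alpha> (nf x) + scal \<beta> (nf y))"
  by auto

lemma bval_reduct:
  "bval (p @ mid b @ q) < bval (p @ [Gen_d, b, Gen_u] @ q)"
  "bval (p @ [Gen_u, b, Gen_d] @ q) < bval (p @ [Gen_d, b, Gen_u] @ q)"
  by (auto simp: bval_append mid_def gen_neq)

termination
proof (relation "measure bval", simp, goal_cases)
  case (1 w a x y)
  with red_Some[of w x y] bval_reduct show ?case by fastforce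
next
  case (2 w a x y)
  with red_Some[of w x y] bval_reduct show ?case by fastforce
qed

declare nf.simps [simp del]

definition NF :: "(gen list \<Rightarrow>\<^sub>0 'k) \<Rightarrow> (gen list \<Rightarrow>\<^sub>0 'k)" where "NF = lin_ext nf"

lemma lin_NF: "lin NF" unfolding NF_def by (rule lin_lin_ext)

lemmas NF_simps = lin_simps[OF lin_NF]

lemma NF_bas [simp]: "NF (Poly_Mapping.single w c) = scal c (nf w)" by (simp add: NF_def)

lemma nf_irr: "irr w \<Longrightarrow> nf w = bas w"
  by (simp add: nf.simps irr_def)

lemma nf_not_irr:
  assumes "\<not> irr w"
  obtains p b q where "w = p @ [Gen_d, b, Gen_u] @ q"
    "nf w = scal \<alpha> (nf (p @ mid b @ q)) + scal \<beta> (nf (p @ [Gen_u, b, Gen_d] @ q))"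
proof -
  obtain x y where xy: "red w = Some (x, y)" using assms by (cases "red w") (auto simp: irr_def)
  from red_Some[OF this] obtain p b q where
    "w = p @ [Gen_d, b, Gen_u] @ q" "x = p @ mid b @ q" "y = p @ [Gen_u, b, Gen_d] @ q" by blast
  moreover have "nf w = scal \<alpha> (nf x) + scal \<beta> (nf y)" using xy by (simp add: nf.simps[of w])
  ultimately show thesis using that by blast
qed

text \<open>The diamond lemma: by induction on \<open>bval\<close> the equation holds for all
  reducts, so two different forbidden subwords have to be compared only one step further.\<close>

lemma nf_redex:
  "nf (p @ [Gen_d, b, Gen_u] @ q) = scal \<alpha> (nf (p @ mid b @ q)) + scal \<beta> (nf (p @ [Gen_u, b, Gen_d] @ q))"
proof (induction "bval (p @ [Gen_d, b, Gen_u] @ q)" arbitrary: p b q rule: less_induct)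
  case (less p b q)
  let ?R = "\<lambda>p b q. scal \<alpha> (nf (p @ mid b @ q)) + scal \<beta> (nf (p @ [Gen_u, b, Gen_d] @ q))"
  let ?w = "p @ [Gen_d, b, Gen_u] @ q"
  have IH: "nf (p' @ [Gen_d, b', Gen_u] @ q') = ?R p' b' q'"
    if "bval (p' @ [Gen_d, b', Gen_u] @ q') < bval ?w" for p' b' q'
    by (rule less[OF that])
  have confl: "?R p1 b1 q1 = ?R p2 b2 q2"
    if e1: "?w = p1 @ [Gen_d, b1, Gen_u] @ q1" and e2: "?w = p2 @ [Gen_d, b2, Gen_u] @ q2"
      and l: "length p1 < length p2" for p1 b1 q1 p2 b2 q2
    using trans[OF e1[symmetric] e2] l
  proof (cases rule: redex_cases)
    \<comment> \<open>The critical pair \<open>d d u u\<close>: both \<alpha>-reducts are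
      \<open>d u d u\<close>, and the \<beta>-reducts \<open>u d d u\<close> and
      \<open>d u u d\<close> both continue to \<alpha> times \<open>u d u d\<close> plus \<beta>
      times \<open>u u d d\<close>.\<close>
    case 1
    have "bval (p1 @ [Gen_u, Gen_d, Gen_d] @ Gen_u # q2) < bval ?w"
      unfolding e1 1 by (rule bval_reduct)
    with IH[of "p1 @ [Gen_u]" Gen_d q2]
    have a: "nf (p1 @ [Gen_u, Gen_d, Gen_d] @ Gen_u # q2) = ?R (p1 @ [Gen_u]) Gen_d q2" by simp
    have "bval (p2 @ [Gen_u, Gen_u, Gen_d] @ q2) < bval ?w"
      unfolding e2 1 by (rule bval_reduct)
    with IH[of p1 Gen_u "Gen_d # q2"]
    have b: "nf (p2 @ [Gen_u, Gen_u, Gen_d] @ q2) = ?R p1 Gen_u (Gen_d # q2)" unfolding 1 by simp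
    show ?thesis using a b unfolding 1 by (simp add: mid_def)
  next
    case (2 s)
    \<comment> \<open>Disjoint subwords: reducing the other one in each reduct leads to the same
      four terms.\<close>
    have "bval (p1 @ mid b1 @ s @ [Gen_d, b2, Gen_u] @ q2) < bval ?w"
      "bval (p1 @ [Gen_u, b1, Gen_d] @ s @ [Gen_d, b2, Gen_u] @ q2) < bval ?w"
      unfolding e1 2 by (rule bval_reduct)+
    with IH[of "p1 @ mid b1 @ s" b2 q2] IH[of "p1 @ [Gen_u, b1, Gen_d] @ s" b2 q2]
    have a: "?R p1 b1 q1 = scal \<alpha> (?R (p1 @ mid b1 @ s) b2 q2) + scal \<beta> (?R (p1 @ [Gen_u, b1, Gen_d] @ s) b2 q2)"
      unfolding 2 by simp
    have "bval (p2 @ mid b2 @ q2) < bval ?w" "bval (p2 @ [Gen_u, b2, Gen_d] @ q2) < bval ?w"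
      unfolding e2 by (rule bval_reduct)+
    with IH[of p1 b1 "s @ mid b2 @ q2"] IH[of p1 b1 "s @ [Gen_u, b2, Gen_d] @ q2"]
    have b: "?R p2 b2 q2 = scal \<alpha> (?R p1 b1 (s @ mid b2 @ q2)) + scal \<beta> (?R p1 b1 (s @ [Gen_u, b2, Gen_d] @ q2))"
      unfolding 2 by simp
    show ?thesis unfolding a b by (simp add: free_vs.scale_right_distrib mult.commute add_ac)
  qed
  obtain p0 b0 q0 where e0: "?w = p0 @ [Gen_d, b0, Gen_u] @ q0" "nf ?w = ?R p0 b0 q0"
    using nf_not_irr[OF not_irr_redex] by metis
  consider "length p0 < length p" | "length p < length p0" | "length p = length p0" by linarith
  then show ?case
  proof cases
    case 1 then show ?thesis using confl[OF e0(1) refl] e0(2) by simp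
  next
    case 2 then show ?thesis using confl[OF refl e0(1)] e0(2) by simp
  next
    case 3 then show ?thesis using e0 by auto
  qed
qed

text \<open>Rewriting keeps the length and lowers \<open>bval\<close>. The strict inequality for
  reducible words is what later allows a product to be replaced by its concatenation up to smaller
  words.\<close>

lemma keys_nf:
  "v \<in> keys (nf w) \<Longrightarrow> irr v \<and> length v = length w \<and> bval v \<le> bval w \<and> (\<not> irr w \<longrightarrow> bval v < bval w)"
proof (induction "bval w" arbitrary: w v rule: less_induct)
  case (less w v)
  show ?case
  proof (cases "irr w")
    case True then show ?thesis using less(2) by (simp add: nf_irr)
  next
    case False
    then obtain p b q where pq: "w = p @ [Gen_d, b, Gen_u] @ q"
      "nf w = scal \<alpha> (nf (p @ mid b @ q)) + scal \<beta> (nf (p @ [Gen_u, b, Gen_d] @ q))"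
      by (rule nf_not_irr)
    have lt: "bval (p @ mid b @ q) < bval w" "bval (p @ [Gen_u, b, Gen_d] @ q) < bval w"
      unfolding pq(1) by (rule bval_reduct)+
    have "v \<in> keys (nf (p @ mid b @ q)) \<or> v \<in> keys (nf (p @ [Gen_u, b, Gen_d] @ q))"
      using less(2) keys_add[of "scal \<alpha> (nf (p @ mid b @ q))" "scal \<beta> (nf (p @ [Gen_u, b, Gen_d] @ q))"]
        keys_scal[of \<alpha> "nf (p @ mid b @ q)"] keys_scal[of \<beta> "nf (p @ [Gen_u, b, Gen_d] @ q)"]
      unfolding pq(2) by blast
    then show ?thesis
    proof
      assume v: "v \<in> keys (nf (p @ mid b @ q))"
      show ?thesis using less(1)[OF lt(1) v] lt(1) by (simp add: pq(1))
    next
      assume v: "v \<in> keys (nf (p @ [Gen_u, b, Gen_d] @ q))"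
      show ?thesis using less(1)[OF lt(2) v] lt(2) by (simp add: pq(1))
    qed
  qed
qed

text \<open>A rewriting step inside a factor is one inside the product, at a position that need not
  be leftmost there; \<open>nf_redex\<close> permits this. With the mirror statement below, the
  kernel of \<open>NF\<close> is a two-sided ideal.\<close>

lemma NF_mult_left: "NF (NF x * y) = NF (x * y)"
proof -
  have bb: "NF (nf v * bas w) = nf (v @ w)" for v w
  proof (induction v rule: nf.induct)
    case (1 v)
    show ?case
    proof (cases "red v")
      case None
      then show ?thesis by (simp add: nf_irr irr_def)
    next
      case (Some xy)
      obtain x y where xy: "xy = (x, y)" by fastforce
      note IH = 1[OF Some, of x y] 
      from red_Some[of v x y] Some xy obtain p b q where
        pq: "v = p @ [Gen_d, b, Gen_u] @ q" "x = p @ mid b @ q" "y = p @ [Gen_u, b, Gen_d] @ q" by blast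
      have "nf (v @ w) = scal \<alpha> (nf (x @ w)) + scal \<beta> (nf (y @ w))"
        using nf_redex[of p b "q @ w"] by (simp add: pq)
      moreover have "nf v = scal \<alpha> (nf x) + scal \<beta> (nf y)" using Some xy by (simp add: nf.simps[of v])
      ultimately show ?thesis using IH xy by (simp add: distrib_right scal_mult NF_simps)
    qed
  qed
  have "NF (NF x * bas w) = NF (x * bas w)" for w
    by (rule lin_eqI[OF lin_comp[OF lin_NF lin_mult_right[OF lin_NF]] lin_comp[OF lin_NF lin_mult_right[OF lin_id]]])
      (simp add: bb)
  then show ?thesis
    by (rule lin_eqI[OF lin_comp[OF lin_NF lin_mult_left[OF lin_id]] lin_comp[OF lin_NF lin_mult_left[OF lin_id]]])
qed

lemma NF_mult_right: "NF (x * NF y) = NF (x * y)"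
proof -
  have bb: "NF (bas w * nf v) = nf (w @ v)" for v w
  proof (induction v rule: nf.induct)
    case (1 v)
    show ?case
    proof (cases "red v")
      case None
      then show ?thesis by (simp add: nf_irr irr_def)
    next
      case (Some xy)
      obtain x y where xy: "xy = (x, y)" by fastforce
      note IH = 1[OF Some, of x y] 
      from red_Some[of v x y] Some xy obtain p b q where
        pq: "v = p @ [Gen_d, b, Gen_u] @ q" "x = p @ mid b @ q" "y = p @ [Gen_u, b, Gen_d] @ q" by blast
      have "nf (w @ v) = scal \<alpha> (nf (w @ x)) + scal \<beta> (nf (w @ y))"
        using nf_redex[of "w @ p" b q] by (simp add: pq)
      moreover have "nf v = scal \<alpha> (nf x) + scal \<beta> (nf y)" using Some xy by (simp add: nf.simps[of v])
      ultimately show ?thesis using IH xy by (simp add: distrib_left scal_mult NF_simps)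
    qed
  qed
  have "NF (bas w * NF y) = NF (bas w * y)" for w
    by (rule lin_eqI[OF lin_comp[OF lin_NF lin_mult_left[OF lin_NF]] lin_comp[OF lin_NF lin_mult_left[OF lin_id]]])
      (simp add: bb)
  then show ?thesis
    by (rule lin_eqI[OF lin_comp[OF lin_NF lin_mult_right[OF lin_id]] lin_comp[OF lin_NF lin_mult_right[OF lin_id]]])
qed

lemma NF_idem: "NF (NF x) = NF x"
  using NF_mult_left[of x 1] by simp

definition NW :: "gen list set" where "NW = {w. irr w}"

lemma NF_in_NW: "NF x \<in> spn NW"
  using keys_lin_ext[of nf x] keys_nf unfolding NF_def NW_def spn_def by blast

section \<open>Coordinates on the quotient algebra\<close>

abbreviation "dI \<equiv> down_up_ideal \<alpha> \<beta>"
abbreviation "dA \<equiv> down_up \<alpha> \<beta>"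
abbreviation "dG \<equiv> down_up_grading \<alpha> \<beta>"

lemma free_ring_simps [simp]:
  "carrier (free_ring :: 'k free_alg ring) = UNIV"
  "x \<otimes>\<^bsub>free_ring :: 'k free_alg ring\<^esub> y = x * y"
  "x \<oplus>\<^bsub>free_ring :: 'k free_alg ring\<^esub> y = x + y"
  "\<one>\<^bsub>free_ring :: 'k free_alg ring\<^esub> = 1" "\<zero>\<^bsub>free_ring :: 'k free_alg ring\<^esub> = 0"
  by (simp_all add: ring_of_type_algebra_def)

lemma ring_free_ring: "ring (free_ring :: 'k free_alg ring)"
proof -
  have "\<exists>y. x + y = 0" for x :: "'k free_alg" using add.right_inverse by blast
  then show ?thesis unfolding ring_of_type_algebra_def
    by unfold_locales (auto simp: algebra_simps Units_def)
qed

lemma ideal_dI: "ideal dI free_ring"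
  unfolding down_up_ideal_def by (rule ring.genideal_ideal[OF ring_free_ring]) simp

lemma NF_ideal: "x \<in> dI \<Longrightarrow> NF x = 0"
proof -
  let ?K = "{x. NF x = 0}"
  have "ideal ?K free_ring"
  proof (rule idealI[OF ring_free_ring])
    show "subgroup ?K (add_monoid (free_ring :: 'k free_alg ring))"
    proof
      fix x assume "x \<in> ?K"
      interpret ring "free_ring :: 'k free_alg ring" by (rule ring_free_ring)
      have "- x \<oplus>\<^bsub>free_ring\<^esub> x = \<zero>\<^bsub>free_ring\<^esub>" by simp
      then have "inv\<^bsub>add_monoid (free_ring :: 'k free_alg ring)\<^esub> x = - x"
        by (metis (no_types) a_inv_def free_ring_simps(1) UNIV_I minus_equality)
      then show "inv\<^bsub>add_monoid (free_ring :: 'k free_alg ring)\<^esub> x \<in> ?K" using \<open>x \<in> ?K\<close> by (simp add: NF_simps)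
    qed (auto simp: NF_simps)
    fix a x assume "a \<in> ?K"
    then show "x \<otimes>\<^bsub>free_ring\<^esub> a \<in> ?K" "a \<otimes>\<^bsub>free_ring\<^esub> x \<in> ?K"
      using NF_mult_right[of x a] NF_mult_left[of a x] by (simp_all add: NF_simps)
  qed
  moreover have "NF (free_d * free_d * free_u
        - (scal \<alpha> (free_d * free_u * free_d) + scal \<beta> (free_u * free_d * free_d))) = 0"
    "NF (free_d * free_u * free_u
        - (scal \<alpha> (free_u * free_d * free_u) + scal \<beta> (free_u * free_u * free_d))) = 0"
    using nf_redex[of "[]" Gen_d "[]"] nf_redex[of "[]" Gen_u "[]"]
    by (simp_all add: free_u_def free_d_def NF_simps mid_def del: scal_single)
  ultimately have "dI \<subseteq> ?K"
    unfolding down_up_ideal_def by (intro ring.genideal_minimal[OF ring_free_ring]) auto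
  then show "x \<in> dI \<Longrightarrow> NF x = 0" by auto
qed

lemma dI_closed: "x \<in> dI \<Longrightarrow> y \<in> dI \<Longrightarrow> x + y \<in> dI" "0 \<in> dI"
  "x \<in> dI \<Longrightarrow> z * x \<in> dI" "x \<in> dI \<Longrightarrow> x * z \<in> dI" "x \<in> dI \<Longrightarrow> scal c x \<in> dI" "x \<in> dI \<Longrightarrow> - x \<in> dI"
proof -
  interpret ideal dI "free_ring :: 'k free_alg ring" by (rule ideal_dI)
  show "x \<in> dI \<Longrightarrow> y \<in> dI \<Longrightarrow> x + y \<in> dI"
    using additive_subgroup.a_closed[OF additive_subgroup_axioms, of x y] by simp
  show "0 \<in> dI" using additive_subgroup.zero_closed[OF additive_subgroup_axioms] by simp
  show l: "x \<in> dI \<Longrightarrow> z * x \<in> dI" for z using I_l_closed[of x z] by simp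
  show "x \<in> dI \<Longrightarrow> x * z \<in> dI" using I_r_closed[of x z] by simp
  show s: "x \<in> dI \<Longrightarrow> scal c x \<in> dI" for c using l[of "Poly_Mapping.single [] c"]
    by (metis mult_map_scale_conv_mult scal_def zero_list_def)
  show "x \<in> dI \<Longrightarrow> - x \<in> dI" using s[of "- 1"] by simp
qed

lemma diff_NF_ideal: "x - NF x \<in> dI"
proof -
  have rel: "bas [Gen_d, b, Gen_u] - (scal \<alpha> (bas (mid b)) + scal \<beta> (bas [Gen_u, b, Gen_d])) \<in> dI" for b
    unfolding down_up_ideal_def 
    by (rule subsetD[OF ring.genideal_self[OF ring_free_ring]], simp)
      (cases b; simp add: free_u_def free_d_def mid_def)
  have bb: "bas w - nf w \<in> dI" for w
  proof (induction w rule: nf.induct)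
    case (1 w)
    show ?case
    proof (cases "red w")
      case None
      then show ?thesis by (simp add: nf_irr irr_def dI_closed)
    next
      case (Some xy)
      obtain x y where xy: "xy = (x, y)" by fastforce
      note IH = 1[OF Some, of x y]
      from red_Some[of w x y] Some xy obtain p b q where
        pq: "w = p @ [Gen_d, b, Gen_u] @ q" "x = p @ mid b @ q" "y = p @ [Gen_u, b, Gen_d] @ q" by blast
      have "bas p * (bas [Gen_d, b, Gen_u] - (scal \<alpha> (bas (mid b)) + scal \<beta> (bas [Gen_u, b, Gen_d]))) * bas q \<in> dI"
        by (intro dI_closed rel)
      then have "bas w - scal \<alpha> (bas x) - scal \<beta> (bas y) \<in> dI"
        by (simp add: pq algebra_simps)
      then have "(bas w - scal \<alpha> (bas x) - scal \<beta> (bas y)) + scal \<alpha> (bas x - nf x) + scal \<beta> (bas y - nf y) \<in> dI"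
        using IH xy by (intro dI_closed) auto
      moreover have "nf w = scal \<alpha> (nf x) + scal \<beta> (nf y)" using Some xy by (simp add: nf.simps[of w])
      ultimately show ?thesis by (simp add: free_vs.scale_right_diff_distrib diff_diff_eq)
    qed
  qed
  have sub: "free_vs.subspace dI" by (auto simp: free_vs.subspace_def dI_closed)
  show ?thesis
    by (rule lin_spnI[OF lin_minus_fun[OF lin_id lin_NF] _ sub, of _ UNIV]) (auto simp: spn_def bb)
qed

lemma in_dI_iff: "x \<in> dI \<longleftrightarrow> NF x = 0"
  using NF_ideal diff_NF_ideal[of x] by auto

definition cls :: "(gen list \<Rightarrow>\<^sub>0 'k) \<Rightarrow> 'k free_alg set" where
  "cls x = dI +>\<^bsub>free_ring\<^esub> x"

lemma in_cls_iff: "y \<in> cls x \<longleftrightarrow> NF y = NF x"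
proof -
  have "y \<in> cls x \<longleftrightarrow> (\<exists>h\<in>dI. y = h + x)" by (auto simp: cls_def a_r_coset_def')
  also have "\<dots> \<longleftrightarrow> y - x \<in> dI" by (metis add_diff_cancel_right' diff_add_cancel)
  finally show ?thesis by (simp add: in_dI_iff NF_simps)
qed

lemma cls_eq_iff: "cls x = cls y \<longleftrightarrow> NF x = NF y"
  using in_cls_iff by (metis equalityI subsetI)

lemma carrier_dA: "carrier dA = range cls"
  by (auto simp: down_up_def Let_def FactRing_def A_RCOSETS_def' cls_def a_r_coset_def')

lemma cls_in [simp]: "cls x \<in> carrier dA" by (simp add: carrier_dA)

lemma mult_dA: "cls x \<otimes>\<^bsub>dA\<^esub> cls y = cls (x * y)"
  using ideal.rcoset_mult_add[OF ideal_dI, of x y] by (simp add: down_up_def Let_def FactRing_def cls_def)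

lemma add_dA: "cls x \<oplus>\<^bsub>dA\<^esub> cls y = cls (x + y)"
proof -
  interpret ideal dI "free_ring :: 'k free_alg ring" by (rule ideal_dI)
  show ?thesis using a_rcos_sum[of x y] by (simp add: down_up_def Let_def FactRing_def cls_def)
qed

lemma smult_dA: "c \<odot>\<^bsub>dA\<^esub> cls x = cls (scal c x)"
proof -
  have "c \<odot>\<^bsub>dA\<^esub> cls x = cls (Poly_Mapping.single 0 c) \<otimes>\<^bsub>dA\<^esub> cls x"
    by (simp add: down_up_def Let_def cls_def)
  also have "\<dots> = cls (scal c x)"
    unfolding mult_dA by (simp add: scal_def mult_map_scale_conv_mult)
  finally show ?thesis .
qed

lemma one_dA: "\<one>\<^bsub>dA\<^esub> = cls (bas [])"
  by (simp add: down_up_def Let_def FactRing_def cls_def one_eq_bas)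

text \<open>The coordinates of a class in the basis of irreducible words; by \<open>kap_cls\<close>
  the chosen representative does not matter.\<close>

definition kap :: "'k free_alg set \<Rightarrow> (gen list \<Rightarrow>\<^sub>0 'k)" where
  "kap a = NF (SOME x. cls x = a)"

lemma kap_cls [simp]: "kap (cls x) = NF x"
  unfolding kap_def by (metis (mono_tags, lifting) cls_eq_iff someI)

lemma cls_kap: "a \<in> carrier dA \<Longrightarrow> cls (kap a) = a"
  unfolding carrier_dA by (elim rangeE) (simp only: kap_cls cls_eq_iff NF_idem)

lemma kap_simps:
  assumes "a \<in> carrier dA" "b \<in> carrier dA"
  shows "kap (a \<otimes>\<^bsub>dA\<^esub> b) = NF (kap a * kap b)" "kap (a \<oplus>\<^bsub>dA\<^esub> b) = kap a + kap b" "kap (c \<odot>\<^bsub>dA\<^esub> a) = scal c (kap a)"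
    "a \<otimes>\<^bsub>dA\<^esub> b \<in> carrier dA" "a \<oplus>\<^bsub>dA\<^esub> b \<in> carrier dA" "c \<odot>\<^bsub>dA\<^esub> a \<in> carrier dA" "kap a \<in> spn NW"
  using assms by (auto simp: carrier_dA mult_dA add_dA smult_dA NF_simps NF_mult_left NF_mult_right NF_in_NW)

lemma kap_one: "kap \<one>\<^bsub>dA\<^esub> = bas []" "\<one>\<^bsub>dA\<^esub> \<in> carrier dA"
  by (simp_all add: one_dA nf_irr)

definition NWl :: "nat \<Rightarrow> gen list set" where "NWl m = {w. irr w \<and> length w = m}"

text \<open>The grading asks for some homogeneous representative. The normal form is one, because
  rewriting preserves length.\<close>

lemma dG_iff: "a \<in> dG m \<longleftrightarrow> a \<in> carrier dA \<and> kap a \<in> spn (NWl m)"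
proof
  assume "a \<in> dG m"
  then obtain x where x: "a = cls x" "\<forall>w\<in>keys x. length w = m" by (auto simp: down_up_grading_def cls_def)
  have "NF x \<in> spn (NWl m)"
    using keys_lin_ext[of nf x] keys_nf x(2) unfolding NF_def NWl_def spn_def by fastforce
  with x show "a \<in> carrier dA \<and> kap a \<in> spn (NWl m)" by simp
next
  assume *: "a \<in> carrier dA \<and> kap a \<in> spn (NWl m)"
  then show "a \<in> dG m" using cls_kap[of a]
    by (auto simp: down_up_grading_def cls_def NWl_def spn_def intro!: exI[of _ "kap a"])
qed

end

section \<open>Cyclic objects with a weight\<close>

text \<open>Only the first face \<open>d\<close> and the signed rotation \<open>t\<close> are primitive: the Hochschild differential is
  \<open>\<Sum>\<^sub>i\<^sub>\<le>\<^sub>n t\<^sup>i d t\<^sup>-\<^sup>i\<close>, and \<open>bp\<close> is the same sum without its last term \<open>d t\<close>.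
  \<open>W j\<close> multiplies by the weight of the \<open>j\<close>-th tensor factor.\<close>

locale cyclic_cx =
  fixes TX :: "nat \<Rightarrow> ('x \<Rightarrow>\<^sub>0 'k::field_char_0) set"
    and t d bp :: "('x \<Rightarrow>\<^sub>0 'k) \<Rightarrow> ('x \<Rightarrow>\<^sub>0 'k)"
    and W :: "nat \<Rightarrow> ('x \<Rightarrow>\<^sub>0 'k) \<Rightarrow> ('x \<Rightarrow>\<^sub>0 'k)"
    and m :: nat
  assumes fdX: "fd (TX n)"
    and lin_t: "lin t" and lin_d: "lin d" and lin_bp: "lin bp" and lin_W: "lin (W j)"
    and t_in: "x \<in> TX n \<Longrightarrow> t x \<in> TX n" and t_pow: "x \<in> TX n \<Longrightarrow> (t ^^ Suc n) x = x"
    and d_in: "x \<in> TX (Suc n) \<Longrightarrow> d x \<in> TX n" and d_0: "x \<in> TX 0 \<Longrightarrow> d x = 0"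
    and bp_eq: "x \<in> TX n \<Longrightarrow> bp x = (\<Sum>i<n. (t ^^ i) (d ((t ^^ (Suc n - i)) x)))"
    and W_in: "x \<in> TX n \<Longrightarrow> W j x \<in> TX n"
    and tW: "x \<in> TX n \<Longrightarrow> j \<le> n \<Longrightarrow> t (W j x) = W (if j = n then 0 else Suc j) (t x)"
    and dW: "x \<in> TX n \<Longrightarrow> 2 \<le> j \<Longrightarrow> j \<le> n \<Longrightarrow> d (W j x) = W (j - 1) (d x)"
    and dW01: "x \<in> TX (Suc n) \<Longrightarrow> d (W 0 x) + d (W 1 x) = W 0 (d x)"
    and sumW: "x \<in> TX n \<Longrightarrow> (\<Sum>j\<le>n. W j x) = scal (of_nat m) x"
    and bpbp: "x \<in> TX n \<Longrightarrow> bp (bp x) = 0"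
    and m_pos: "0 < m"
begin

lemma subX: "free_vs.subspace (TX n)" by (rule fd_subspace[OF fdX])

lemmas t_simps = lin_simps[OF lin_t] and d_simps = lin_simps[OF lin_d]
  and bp_simps = lin_simps[OF lin_bp] and W_simps = lin_simps[OF lin_W]

lemmas TX_cl = free_vs.subspace_add[OF subX] free_vs.subspace_diff[OF subX] free_vs.subspace_neg[OF subX]
  free_vs.subspace_scale[OF subX] free_vs.subspace_0[OF subX] free_vs.subspace_sum[OF subX]

lemma lin_tp: "lin (t ^^ k)" by (rule lin_funpow[OF lin_t])

lemma tp_in: "x \<in> TX n \<Longrightarrow> (t ^^ k) x \<in> TX n"
  by (induction k) (auto intro: t_in)

lemma tp_fix: "t x = x \<Longrightarrow> (t ^^ k) x = x"
  by (induction k) auto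

definition b where "b x = bp x + d (t x)"

lemma lin_b: "lin b"
  unfolding b_def by (rule lin_plus[OF lin_bp lin_comp[OF lin_d lin_t]])

lemmas b_simps = lin_simps[OF lin_b]

definition N where "N n x = (\<Sum>k\<le>n. (t ^^ k) x)" for n :: nat

lemma lin_N: "lin (N n)"
  unfolding N_def by (rule lin_sum_fun) (rule lin_tp)

lemmas N_simps = lin_simps[OF lin_N]

lemma bp_0: "x \<in> TX 0 \<Longrightarrow> bp x = 0" by (simp add: bp_eq)

lemma b_0: "x \<in> TX 0 \<Longrightarrow> b x = 0" by (simp add: b_def bp_0 d_0 t_in)

lemma bp_in: "x \<in> TX (Suc n) \<Longrightarrow> bp x \<in> TX n"
  by (auto simp: bp_eq intro!: TX_cl tp_in d_in simp del: funpow.simps)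

lemma b_in: "x \<in> TX (Suc n) \<Longrightarrow> b x \<in> TX n"
  unfolding b_def by (intro TX_cl bp_in d_in t_in)

lemma N_in: "x \<in> TX n \<Longrightarrow> N k x \<in> TX n"
  unfolding N_def by (intro TX_cl tp_in)

lemma N_t: assumes "x \<in> TX n" shows "N n (t x) = N n x"
proof -
  have "N n (t x) = (\<Sum>k\<le>n. (t ^^ Suc k) x)" unfolding N_def by (simp add: funpow_swap1)
  also have "\<dots> = (\<Sum>k<n. (t ^^ Suc k) x) + (t ^^ Suc n) x" by (simp only: lessThan_Suc_atMost[symmetric] sum.lessThan_Suc)
  also have "\<dots> = (\<Sum>k<n. (t ^^ Suc k) x) + (t ^^ 0) x" using t_pow[OF assms] by simp
  also have "\<dots> = N n x" unfolding N_def lessThan_Suc_atMost[symmetric] by (simp only: sum.lessThan_Suc_shift add.commute)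
  finally show ?thesis .
qed

lemma N_tp: "x \<in> TX n \<Longrightarrow> N n ((t ^^ k) x) = N n x"
  by (induction k) (simp_all add: N_t tp_in)

lemma t_N: assumes "x \<in> TX n" shows "t (N n x) = N n x"
  using N_t[OF assms] unfolding N_def by (simp add: t_simps funpow_swap1)

lemma N_inv: "t x = x \<Longrightarrow> N n x = scal (of_nat (Suc n)) x"
  unfolding N_def by (simp add: tp_fix free_vs.sum_constant_scale)

text \<open>Exactness of the rows at the kernel of the norm, by averaging in characteristic
  0.\<close>

lemma N_eq_0:
  assumes x: "x \<in> TX n" and Nx: "N n x = 0"
  obtains w where "w \<in> TX n" "x = w - t w"
proof -
  have tel: "x - (t ^^ k) x = (\<Sum>j<k. (t ^^ j) x) - t (\<Sum>j<k. (t ^^ j) x)" for k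
    by (induction k) (simp_all add: t_simps algebra_simps)
  \<comment> \<open>Each \<open>x - (t ^^ k) x\<close> telescopes to \<open>1 - t\<close> of a
    partial sum. Summed over \<open>k\<close> the left side is \<open>n + 1\<close> times
    \<open>x\<close>, because the norm of \<open>x\<close> is 0.\<close>
  define w where "w = scal (1 / of_nat (Suc n)) (\<Sum>k\<le>n. \<Sum>j<k. (t ^^ j) x)"
  have "(\<Sum>k\<le>n. x - (t ^^ k) x) = (\<Sum>k\<le>n. \<Sum>j<k. (t ^^ j) x) - t (\<Sum>k\<le>n. \<Sum>j<k. (t ^^ j) x)"
    unfolding tel by (simp add: t_simps sum_subtractf)
  then have e: "scal (of_nat (Suc n)) x = (\<Sum>k\<le>n. \<Sum>j<k. (t ^^ j) x) - t (\<Sum>k\<le>n. \<Sum>j<k. (t ^^ j) x)"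
    using Nx by (simp add: sum_subtractf N_def free_vs.sum_constant_scale)
  have "x = scal (1 / of_nat (Suc n)) (scal (of_nat (Suc n)) x)"
    unfolding free_vs.scale_scale by (simp del: of_nat_Suc)
  then have "x = w - t w" unfolding w_def e t_simps(2) free_vs.scale_right_diff_distrib .
  moreover have "w \<in> TX n" unfolding w_def by (intro TX_cl tp_in x)
  ultimately show thesis using that by blast
qed

lemma N_1t: "x \<in> TX n \<Longrightarrow> N n (x - t x) = 0"
  by (simp add: N_simps N_t)

lemma b_sum: assumes "x \<in> TX n" shows "b x = (\<Sum>i\<le>n. (t ^^ i) (d ((t ^^ (Suc n - i)) x)))"
proof (cases n)
  case 0
  then show ?thesis using assms by (simp add: b_0 d_0 t_in)
next
  case (Suc k)
  have "(t ^^ n) (d (t x)) = d (t x)" using t_pow[of "d (t x)" k] d_in[OF t_in, of x k] assms Suc by simp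
  then show ?thesis using bp_eq[OF assms] unfolding b_def lessThan_Suc_atMost[symmetric] by simp
qed

lemma b_t: assumes "x \<in> TX n" shows "b (t x) = d (t x) + t (bp x)"
proof -
  have "b (t x) = (\<Sum>i<Suc n. (t ^^ i) (d ((t ^^ (Suc n - i)) (t x))))"
    unfolding b_sum[OF t_in[OF assms]] lessThan_Suc_atMost ..
  also have "\<dots> = d ((t ^^ Suc n) (t x)) + (\<Sum>i<n. (t ^^ Suc i) (d ((t ^^ (n - i)) (t x))))"
    unfolding sum.lessThan_Suc_shift by simp
  also have "d ((t ^^ Suc n) (t x)) = d (t x)" by (simp only: t_pow[OF t_in[OF assms]])
  also have "(\<Sum>i<n. (t ^^ Suc i) (d ((t ^^ (n - i)) (t x)))) = t (bp x)"
    unfolding bp_eq[OF assms] t_simps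
  proof (rule sum.cong[OF refl])
    fix i assume "i \<in> {..<n}"
    then have "(t ^^ (n - i)) (t x) = (t ^^ (Suc n - i)) x" by (simp add: Suc_diff_le funpow_swap1)
    then show "(t ^^ Suc i) (d ((t ^^ (n - i)) (t x))) = t ((t ^^ i) (d ((t ^^ (Suc n - i)) x)))" by simp
  qed
  finally show ?thesis .
qed

lemma b_1t: "x \<in> TX n \<Longrightarrow> b (x - t x) = bp x - t (bp x)"
  by (simp add: b_simps b_t) (simp add: b_def)

text \<open>On invariants the inner rotations in \<open>bp_eq\<close> act trivially, and the outer
  ones add up to the norm one degree lower.\<close>

lemma bp_inv: assumes "y \<in> TX (Suc n)" "t y = y" shows "bp y = N n (d y)"
  using assms unfolding bp_eq[OF assms(1)] N_def
  by (simp add: tp_fix lessThan_Suc_atMost del: funpow.simps)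

text \<open>The norm absorbs the outer rotations, so both sides equal
  \<open>N n (d (N (Suc n) x))\<close>.\<close>

lemma bp_N: assumes x: "x \<in> TX (Suc n)" shows "bp (N (Suc n) x) = N n (b x)"
proof -
  have "N n (b x) = (\<Sum>i\<le>Suc n. N n (d ((t ^^ (Suc (Suc n) - i)) x)))"
    unfolding b_sum[OF x] N_simps by (intro sum.cong refl N_tp d_in tp_in x)
  also have "\<dots> = N n (d (\<Sum>i\<le>Suc n. (t ^^ (Suc (Suc n) - i)) x))"
    by (simp only: N_simps d_simps)
  also have "(\<Sum>i\<le>Suc n. (t ^^ (Suc (Suc n) - i)) x) = (\<Sum>i\<le>Suc n. (t ^^ (Suc n - i)) (t x))"
    by (intro sum.cong refl) (simp add: Suc_diff_le funpow_swap1)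
  also have "\<dots> = N (Suc n) (t x)" unfolding N_def
    by (rule sum.reindex_bij_witness[of _ "\<lambda>i. Suc n - i" "\<lambda>i. Suc n - i"]) auto
  also have "\<dots> = N (Suc n) x" by (rule N_t[OF x])
  also have "N n (d (N (Suc n) x)) = bp (N (Suc n) x)"
    by (rule bp_inv[symmetric]) (simp_all add: N_in t_N x)
  finally show ?thesis by simp
qed

lemma bp_N': assumes x: "x \<in> TX n" shows "bp (N n x) = N (n - 1) (b x)"
  by (cases n) (use assms in \<open>simp_all add: bp_N bp_0 b_0 N_in N_simps\<close>)

lemma t_bp: "y \<in> TX n \<Longrightarrow> t y = y \<Longrightarrow> t (bp y) = bp y"
  by (cases n) (simp_all add: bp_0 t_simps bp_inv t_N d_in)

lemma tpW: "x \<in> TX n \<Longrightarrow> j \<le> n \<Longrightarrow> (t ^^ k) (W j x) = W ((j + k) mod Suc n) ((t ^^ k) x)"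
proof (induction k)
  case (Suc k)
  then have "(t ^^ Suc k) (W j x) = t (W ((j + k) mod Suc n) ((t ^^ k) x))" by simp
  also have "\<dots> = W (if (j + k) mod Suc n = n then 0 else Suc ((j + k) mod Suc n)) (t ((t ^^ k) x))"
    by (rule tW[OF tp_in[OF Suc.prems(1)]]) (simp add: less_Suc_eq_le[symmetric] del: less_Suc_eq)
  also have "(if (j + k) mod Suc n = n then 0 else Suc ((j + k) mod Suc n)) = (j + Suc k) mod Suc n"
    by (simp add: mod_Suc)
  finally show ?case by simp
qed simp

text \<open>On invariants, multiplication by the weight of factor 0 turns \<open>bp\<close> into
  \<open>b\<close>. This is what makes the section of the norm a chain map: faces away from factor 0
  preserve its weight, and the two faces that touch it jointly add the weights they merge.\<close>

lemma b_W: assumes y: "y \<in> TX n" "t y = y" shows "b (W 0 y) = W 0 (bp y)"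
proof (cases n)
  case 0
  then show ?thesis using assms by (simp add: b_0 bp_0 W_in W_simps)
next
  case (Suc k)
  have yS: "y \<in> TX (Suc k)" using y Suc by simp
  have dy: "d y \<in> TX k" by (rule d_in[OF yS])
  let ?T = "\<lambda>i. (t ^^ i) (d ((t ^^ (Suc n - i)) (W 0 y)))"
  \<comment> \<open>The rotation carries the weight away from position 0, \<open>d\<close> lowers
    its index by one, and the rotation back returns it to position 0.\<close>
  have T: "?T i = W 0 ((t ^^ i) (d y))" if "0 < i" "i < n" for i
  proof -
    have "(t ^^ (Suc n - i)) (W 0 y) = W (Suc n - i) y"
      using that tpW[OF y(1), of 0 "Suc n - i"] by (simp add: tp_fix y(2) del: funpow.simps)
    moreover have "d (W (Suc n - i) y) = W (n - i) (d y)"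
      using dW[OF y(1), of "Suc n - i"] that by simp
    moreover have "(t ^^ i) (W (n - i) (d y)) = W 0 ((t ^^ i) (d y))"
      using tpW[OF dy, of "n - i" i] that Suc by simp
    ultimately show ?thesis by simp
  qed
  have T0: "?T 0 = d (W 0 y)" using t_pow[OF W_in[OF y(1)]] by simp
  \<comment> \<open>In the last face a single rotation has moved the weight to position 1; with the
    first face it forms the left side of \<open>dW01\<close>.\<close>
  have "(t ^^ n) (d (W 1 y)) = d (W 1 y)" using t_pow[OF d_in[OF W_in[OF yS]]] Suc by simp
  then have Tn: "?T n = d (W 1 y)" using tW[OF y(1), of 0] Suc y(2) by simp
  have split: "(\<Sum>i\<le>Suc k. f i) = f 0 + (\<Sum>i<k. f (Suc i)) + f (Suc k)" for f :: "nat \<Rightarrow> 'x \<Rightarrow>\<^sub>0 'k"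
    by (induction k) (simp_all add: add_ac)
  have "b (W 0 y) = (\<Sum>i\<le>n. ?T i)" by (rule b_sum[OF W_in[OF y(1)]])
  also have "\<dots> = ?T 0 + (\<Sum>i<k. ?T (Suc i)) + ?T n"
    unfolding Suc by (rule split)
  also have "(\<Sum>i<k. ?T (Suc i)) = (\<Sum>i<k. W 0 ((t ^^ Suc i) (d y)))"
    by (intro sum.cong refl T) (use Suc in auto)
  also have "?T 0 + (\<Sum>i<k. W 0 ((t ^^ Suc i) (d y))) + ?T n = W 0 (d y) + (\<Sum>i<k. W 0 ((t ^^ Suc i) (d y)))"
    unfolding T0 Tn dW01[OF yS, symmetric] by (simp add: add_ac)
  also have "\<dots> = W 0 (\<Sum>i<Suc k. (t ^^ i) (d y))" by (simp only: W_simps sum.lessThan_Suc_shift funpow_0)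
  also have "\<dots> = W 0 (bp y)" unfolding Suc bp_inv[OF yS y(2)] N_def lessThan_Suc_atMost ..
  finally show ?thesis .
qed

text \<open>The rotations move the weight through all positions, and the weights of all factors add
  up to \<open>m\<close>.\<close>

lemma N_W: assumes "y \<in> TX n" "t y = y" shows "N n (W 0 y) = scal (of_nat m) y"
proof -
  have "N n (W 0 y) = (\<Sum>k\<le>n. W k y)" unfolding N_def
    by (intro sum.cong refl) (use tpW[OF assms(1), of 0] assms(2) in \<open>simp add: tp_fix\<close>)
  then show ?thesis using sumW[OF assms(1)] by simp
qed

section \<open>Invariants, the section of the norm, and cyclic dimensions\<close>

definition K where "K n = {y \<in> TX n. t y = y}"

lemma subK: "free_vs.subspace (K n)"
  unfolding K_def using subX by (auto simp: free_vs.subspace_def t_simps)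

lemma fdK: "fd (K n)" by (rule fd_mono[OF fdX subK]) (auto simp: K_def)

lemma N_inK: "x \<in> TX n \<Longrightarrow> N n x \<in> K n" by (simp add: K_def N_in t_N)

text \<open>A right inverse of the norm and a chain map from (K, bp) to (TX, b). The division by
  \<open>m\<close> uses positive degree and characteristic 0.\<close>

definition sec where "sec y = scal (1 / of_nat m) (W 0 y)"

lemma sec: assumes "y \<in> K n" shows "sec y \<in> TX n" "N n (sec y) = y" "b (sec y) = sec (bp y)"
proof -
  show "sec y \<in> TX n" using assms unfolding sec_def K_def by (auto intro: TX_cl W_in)
  show "N n (sec y) = y" unfolding sec_def using assms N_W[of y n] m_pos by (simp add: K_def N_simps)
  show "b (sec y) = sec (bp y)" unfolding sec_def using assms b_W[of y n] by (simp add: K_def b_simps)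
qed

lemma N_image: "N n ` TX n = K n"
  using N_inK sec(1,2) by (force simp: image_iff)

lemma bp_K: "y \<in> K (Suc n) \<Longrightarrow> bp y \<in> K n" by (auto simp: K_def bp_in t_bp)

lemma sec_0: "sec 0 = 0" by (simp add: sec_def W_simps)

text \<open>Not an axiom of the locale: \<open>x\<close> is some \<open>w - t w\<close> plus the
  section of its norm, and on both parts \<open>b\<close> is intertwined with \<open>bp\<close>,
  whose square is 0.\<close>

lemma bb: assumes "x \<in> TX n" shows "b (b x) = 0"
proof -
  have Nx: "N n x \<in> K n" by (rule N_inK[OF assms])
  have "N n (x - sec (N n x)) = 0" using sec(2)[OF Nx] by (simp add: N_simps)
  moreover have "x - sec (N n x) \<in> TX n" by (intro TX_cl assms sec(1) Nx)
  ultimately obtain w where w: "w \<in> TX n" "x - sec (N n x) = w - t w" using N_eq_0 by blast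
  have "b (b (w - t w)) = 0"
  proof (cases n)
    case 0 then show ?thesis using w by (simp add: b_0 TX_cl t_in b_simps)
  next
    case (Suc k)
    then have "bp w \<in> TX k" using w bp_in by simp
    then show ?thesis using b_1t[OF w(1)] b_1t[of "bp w" k] bpbp[OF w(1)] by (simp add: t_simps)
  qed
  moreover have "b (b (sec (N n x))) = 0"
  proof (cases n)
    case 0 then show ?thesis using sec(1)[OF Nx] by (simp add: b_0 b_simps)
  next
    case (Suc k)
    then have "bp (N n x) \<in> K k" using Nx bp_K by simp
    then show ?thesis using sec(3)[OF Nx] sec(3)[of "bp (N n x)" k] bpbp[of "N n x" n] N_in[OF assms]
      by (simp add: sec_0)
  qed
  moreover have "x = (w - t w) + sec (N n x)" using w(2) by (metis diff_add_cancel)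
  ultimately show ?thesis by (metis b_simps(1) add_0)
qed

text \<open>Cycles and homology of the complex (K, bp). In characteristic 0 the norm identifies
  coinvariants with invariants, so \<open>cn\<close> is the dimension of cyclic homology as far as
  the given complex computes it.\<close>

definition zk where "zk n = free_vs.dim {y \<in> K n. bp y = 0}"
definition cn where "cn n = zk n - free_vs.dim (bp ` K (Suc n))"

lemma dim_zero: "free_vs.dim {0 :: 'x \<Rightarrow>\<^sub>0 'k} = 0"
  using dim_spn[of "{} :: 'x set", where 'k = 'k] by (simp add: spn_def)

lemma sub_cyc: "free_vs.subspace {y \<in> K n. bp y = 0}" by (rule lin_kernelI[OF lin_bp subK])

lemma bpK_sub: "bp ` K (Suc n) \<subseteq> {y \<in> K n. bp y = 0}"
  using bp_K bpbp by (auto simp: K_def)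

lemma cn_dim: "cn n + free_vs.dim (bp ` K (Suc n)) = zk n"
  unfolding cn_def zk_def using dim_fd_mono[OF fd_mono[OF fdK[of n] sub_cyc[of n]] lin_imageI[OF lin_bp subK] bpK_sub] by auto

lemma cn_eq: "cn n + free_vs.dim (K (Suc n)) = zk n + zk (Suc n)"
  using rank_nullity[OF lin_bp fdK, of "Suc n"] cn_dim[of n] by (simp add: zk_def)

lemma zk_0: "zk 0 = free_vs.dim (K 0)"
proof -
  have "{y \<in> K 0. bp y = 0} = K 0" using bp_0 by (auto simp: K_def)
  then show ?thesis by (simp add: zk_def)
qed

lemma lin_1t: "lin (\<lambda>x. x - t x)" by (rule lin_minus_fun[OF lin_id lin_t])

text \<open>\<open>sec\<close> splits the complex \<open>(TX, b)\<close> into \<open>(K, bp)\<close> and \<open>ker N = (1 - t) TX\<close>.\<close>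

lemma hochschild_dim:
  assumes acyc: "\<And>n x. x \<in> TX n \<Longrightarrow> bp x = 0 \<Longrightarrow> \<exists>w\<in>TX (Suc n). x = bp w"
  shows "free_vs.dim {x \<in> TX n. b x = 0} = free_vs.dim (b ` TX (Suc n)) + cn n + (if n = 0 then 0 else cn (n - 1))"
proof -
  define zb where "zb n = free_vs.dim {x \<in> TX n. b x = 0}" for n
  define a where "a n = free_vs.dim {x \<in> {x \<in> TX n. b x = 0}. N n x = 0}" for n
  define zp where "zp n = free_vs.dim {x \<in> TX n. bp x = 0}" for n
  \<comment> \<open>\<open>U\<close> is the source of two surjections: \<open>1 - t\<close> onto the
    \<open>b\<close>-cycles of norm 0, with kernel \<open>K\<close>, and \<open>bp\<close> onto the
    invariant cycles one degree lower, with kernel the \<open>bp\<close>-cycles. Counting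
    \<open>U\<close> twice yields the number \<open>a\<close> of cycles of norm 0.\<close>
  define U where "U n = {w \<in> TX n. t (bp w) = bp w}" for n
  define zk' where "zk' n = (if n = 0 then 0 else zk (n - 1))" for n
  have fdU: "fd (U n)" for n
    by (rule fd_mono[OF fdX]) (use subX in \<open>auto simp: U_def free_vs.subspace_def bp_simps t_simps\<close>)
  have fdZ: "fd {x \<in> TX n. b x = 0}" for n
    by (rule fd_mono[OF fdX lin_kernelI[OF lin_b subX]]) auto
  have 1: "zb n = zk n + a n" for n
  proof -
    have "N n ` {x \<in> TX n. b x = 0} = {y \<in> K n. bp y = 0}"
    proof
      show "N n ` {x \<in> TX n. b x = 0} \<subseteq> {y \<in> K n. bp y = 0}" by (auto simp: N_inK bp_N' N_simps)
      show "{y \<in> K n. bp y = 0} \<subseteq> N n ` {x \<in> TX n. b x = 0}"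
      proof
        fix y assume "y \<in> {y \<in> K n. bp y = 0}"
        then show "y \<in> N n ` {x \<in> TX n. b x = 0}"
          using sec[of y n] by (intro image_eqI[of _ _ "sec y"]) (auto simp: sec_0)
      qed
    qed
    then show ?thesis using rank_nullity[OF lin_N fdZ, of n n] by (simp add: zb_def a_def zk_def)
  qed
  have 2: "free_vs.dim (U n) = a n + free_vs.dim (K n)" for n
  proof -
    have "(\<lambda>x. x - t x) ` U n = {x \<in> {x \<in> TX n. b x = 0}. N n x = 0}"
    proof
      show "(\<lambda>x. x - t x) ` U n \<subseteq> {x \<in> {x \<in> TX n. b x = 0}. N n x = 0}"
        by (auto simp: U_def b_1t N_1t TX_cl t_in)
      show "{x \<in> {x \<in> TX n. b x = 0}. N n x = 0} \<subseteq> (\<lambda>x. x - t x) ` U n"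
      proof
        fix x assume x: "x \<in> {x \<in> {x \<in> TX n. b x = 0}. N n x = 0}"
        then obtain w where w: "w \<in> TX n" "x = w - t w" using N_eq_0[of x n] by blast
        with x have "w \<in> U n" using b_1t[of w n] by (simp add: U_def)
        with w show "x \<in> (\<lambda>x. x - t x) ` U n" by auto
      qed
    qed
    moreover have "{x \<in> U n. x - t x = 0} = K n" by (auto simp: U_def K_def t_bp)
    ultimately show ?thesis using rank_nullity[OF lin_1t fdU, of n] by (simp add: a_def)
  qed
  have 3: "free_vs.dim (U n) = zk' n + zp n" for n
  proof -
    have "{x \<in> U n. bp x = 0} = {x \<in> TX n. bp x = 0}" by (auto simp: U_def t_simps)
    moreover have "free_vs.dim (bp ` U n) = zk' n"
    proof (cases n)
      case 0
      then have "bp w = 0" if "w \<in> U n" for w using that by (simp add: U_def bp_0)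
      moreover have "0 \<in> U n" using fd_subspace[OF fdU[of n]] by (rule free_vs.subspace_0)
      ultimately have "bp ` U n = {0}" by (auto simp: image_iff)
      then show ?thesis using 0 by (simp add: zk'_def dim_zero)
    next
      case (Suc k)
      \<comment> \<open>Acyclicity enters here: an invariant cycle is \<open>bp w\<close> for some
        \<open>w\<close>, and such a \<open>w\<close> lies in \<open>U\<close>.\<close>
      have "bp ` U n = {y \<in> K k. bp y = 0}"
      proof
        show "bp ` U n \<subseteq> {y \<in> K k. bp y = 0}" using Suc bpbp by (auto simp: U_def K_def bp_in)
        show "{y \<in> K k. bp y = 0} \<subseteq> bp ` U n"
        proof
          fix y assume y: "y \<in> {y \<in> K k. bp y = 0}"
          then obtain w where "w \<in> TX n" "y = bp w" using acyc[of y k] Suc by (auto simp: K_def)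
          with y show "y \<in> bp ` U n" by (auto simp: U_def K_def)
        qed
      qed
      then show ?thesis using Suc by (simp add: zk'_def zk_def)
    qed
    ultimately show ?thesis using rank_nullity[OF lin_bp fdU, of n] by (simp add: zp_def)
  qed
  have 4: "free_vs.dim (TX (Suc n)) = zp n + zp (Suc n)" for n
  proof -
    have "bp ` TX (Suc n) = {x \<in> TX n. bp x = 0}" using acyc bpbp bp_in by (force simp: image_iff)
    then show ?thesis using rank_nullity[OF lin_bp fdX, of "Suc n"] by (simp add: zp_def)
  qed
  have 5: "free_vs.dim (TX (Suc n)) = free_vs.dim (b ` TX (Suc n)) + zb (Suc n)"
    using rank_nullity[OF lin_b fdX, of "Suc n"] by (simp add: zb_def)
  show ?thesis
    using 1[of n] 1[of "Suc n"] 2[of n] 2[of "Suc n"] 3[of n] 3[of "Suc n"] 4[of n] 5 cn_eq[of n] cn_eq[of "n - 1"] zk_0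
    unfolding zb_def[symmetric] by (cases n) (simp_all add: zk'_def)
qed

text \<open>The normalised Hochschild complex is the mapping cone of \<open>1 - t : (TX, bp) \<rightarrow> (TX, b)\<close>, the
  map \<open>j\<close> being the insertion of the unit in front.\<close>

lemma cone_dim:
  fixes j p B :: "('x \<Rightarrow>\<^sub>0 'k) \<Rightarrow> ('x \<Rightarrow>\<^sub>0 'k)"
  assumes lin_j: "lin j" and lin_p: "lin p" and lin_B: "lin B"
    and pX: "\<And>n x. x \<in> TX n \<Longrightarrow> p x = x" and pj: "\<And>y. p (j y) = 0" and jinj: "\<And>y. j y = 0 \<Longrightarrow> y = 0"
    and BX: "\<And>n x. x \<in> TX n \<Longrightarrow> B x = b x"
    and Bj: "\<And>n y. y \<in> TX n \<Longrightarrow> B (j y) = y - t y - j (bp y)"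
  defines "C \<equiv> \<lambda>n. {x + j y | x y. x \<in> TX n \<and> y \<in> (if n = 0 then {0} else TX (n - 1))}"
  shows "free_vs.dim {x \<in> C n. B x = 0} = free_vs.dim (B ` C (Suc n)) + cn n + (if n = 0 then 0 else cn (n - 1))"
    and "fd (C n)"
proof -
  note j_simps = lin_simps[OF lin_j] and p_simps = lin_simps[OF lin_p] and B_simps = lin_simps[OF lin_B]
  define Y where "Y n = (if n = 0 then {0} else TX (n - 1))" for n
  define zk' where "zk' n = (if n = 0 then 0 else zk (n - 1))" for n
  define x' where "x' n = (if n = 0 then 0 else free_vs.dim (TX (n - 1)))" for n
  define z where "z n = free_vs.dim {x \<in> C n. B x = 0}" for n
  have subY: "free_vs.subspace (Y n)" and fdY: "fd (Y n)" for n
    using subX fdX by (auto simp: Y_def fd_def)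
  have C_iff: "C n = {x + j y | x y. x \<in> TX n \<and> y \<in> Y n}" for n by (simp add: C_def Y_def)
  have YX: "y \<in> Y n \<Longrightarrow> y \<in> TX (n - 1)" for y n using TX_cl by (auto simp: Y_def split: if_splits)
  have BC: "B (x + j y) = (b x + (y - t y)) - j (bp y)" if "x \<in> TX n" "y \<in> Y n" for x y n
    using that BX Bj[OF YX] by (simp add: B_simps)
  have inX: "b x + (y - t y) \<in> TX (n - 1)" if "x \<in> TX n" "y \<in> Y n" for x y n
    using that YX[of y n] by (cases n) (auto intro!: TX_cl b_in t_in simp: b_0 Y_def)
  have B0: "B (x + j y) = 0 \<longleftrightarrow> b x + (y - t y) = 0 \<and> bp y = 0" if "x \<in> TX n" "y \<in> Y n" for x y n
  proof
    assume h: "B (x + j y) = 0"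
    have "p (B (x + j y)) = b x + (y - t y)" unfolding BC[OF that] using pX[OF inX[OF that]] pj by (simp add: p_simps)
    with h have *: "b x + (y - t y) = 0" by (simp add: p_simps)
    with h BC[OF that] have "j (bp y) = 0" by simp
    with * jinj show "b x + (y - t y) = 0 \<and> bp y = 0" by blast
  qed (simp add: BC[OF that] j_simps)
  have pC: "p (x + j y) = x" if "x \<in> TX n" for x y n using that pX pj by (simp add: p_simps)
  have subC: "free_vs.subspace (C n)" for n
    using free_vs.subspace_sums[OF subX lin_imageI[OF lin_j subY], of n n]
    by (rule back_subst[of free_vs.subspace]) (auto simp: C_iff)
  have fdC: "fd (C n)" for n
  proof -
    obtain S T where ST: "finite S" "TX n \<subseteq> free_vs.span S" "finite T" "j ` Y n \<subseteq> free_vs.span T"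
      using fdX[of n] fd_image[OF lin_j fdY, of n] by (auto simp: fd_def)
    have "C n \<subseteq> free_vs.span (S \<union> T)"
      unfolding C_iff free_vs.span_Un using ST by fastforce
    then show ?thesis using subC ST by (auto simp: fd_def)
  qed
  then show "fd (C n)" .
  have fdZ: "fd {x \<in> C n. B x = 0}" for n
    by (rule fd_mono[OF fdC lin_kernelI[OF lin_B subC]]) auto
  have XC: "x \<in> C n" if "x \<in> TX n" for x n
  proof -
    have "x = x + j 0" by (simp add: j_simps)
    then show ?thesis using that free_vs.subspace_0[OF subY[of n]] unfolding C_iff by blast
  qed
  have dimC: "free_vs.dim (C n) = free_vs.dim (TX n) + x' n" for n
  proof -
    have "p ` C n = TX n"
    proof (intro equalityI subsetI)
      show "x \<in> p ` C n" if "x \<in> TX n" for x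
        using pX[OF that] XC[OF that] by (metis imageI)
      show "v \<in> TX n" if "v \<in> p ` C n" for v using that pC[of _ n] unfolding C_iff by auto
    qed
    moreover have "{v \<in> C n. p v = 0} = j ` Y n"
    proof
      show "{v \<in> C n. p v = 0} \<subseteq> j ` Y n" using pC[of _ n] by (auto simp: C_iff)
      have "j y \<in> C n" if "y \<in> Y n" for y
      proof -
        have "j y = 0 + j y" by simp
        then show ?thesis using that TX_cl(5)[of n] unfolding C_iff by blast
      qed
      then show "j ` Y n \<subseteq> {v \<in> C n. p v = 0}" using pj by blast
    qed
    moreover have "free_vs.dim (j ` Y n) = x' n"
      using dim_inj_image[OF lin_j fdY, of n] jinj by (auto simp: Y_def x'_def dim_zero)
    ultimately show ?thesis using rank_nullity[OF lin_p fdC, of n] by simp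
  qed
  have dimN: "free_vs.dim (TX n) = free_vs.dim (K n) + free_vs.dim {x \<in> TX n. N n x = 0}" for n
    using rank_nullity[OF lin_N fdX, of n n] by (simp add: N_image)
  \<comment> \<open>Cycles of the cone are counted in three layers: the norm of the first component
    reaches every invariant cycle, first components of norm 0 all lift, and what remains consists of
    invariant cycles behind the inserted unit.\<close>
  have zdim: "z n + free_vs.dim (K n) = zk n + free_vs.dim (TX n) + zk' n" for n
  proof -
    let ?Z = "{v \<in> C n. B v = 0}"
    let ?A = "{v \<in> ?Z. N n (p v) = 0}"
    have lNp: "lin (\<lambda>v. N n (p v))" by (rule lin_comp[OF lin_N lin_p])
    have "(\<lambda>v. N n (p v)) ` ?Z = {y \<in> K n. bp y = 0}"
    proof
      show "(\<lambda>v. N n (p v)) ` ?Z \<subseteq> {y \<in> K n. bp y = 0}"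
      proof clarsimp
        fix v assume "v \<in> C n" "B v = 0"
        then obtain x y where v: "v = x + j y" "x \<in> TX n" "y \<in> Y n" "b x + (y - t y) = 0"
          using B0 by (auto simp: C_iff)
        have "b x = - (y - t y)" using v(4) by (simp only: eq_neg_iff_add_eq_0)
        then have "N (n - 1) (b x) = - N (n - 1) (y - t y)" by (simp only: N_simps)
        also have "\<dots> = 0" using N_1t[OF YX[OF v(3)]] by simp
        finally have "bp (N n x) = 0" using bp_N'[OF v(2)] by simp
        then show "N n (p v) \<in> K n \<and> bp (N n (p v)) = 0" using v pC N_inK by simp
      qed
      show "{y \<in> K n. bp y = 0} \<subseteq> (\<lambda>v. N n (p v)) ` ?Z"
      proof
        fix y assume y: "y \<in> {y \<in> K n. bp y = 0}"
        then have "sec y \<in> ?Z" using sec[of y n] XC BX by (auto simp: sec_0)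
        moreover have "N n (p (sec y)) = y" using y sec[of y n] pX by auto
        ultimately show "y \<in> (\<lambda>v. N n (p v)) ` ?Z" by force
      qed
    qed
    then have e1: "z n = zk n + free_vs.dim ?A"
      using rank_nullity[OF lNp fdZ, of n] by (simp add: z_def zk_def)
    have fdA: "fd ?A" by (rule fd_mono[OF fdZ lin_kernelI[OF lNp fd_subspace[OF fdZ]]]) auto
    have "p ` ?A = {x \<in> TX n. N n x = 0}"
    proof
      show "p ` ?A \<subseteq> {x \<in> TX n. N n x = 0}" using pC by (auto simp: C_iff)
      show "{x \<in> TX n. N n x = 0} \<subseteq> p ` ?A"
      proof
        fix x assume x: "x \<in> {x \<in> TX n. N n x = 0}"
        then obtain w where w: "w \<in> TX n" "x = w - t w" using N_eq_0[of x n] by blast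
        \<comment> \<open>The second component has to cancel \<open>b x\<close>, which for
          \<open>x = w - t w\<close> equals \<open>bp w - t (bp w)\<close>.\<close>
        have y: "- bp w \<in> Y n" using w(1) by (cases n) (auto simp: Y_def bp_0 intro!: TX_cl bp_in)
        have "B (x + j (- bp w)) = 0"
          using B0[of x n, OF _ y] x b_1t[OF w(1)] bpbp[OF w(1)] by (simp add: w(2) bp_simps t_simps)
        moreover have "x + j (- bp w) \<in> C n" using x y by (auto simp: C_iff)
        moreover have "p (x + j (- bp w)) = x" using x pC by auto
        ultimately show "x \<in> p ` ?A" using x by (intro image_eqI[of _ _ "x + j (- bp w)"]) auto
      qed
    qed
    moreover have "free_vs.dim {v \<in> ?A. p v = 0} = zk' n"
    proof -
      have "{v \<in> ?A. p v = 0} = j ` {y \<in> Y n. y - t y = 0 \<and> bp y = 0}"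
      proof
        show "{v \<in> ?A. p v = 0} \<subseteq> j ` {y \<in> Y n. y - t y = 0 \<and> bp y = 0}"
        proof
          fix v assume v: "v \<in> {v \<in> ?A. p v = 0}"
          then obtain x y where xy: "v = x + j y" "x \<in> TX n" "y \<in> Y n" by (auto simp: C_iff)
          with v have "x = 0" using pC by auto
          with v xy B0[OF xy(2,3)] show "v \<in> j ` {y \<in> Y n. y - t y = 0 \<and> bp y = 0}" by (auto simp: b_simps)
        qed
        show "j ` {y \<in> Y n. y - t y = 0 \<and> bp y = 0} \<subseteq> {v \<in> ?A. p v = 0}"
        proof
          fix v assume "v \<in> j ` {y \<in> Y n. y - t y = 0 \<and> bp y = 0}"
          then obtain y where y: "v = j y" "y \<in> Y n" "y - t y = 0" "bp y = 0" by auto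
          have "B (0 + j y) = 0" using B0[of 0 n y] y TX_cl(5) by (simp add: b_simps)
          moreover have "0 + j y \<in> C n" using y TX_cl(5) unfolding C_iff by blast
          ultimately show "v \<in> {v \<in> ?A. p v = 0}" using y pj by (simp add: N_simps)
        qed
      qed
      moreover have "free_vs.dim (j ` {y \<in> Y n. y - t y = 0 \<and> bp y = 0}) = free_vs.dim {y \<in> Y n. y - t y = 0 \<and> bp y = 0}"
        by (rule dim_inj_image[OF lin_j fd_mono[OF fdY]])
          (use subY[of n] jinj in \<open>auto simp: free_vs.subspace_def t_simps bp_simps\<close>)
      moreover have "free_vs.dim {y \<in> Y n. y - t y = 0 \<and> bp y = 0} = zk' n"
      proof (cases n)
        case 0
        then have "{y \<in> Y n. y - t y = 0 \<and> bp y = 0} = {0}" by (auto simp: Y_def t_simps bp_simps)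
        then show ?thesis using 0 by (simp add: zk'_def dim_zero)
      next
        case (Suc k)
        then have "{y \<in> Y n. y - t y = 0 \<and> bp y = 0} = {y \<in> K k. bp y = 0}" by (auto simp: Y_def K_def)
        then show ?thesis using Suc by (simp add: zk'_def zk_def)
      qed
      ultimately show ?thesis by simp
    qed
    ultimately show ?thesis using e1 rank_nullity[OF lin_p fdA] dimN[of n] by simp
  qed
  have 5: "free_vs.dim (C (Suc n)) = free_vs.dim (B ` C (Suc n)) + z (Suc n)"
    using rank_nullity[OF lin_B fdC, of "Suc n"] by (simp add: z_def)
  show "free_vs.dim {x \<in> C n. B x = 0} = free_vs.dim (B ` C (Suc n)) + cn n + (if n = 0 then 0 else cn (n - 1))"
    using zdim[of n] zdim[of "Suc n"] 5 dimC[of "Suc n"] cn_eq[of n] cn_eq[of "n - 1"] zk_0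
    unfolding z_def[symmetric] by (cases n) (simp_all add: zk'_def x'_def)
qed

text \<open>By \<open>cn_eq\<close> the alternating sums telescope: up to \<open>L\<close> they
  differ by the dimension of \<open>K L\<close> minus \<open>zk L\<close>, up to sign, and this
  vanishes where the complex ends.\<close>

lemma euler_cn:
  assumes "\<And>n. n \<ge> M \<Longrightarrow> TX n = {0}"
  shows "(\<Sum>n<M. (- 1) ^ n * int (cn n)) = (\<Sum>n<M. (- 1) ^ n * int (free_vs.dim (K n)))"
proof -
  have "(\<Sum>n<L. (- 1) ^ n * int (cn n)) = (\<Sum>n<L. (- 1) ^ n * int (free_vs.dim (K n))) 
      + (- 1) ^ L * (int (free_vs.dim (K L)) - int (zk L))" for L
  proof (induction L)
    case 0 then show ?case using zk_0 by simp
  next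
    case (Suc L)
    have "int (cn L) = int (zk L) + int (zk (Suc L)) - int (free_vs.dim (K (Suc L)))" using cn_eq[of L] by linarith
    then have "(- 1) ^ L * int (cn L) = (- 1) ^ L * (int (zk L) + int (zk (Suc L)) - int (free_vs.dim (K (Suc L))))" by simp
    then show ?case using Suc by (simp add: algebra_simps)
  qed
  moreover have "K M = {0}" using assms[of M] subK[of M] free_vs.subspace_0 by (fastforce simp: K_def)
  moreover have "zk M = 0"
  proof -
    have "{y \<in> K M. bp y = 0} = {0}" unfolding \<open>K M = {0}\<close> using lin_0[OF lin_bp] by auto
    then show ?thesis by (simp add: zk_def dim_zero)
  qed
  ultimately show ?thesis by (simp add: dim_zero)
qed

end

section \<open>The total complex of the cyclic bicomplex\<close>

context cyclic_cx
begin

text \<open>Column \<open>p\<close> in total degree \<open>n\<close>, set to 0 beyond the diagonal,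
  so that a chain is a family over all \<open>p\<close>.\<close>

definition Col :: "nat \<Rightarrow> nat \<Rightarrow> ('x \<Rightarrow>\<^sub>0 'k) set" where
  "Col n p = (if p \<le> n then TX (n - p) else {0})"

definition dcol :: "nat \<Rightarrow> ('x \<Rightarrow>\<^sub>0 'k) \<Rightarrow> ('x \<Rightarrow>\<^sub>0 'k)" where
  "dcol p x = (if even p then b x else - bp x)"

lemma lin_dcol: "lin (dcol p)"
  unfolding dcol_def using lin_b lin_scal_fun[OF lin_bp, of "- 1"] by (cases "even p") simp_all

lemmas dcol_simps = lin_simps[OF lin_dcol]

lemma subCol: "free_vs.subspace (Col n p)" by (simp add: Col_def subX)

lemma dcol_in: "y \<in> Col (Suc n) p \<Longrightarrow> dcol p y \<in> Col n p"
proof -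
  assume y: "y \<in> Col (Suc n) p"
  consider "p \<le> n" | "p = Suc n" | "p > Suc n" by linarith
  then show ?thesis
  proof cases
    case 1
    then have "y \<in> TX (Suc (n - p))" using y by (simp add: Col_def Suc_diff_le)
    then show ?thesis using 1 by (auto simp: Col_def dcol_def intro: b_in bp_in TX_cl)
  next
    case 2
    then show ?thesis using y by (simp add: Col_def dcol_def b_0 bp_0)
  next
    case 3
    then show ?thesis using y by (simp add: Col_def dcol_simps)
  qed
qed

lemma dcol_dcol: "y \<in> TX n \<Longrightarrow> dcol p (dcol p y) = 0"
  by (simp add: dcol_def bb bpbp bp_simps)

text \<open>As the rows are exact, a cycle of the total complex is a boundary if the norm of its
  zeroth column is a boundary of \<open>(K, bp)\<close>.\<close>

lemma total_chase:
  assumes lin_NN: "lin NN" and NN: "\<And>n x. x \<in> TX n \<Longrightarrow> NN x = N n x"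
  defines "r \<equiv> \<lambda>p y. if odd p then y - t y else NN y"
  assumes xin: "\<And>p. x p \<in> Col n p"
    and cyc: "\<And>p. dcol p (x p) + r (Suc p) (x (Suc p)) = 0"
    and bd: "NN (x 0) \<in> bp ` K (Suc n)"
  shows "\<exists>y. (\<forall>p. y p \<in> Col (Suc n) p) \<and> (\<forall>p. x p = dcol p (y p) + r (Suc p) (y (Suc p)))"
proof -
  have lin_r: "lin (r p)" for p unfolding r_def using lin_NN lin_1t by (cases "odd p") simp_all
  note r_simps = lin_simps[OF lin_r]
  have dr: "dcol p (r (Suc p) w) + r (Suc p) (dcol (Suc p) w) = 0" if "w \<in> TX k" for p w k
  proof (cases "even p")
    case True
    then show ?thesis using b_1t[OF that] by (simp add: r_def dcol_def t_simps)
  next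
    case False
    have "NN (b w) = N (k - 1) (b w)"
    proof (cases k)
      case 0 then show ?thesis using that NN[OF TX_cl(5), of 0] by (simp add: b_0 N_simps)
    next
      case (Suc l) then show ?thesis using that NN[of "b w" l] b_in by simp
    qed
    then show ?thesis using False bp_N'[OF that] NN[OF that] by (simp add: r_def dcol_def)
  qed
  \<comment> \<open>Exactness of the rows. For even \<open>p\<close> this is \<open>N_eq_0\<close>;
    for odd \<open>p\<close> the element is invariant, hence the norm of itself divided by the
    number of rotations.\<close>
  have ex: "\<exists>w \<in> Col n p. z = r (Suc p) w" if "z \<in> Col n p" "r p z = 0" for z p
  proof (cases "p \<le> n")
    case True
    then have z: "z \<in> TX (n - p)" using that by (simp add: Col_def)
    show ?thesis
    proof (cases "even p")
      case True
      with that(2) z have "N (n - p) z = 0" using NN by (simp add: r_def)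
      with z obtain w where "w \<in> TX (n - p)" "z = w - t w" using N_eq_0 by blast
      with True \<open>p \<le> n\<close> show ?thesis by (auto simp: Col_def r_def)
    next
      case False
      with that(2) have tz: "t z = z" by (simp add: r_def)
      define w where "w = scal (1 / of_nat (Suc (n - p))) z"
      have w: "w \<in> TX (n - p)" unfolding w_def by (intro TX_cl z)
      have "t w = w" using tz by (simp add: w_def t_simps)
      have "N (n - p) w = scal (of_nat (Suc (n - p))) w" by (rule N_inv[OF \<open>t w = w\<close>])
      then have "N (n - p) w = z" by (simp add: w_def del: of_nat_Suc)
      then have "NN w = z" using NN[OF w] by simp
      then show ?thesis using w False \<open>p \<le> n\<close> by (auto simp: Col_def r_def)
    qed
  next
    case False
    with that have "z = 0" by (simp add: Col_def)
    then show ?thesis using False by (auto simp: Col_def r_simps)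
  qed
  \<comment> \<open>The columns are solved one after the other. The invariant says that the
    remainder in column \<open>p\<close> is killed by the next row map and so is hit from column
    \<open>p + 1\<close>. For \<open>p = 0\<close> that map is the norm, an augmentation outside the
    bicomplex, and the hypothesis on \<open>NN (x 0)\<close> starts the recursion.\<close>
  let ?P = "\<lambda>p y. y \<in> Col (Suc n) p \<and> r p (x p - dcol p y) = 0"
  have "\<exists>y. \<forall>p. ?P p (y p) \<and> x p = dcol p (y p) + r (Suc p) (y (Suc p))"
  proof (rule dependent_nat_choice)
    obtain k where k: "k \<in> K (Suc n)" "NN (x 0) = bp k" using bd by auto
    have "NN (b (sec k)) = bp k"
      using sec(2)[OF bp_K[OF k(1)]] sec(3)[OF k(1)] NN[OF sec(1)[OF bp_K[OF k(1)]]] by simp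
    then have "?P 0 (sec k)"
      using sec(1)[OF k(1)] k(2) by (simp add: Col_def r_def dcol_def lin_diff[OF lin_NN])
    then show "\<exists>y. ?P 0 y" by blast
  next
    fix y p assume P: "?P p y"
    have "x p - dcol p y \<in> Col n p"
      using P xin dcol_in free_vs.subspace_diff[OF subCol] by blast
    with ex P obtain w where w: "w \<in> Col n p" "x p - dcol p y = r (Suc p) w" by blast
    have wS: "w \<in> Col (Suc n) (Suc p)" using w(1) by (auto simp: Col_def split: if_splits)
    have yk: "\<exists>k. y \<in> TX k" "\<exists>k. w \<in> TX k" using P w(1) TX_cl(5) by (auto simp: Col_def split: if_splits)
    have xp: "x p = dcol p y + r (Suc p) w" using w(2) by (metis diff_add_cancel add.commute)
    have "dcol p (x p) = dcol p (r (Suc p) w)" unfolding xp using dcol_dcol yk(1) by (auto simp: dcol_simps)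
    moreover have "dcol p (r (Suc p) w) = - r (Suc p) (dcol (Suc p) w)"
      using dr yk(2) by (metis eq_neg_iff_add_eq_0)
    moreover have "r (Suc p) (x (Suc p)) = - dcol p (x p)" using cyc[of p] by (metis add.commute eq_neg_iff_add_eq_0)
    ultimately have "r (Suc p) (x (Suc p) - dcol (Suc p) w) = 0" by (simp add: r_simps)
    then show "\<exists>w. ?P (Suc p) w \<and> x p = dcol p y + r (Suc p) w" using wS xp by blast
  qed
  then show ?thesis by blast
qed

end

section \<open>The tensor powers of the down-up algebra\<close>

text \<open>A list \<open>[w\<^sub>0, \<dots>, w\<^sub>n]\<close> of irreducible words stands for the basis tensor
  \<open>w\<^sub>0 \<otimes> \<dots> \<otimes> w\<^sub>n\<close>; the convolution product concatenates tensors.\<close>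

fun gbar :: "('a \<Rightarrow> 'a \<Rightarrow> ('a list \<Rightarrow>\<^sub>0 'k::field)) \<Rightarrow> 'a list \<Rightarrow> ('a list \<Rightarrow>\<^sub>0 'k)" where
  "gbar \<phi> (x # y # q) = \<phi> x y * bas q - bas [x] * gbar \<phi> (y # q)"
| "gbar \<phi> q = 0"

lemma gbar_sum:
  "gbar \<phi> ws = (\<Sum>i<length ws - 1. scal ((- 1) ^ i) (bas (take i ws) * \<phi> (ws ! i) (ws ! Suc i) * bas (drop (i + 2) ws)))"
proof (induction \<phi> ws rule: gbar.induct)
  case (1 \<phi> x y q)
  have "bas [x] * gbar \<phi> (y # q) = (\<Sum>i<length q. scal ((- 1) ^ i)
     (bas (x # take i (y # q)) * \<phi> ((y # q) ! i) ((y # q) ! Suc i) * bas (drop (i + 2) (y # q))))"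
    unfolding 1 by (simp add: sum_distrib_left scal_mult mult.assoc[symmetric])
  then show ?case
    by (simp add: sum.lessThan_Suc_shift one_eq_bas[symmetric] free_vs.scale_minus_left sum_negf
        del: sum.lessThan_Suc single_one)
qed auto

text \<open>The faces inside \<open>p\<close>, the one across the seam, and those inside
  \<open>q\<close>; used to isolate the faces next to a marked factor.\<close>

lemma gbar_append:
  assumes "p \<noteq> []" "q \<noteq> []"
  shows "gbar \<phi> (p @ q) = gbar \<phi> p * bas q
    + scal ((- 1) ^ (length p - 1)) (bas (butlast p) * \<phi> (last p) (hd q) * bas (tl q))
    + scal ((- 1) ^ length p) (bas p * gbar \<phi> q)"
  using assms(1)
proof (induction \<phi> p rule: gbar.induct)
  case (1 \<phi> x y r)
  have IH: "gbar \<phi> ((y # r) @ q) = gbar \<phi> (y # r) * bas q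
    + scal ((- 1) ^ length r) (bas (butlast (y # r)) * \<phi> (last (y # r)) (hd q) * bas (tl q))
    + scal ((- 1) ^ Suc (length r)) (bas (y # r) * gbar \<phi> q)"
    using 1 by simp
  have "gbar \<phi> ((x # y # r) @ q) = \<phi> x y * bas (r @ q) - bas [x] * gbar \<phi> ((y # r) @ q)" by simp
  also have "\<dots> = \<phi> x y * bas (r @ q) - bas [x] * gbar \<phi> (y # r) * bas q
    - scal ((- 1) ^ length r) (bas (x # butlast (y # r)) * \<phi> (last (y # r)) (hd q) * bas (tl q))
    - scal ((- 1) ^ Suc (length r)) (bas (x # y # r) * gbar \<phi> q)"
    unfolding IH distrib_left scal_mult_right mult.assoc[symmetric] single_mult_list by (simp del: butlast.simps last.simps)
  finally show ?case
    by (simp add: left_diff_distrib mult.assoc free_vs.scale_minus_left)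
next
  case ("2_2" \<phi> x)
  obtain y r where "q = y # r" using assms(2) by (cases q) auto
  then show ?case by (simp add: one_eq_bas[symmetric] free_vs.scale_minus_left del: single_one)
qed auto

fun d0 :: "('a \<Rightarrow> 'a \<Rightarrow> ('a list \<Rightarrow>\<^sub>0 'k::field)) \<Rightarrow> 'a list \<Rightarrow> ('a list \<Rightarrow>\<^sub>0 'k)" where
  "d0 \<phi> (x # y # q) = \<phi> x y * bas q"
| "d0 \<phi> q = 0"

definition tm :: "('a list \<Rightarrow>\<^sub>0 'k::field) \<Rightarrow> ('a list \<Rightarrow>\<^sub>0 'k)" where
  "tm = lin_ext cyclic_op"

lemma lin_tm: "lin tm" unfolding tm_def by (rule lin_lin_ext)

lemma tm_snoc: "tm (Poly_Mapping.single (p @ [x]) c) = Poly_Mapping.single (x # p) ((- 1) ^ length p * c)"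
  by (simp add: tm_def cyclic_op_def mult.commute)

lemma tm_pow:
  "(tm ^^ length q) (bas (p @ q)) = scal ((- 1) ^ ((length p + length q - 1) * length q)) (bas (q @ p) :: 'a list \<Rightarrow>\<^sub>0 'k::field)"
proof (induction q arbitrary: p rule: rev_induct)
  case (snoc x q)
  have "(tm ^^ length (q @ [x])) (bas (p @ q @ [x])) = (tm ^^ length q) (tm (bas ((p @ q) @ [x])))"
    by (simp add: funpow_swap1)
  also have "tm (bas ((p @ q) @ [x])) = scal ((- 1) ^ (length p + length q)) (bas ((x # p) @ q) :: 'a list \<Rightarrow>\<^sub>0 'k)"
    unfolding tm_snoc by simp
  also have "(tm ^^ length q) \<dots> = scal ((- 1) ^ (length p + length q)) (scal ((- 1) ^ ((length p + length q) * length q)) (bas (q @ x # p)))"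
    unfolding lin_scal[OF lin_funpow[OF lin_tm]] snoc by simp
  finally show ?case by (simp add: power_add[symmetric])
qed auto

definition Wm :: "nat \<Rightarrow> ('a list list \<Rightarrow>\<^sub>0 'k::field) \<Rightarrow> ('a list list \<Rightarrow>\<^sub>0 'k)" where
  "Wm j = lin_ext (\<lambda>ws. Poly_Mapping.single ws (of_nat (length (ws ! j))))"

lemma lin_Wm: "lin (Wm j)" unfolding Wm_def by (rule lin_lin_ext)

lemma Wm_bas [simp]: "Wm j (bas ws) = Poly_Mapping.single ws (of_nat (length (ws ! j)))"
  by (simp add: Wm_def)

lemma sgn_square: "((- 1) ^ k * (- 1) ^ k :: 'k::field) = 1"
  by (simp add: power_mult_distrib[symmetric])

lemma finite_words: "finite {w :: gen list. length w \<le> m}"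
proof -
  have "finite (UNIV :: gen set)"
    by (rule finite_subset[of _ "{Gen_u, Gen_d}"]) (use gen.exhaust in auto)
  from finite_lists_length_le[OF this, of m] show ?thesis by simp
qed

context down_up_algebra
begin

definition iota :: "(gen list \<Rightarrow>\<^sub>0 'k) \<Rightarrow> (gen list list \<Rightarrow>\<^sub>0 'k)" where
  "iota = lin_ext (\<lambda>w. bas [w])"

lemma lin_iota: "lin iota" unfolding iota_def by (rule lin_lin_ext)

lemma iota_bas [simp]: "iota (Poly_Mapping.single w c) = Poly_Mapping.single [w] c" by (simp add: iota_def)

lemma iota_in: "x \<in> spn S \<Longrightarrow> iota x \<in> spn ((\<lambda>w. [w]) ` S)"
  by (rule lin_spnI[OF lin_iota]) auto

definition mu :: "gen list \<Rightarrow> gen list \<Rightarrow> (gen list list \<Rightarrow>\<^sub>0 'k)" where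
  "mu v w = iota (nf (v @ w))"

definition bpm :: "(gen list list \<Rightarrow>\<^sub>0 'k) \<Rightarrow> (gen list list \<Rightarrow>\<^sub>0 'k)" where
  "bpm = lin_ext (gbar mu)"

definition dm :: "(gen list list \<Rightarrow>\<^sub>0 'k) \<Rightarrow> (gen list list \<Rightarrow>\<^sub>0 'k)" where
  "dm = lin_ext (d0 mu)"

lemma lin_bpm: "lin bpm" and lin_dm: "lin dm"
  unfolding bpm_def dm_def by (rule lin_lin_ext)+

lemma bpm_bas [simp]: "bpm (Poly_Mapping.single ws c) = scal c (gbar mu ws)"
  and dm_bas [simp]: "dm (Poly_Mapping.single ws c) = scal c (d0 mu ws)"
  by (simp_all add: bpm_def dm_def)

lemmas bpm_simps = lin_simps[OF lin_bpm] and dm_simps = lin_simps[OF lin_dm]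
  and tm_simps = lin_simps[OF lin_tm] and iota_simps = lin_simps[OF lin_iota]

lemma mu_in: "mu v w \<in> spn {[x] | x. irr x \<and> length x = length v + length w}"
proof -
  have "nf (v @ w) \<in> spn {x. irr x \<and> length x = length v + length w}"
    using keys_nf[of _ "v @ w"] by (auto simp: spn_def)
  from iota_in[OF this] show ?thesis unfolding mu_def
    by (rule subsetD[OF spn_mono, rotated]) auto
qed

lemma mu_unit: "irr w \<Longrightarrow> mu [] w = bas [w]" "irr w \<Longrightarrow> mu w [] = bas [w]"
  by (simp_all add: mu_def nf_irr)

lemma mu_eqI:
  assumes "lin f" "lin g" "\<And>x. irr x \<Longrightarrow> length x = length v + length w \<Longrightarrow> f (bas [x]) = g (bas [x])"
  shows "f (mu v w) = g (mu v w)"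
  by (rule lin_spn_eqI[OF mu_in assms(1,2)]) (use assms(3) in auto)

text \<open>Basis tensors of Hochschild degree \<open>n\<close> and weight \<open>m\<close>; for
  \<open>c = True\<close> all factors lie in the augmentation ideal.\<close>

definition Sm :: "bool \<Rightarrow> nat \<Rightarrow> nat \<Rightarrow> gen list list set" where
  "Sm c m n = {ws. length ws = Suc n \<and> (\<forall>w\<in>set ws. irr w \<and> (c \<longrightarrow> w \<noteq> [])) \<and> (\<Sum>w\<leftarrow>ws. length w) = m}"

lemma finite_Sm: "finite (Sm c m n)"
proof (rule finite_subset)
  show "Sm c m n \<subseteq> {ws. set ws \<subseteq> {w. length w \<le> m} \<and> length ws = Suc n}"
  proof
    fix ws assume ws: "ws \<in> Sm c m n"
    have "length w \<le> m" if "w \<in> set ws" for w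
      using member_le_sum_list[of "length w" "map length ws"] ws that by (auto simp: Sm_def)
    with ws show "ws \<in> {ws. set ws \<subseteq> {w. length w \<le> m} \<and> length ws = Suc n}" by (auto simp: Sm_def)
  qed
  show "finite {ws. set ws \<subseteq> {w :: gen list. length w \<le> m} \<and> length ws = Suc n}"
    by (rule finite_lists_length_eq[OF finite_words])
qed

lemma mu_mult_in:
  assumes "x # y # q \<in> Sm c m (Suc n)"
  shows "mu x y * bas q \<in> spn (Sm c m n)"
  by (rule spn_mult[OF mu_in, of _ "{q}"]) (use assms in \<open>auto simp: Sm_def\<close>)

text \<open>Left multiplication of the zeroth factor by \<open>v\<close>. It commutes with
  \<open>bpm\<close>, so identities for arbitrary lists reduce to lists that begin with the
  unit.\<close>

definition lam :: "gen list \<Rightarrow> (gen list list \<Rightarrow>\<^sub>0 'k) \<Rightarrow> (gen list list \<Rightarrow>\<^sub>0 'k)" where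
  "lam v = lin_ext (\<lambda>ws. case ws of [] \<Rightarrow> 0 | w # q \<Rightarrow> mu v w * bas q)"

lemma lin_lam: "lin (lam v)" unfolding lam_def by (rule lin_lin_ext)

lemmas lam_simps = lin_simps[OF lin_lam]

lemma lam_mult: "lam v (bas [w] * z) = mu v w * z"
  by (rule lin_eqI[OF lin_comp[OF lin_lam lin_mult_left[OF lin_id]] lin_mult_left[OF lin_id]])
    (simp add: lam_def)

lemma lam_bas: "lam v (bas (w # q)) = mu v w * bas q"
  using lam_mult[of v w "bas q"] by simp

text \<open>Associativity, inherited from concatenation because \<open>NF\<close> may be applied to
  either factor first.\<close>

lemma mu_assoc: "lam v (mu w x) = bpm (mu v w * bas [x])"
proof -
  have 1: "lam v (iota z) = iota (NF (bas v * z))" for z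
    by (rule lin_eqI[OF lin_comp[OF lin_lam lin_iota] lin_comp[OF lin_iota lin_comp[OF lin_NF lin_mult_left[OF lin_id]]]])
      (simp add: lam_bas mu_def one_eq_bas[symmetric] del: single_one)
  have 2: "bpm (iota z * bas [x]) = iota (NF (z * bas x))" for z
    by (rule lin_eqI[OF lin_comp[OF lin_bpm lin_mult_right[OF lin_iota]] lin_comp[OF lin_iota lin_comp[OF lin_NF lin_mult_right[OF lin_id]]]])
      (simp add: mu_def one_eq_bas[symmetric] del: single_one)
  have "NF (bas v * nf (w @ x)) = NF (nf (v @ w) * bas x)"
    using NF_mult_left[of "bas (v @ w)" "bas x"] NF_mult_right[of "bas v" "bas (w @ x)"] by simp
  then show ?thesis unfolding mu_def[of w] mu_def[of v w] 1 2 by simp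
qed

lemma bpm_mu_mult: "bpm (mu v w * bas (y # q)) = bpm (mu v w * bas [y]) * bas q - mu v w * gbar mu (y # q)"
  by (rule mu_eqI[OF lin_comp[OF lin_bpm lin_mult_right[OF lin_id]]
        lin_minus_fun[OF lin_mult_right[OF lin_comp[OF lin_bpm lin_mult_right[OF lin_id]]] lin_mult_right[OF lin_id]]])
    (simp add: one_eq_bas[symmetric] del: single_one)

lemma bpm_lam: "bpm (lam v z) = lam v (bpm z)"
proof (rule lin_eqI[OF lin_comp[OF lin_bpm lin_lam] lin_comp[OF lin_lam lin_bpm]])
  fix ws :: "gen list list"
  consider "ws = []" | w where "ws = [w]" | w y q where "ws = w # y # q" by (metis list.exhaust)
  then show "bpm (lam v (bas ws)) = lam v (bpm (bas ws))"
  proof cases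
    case 1 then show ?thesis by (simp add: lam_def lin_ext_simps bpm_simps)
  next
    case (2 w)
    have "bpm (mu v w) = 0" 
      using mu_eqI[OF lin_bpm, of "\<lambda>_. 0" v w] by (simp add: linI)
    then show ?thesis using 2 by (simp add: lam_bas lam_simps one_eq_bas[symmetric] del: single_one)
  next
    case (3 w y q)
    have "lam v (mu w y * bas q) = lam v (mu w y) * bas q"
      by (rule mu_eqI[OF lin_comp[OF lin_lam lin_mult_right[OF lin_id]] lin_mult_right[OF lin_lam]])
        (simp add: lam_bas one_eq_bas[symmetric] del: single_one)
    then show ?thesis using 3 by (simp add: lam_bas lam_simps lam_mult bpm_mu_mult[of v w y q] mu_assoc)
  qed
qed

definition IL :: "gen list list set" where "IL = {ws. ws \<noteq> [] \<and> (\<forall>w\<in>set ws. irr w)}"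

lemma gbar_in_IL: "ws \<in> IL \<Longrightarrow> gbar mu ws \<in> spn IL"
proof (induction ws rule: induct_list012)
  case (3 x y q)
  have "mu x y * bas q \<in> spn IL"
    by (rule spn_mult[OF mu_in, of _ "{q}"]) (use 3 in \<open>auto simp: IL_def\<close>)
  moreover have "bas [x] * gbar mu (y # q) \<in> spn IL"
    by (rule spn_mult[of _ "{[x]}" _ IL]) (use 3 in \<open>auto simp: IL_def\<close>)
  ultimately show ?case by (simp add: free_vs.subspace_diff[OF subspace_spn])
qed (auto simp: free_vs.subspace_0[OF subspace_spn])

text \<open>Only the first face removes a unit inserted in front, so the insertion contracts
  \<open>bpm\<close>.\<close>

lemma bpm_unit: "z \<in> spn IL \<Longrightarrow> bpm (bas [[]] * z) = z - bas [[]] * bpm z"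
proof (rule lin_spn_eqI[where f = "\<lambda>z. bpm (bas [[]] * z)" and g = "\<lambda>z. z - bas [[]] * bpm z"])
  show "lin (\<lambda>z. bpm (bas [[]] * z))" by (rule lin_comp[OF lin_bpm lin_mult_left[OF lin_id]])
  show "lin (\<lambda>z. z - bas [[]] * bpm z)" by (rule lin_minus_fun[OF lin_id lin_mult_left[OF lin_bpm]])
  fix ws assume "ws \<in> IL"
  then obtain x q where "ws = x # q" "irr x" by (cases ws) (auto simp: IL_def)
  then show "bpm (bas [[]] * bas ws) = bas ws - bas [[]] * bpm (bas ws)" by (simp add: mu_unit)
qed

text \<open>A list \<open>x # q\<close> is \<open>lam x\<close> of \<open>[] # q\<close>, where
  \<open>bpm\<close> gives \<open>q\<close> minus the unit times \<open>bpm q\<close>. Applying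
  \<open>bpm\<close> again cancels by induction on the list, without a double sum over pairs of
  faces.\<close>

lemma bpm_bpm: "z \<in> spn IL \<Longrightarrow> bpm (bpm z) = 0"
proof -
  have bb: "ws \<in> IL \<Longrightarrow> bpm (gbar mu ws) = 0" for ws
  proof (induction ws)
    case (Cons x q)
    show ?case
    proof (cases q)
      case Nil then show ?thesis by (simp add: bpm_simps)
    next
      case (Cons y r)
      have q: "q \<in> IL" using Cons Cons.prems by (simp add: IL_def)
      have "bas (x # q) = lam x (bas [[]] * bas q)" using Cons.prems by (simp add: lam_mult mu_unit IL_def lam_bas)
      then have "bpm (bas (x # q)) = lam x (bas q - bas [[]] * gbar mu q)"
        using bpm_unit[of "bas q"] q by (simp only: bpm_lam) simp
      then have "bpm (gbar mu (x # q)) = lam x (gbar mu q - bpm (bas [[]] * gbar mu q))"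
        by (simp add: bpm_lam bpm_simps)
      also have "\<dots> = lam x 0" using bpm_unit[OF gbar_in_IL[OF q]] Cons.IH[OF q] by simp
      finally show ?thesis by (simp add: lam_simps)
    qed
  qed (simp add: IL_def)
  show "z \<in> spn IL \<Longrightarrow> bpm (bpm z) = 0"
    by (rule lin_spn_eqI[OF _ lin_comp[OF lin_bpm lin_bpm], of _ _ "\<lambda>_. 0"]) (auto simp: bb linI)
qed

lemma Sm_IL: "Sm c m n \<subseteq> IL" by (auto simp: Sm_def IL_def)

lemma tm_pow_mu:
  "(tm ^^ length p) (mu x y * bas (r @ p)) = scal ((- 1) ^ ((length r + length p) * length p)) (bas p * mu x y * bas r)"
  by (rule mu_eqI[OF lin_comp[OF lin_funpow[OF lin_tm] lin_mult_right[OF lin_id]]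
        lin_scal_fun[OF lin_mult_right[OF lin_mult_left[OF lin_id]]]])
    (use tm_pow[of p "_ # r"] in simp)

lemma bpm_rotations:
  assumes "length ws = Suc n"
  shows "bpm (bas ws) = (\<Sum>i<n. (tm ^^ i) (dm ((tm ^^ (Suc n - i)) (bas ws))))"
proof -
  have "(tm ^^ i) (dm ((tm ^^ (Suc n - i)) (bas ws)))
    = scal ((- 1) ^ i) (bas (take i ws) * mu (ws ! i) (ws ! Suc i) * bas (drop (i + 2) ws))" if i: "i < n" for i
  proof -
    have dr: "drop i ws = ws ! i # ws ! Suc i # drop (i + 2) ws"
      using assms i by (simp add: Cons_nth_drop_Suc)
    have "(tm ^^ (Suc n - i)) (bas ws :: gen list list \<Rightarrow>\<^sub>0 'k) = scal ((- 1) ^ (n * (Suc n - i))) (bas (drop i ws @ take i ws))"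
      using tm_pow[of "drop i ws" "take i ws"] assms i by simp
    then have "dm ((tm ^^ (Suc n - i)) (bas ws))
        = scal ((- 1) ^ (n * (Suc n - i))) (mu (ws ! i) (ws ! Suc i) * bas (drop (i + 2) ws @ take i ws))"
      unfolding dr by (simp add: dm_simps)
    then have "(tm ^^ i) (dm ((tm ^^ (Suc n - i)) (bas ws)))
        = scal ((- 1) ^ (n * (Suc n - i)) * (- 1) ^ ((n - 1) * i)) (bas (take i ws) * mu (ws ! i) (ws ! Suc i) * bas (drop (i + 2) ws))"
      using tm_pow_mu[of "take i ws" "ws ! i" "ws ! Suc i" "drop (i + 2) ws"] assms i
      by (simp add: lin_scal[OF lin_funpow[OF lin_tm]])
    \<comment> \<open>The signs of the two rotations combine: n(n + 1 - i) + (n - 1)i equals n(n +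
      1) - i and has the parity of i.\<close>
    also have "(- 1) ^ (n * (Suc n - i)) * (- 1) ^ ((n - 1) * i) = ((- 1) ^ i :: 'k)"
    proof -
      have "even (n * (Suc n - i) + (n - 1) * i) \<longleftrightarrow> even i" using i by (cases n) (auto simp: Suc_diff_le)
      then have "(- 1) ^ (n * (Suc n - i) + (n - 1) * i) = ((- 1) ^ i :: 'k)" by (simp only: minus_one_power_iff)
      then show ?thesis by (simp only: power_add)
    qed
    finally show ?thesis .
  qed
  then show ?thesis unfolding bpm_bas gbar_sum using assms by simp
qed

lemma Wm_mu: "0 < j \<Longrightarrow> Wm j (mu x y * bas q) = scal (of_nat (length (q ! (j - 1)))) (mu x y * bas q)"
  by (rule mu_eqI[OF lin_comp[OF lin_Wm lin_mult_right[OF lin_id]] lin_scal_fun[OF lin_mult_right[OF lin_id]]])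
    (simp add: nth_Cons')

lemma Wm_mu_0: "Wm 0 (mu x y * bas q) = scal (of_nat (length x + length y)) (mu x y * bas q)"
  by (rule mu_eqI[OF lin_comp[OF lin_Wm lin_mult_right[OF lin_id]] lin_scal_fun[OF lin_mult_right[OF lin_id]]])
    simp

text \<open>The axioms mention no unit, and words of positive length multiply to combinations of
  such words. So both the complex of all tensors and the one without unit factors are
  instances.\<close>

lemma cyclic_cx_Sm:
  assumes m: "0 < m"
  shows "cyclic_cx (\<lambda>n. spn (Sm c m n)) tm dm bpm Wm m"
proof (rule cyclic_cx.intro)
  fix n j and x :: "gen list list \<Rightarrow>\<^sub>0 'k"
  show "fd (spn (Sm c m n) :: (gen list list \<Rightarrow>\<^sub>0 'k) set)" by (rule fd_spn[OF finite_Sm])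
  show "lin (tm :: (gen list list \<Rightarrow>\<^sub>0 'k) \<Rightarrow> (gen list list \<Rightarrow>\<^sub>0 'k))" "lin dm" "lin bpm"
    "lin (Wm j :: (gen list list \<Rightarrow>\<^sub>0 'k) \<Rightarrow> (gen list list \<Rightarrow>\<^sub>0 'k))"
    by (rule lin_tm lin_dm lin_bpm lin_Wm)+
  show "x \<in> spn (Sm c m n) \<Longrightarrow> bpm (bpm x) = 0" by (rule bpm_bpm) (use spn_mono[OF Sm_IL] in blast)
  show "0 < m" by (rule m)
  have dec2: "\<exists>a b q. ws = a # b # q" if "ws \<in> Sm c m (Suc n)" for ws n
    using that by (cases ws; cases "tl ws") (auto simp: Sm_def)
  show "tm x \<in> spn (Sm c m n)" if "x \<in> spn (Sm c m n)"
  proof (rule lin_spnI[OF lin_tm that subspace_spn])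
    fix ws assume "ws \<in> Sm c m n"
    then show "tm (bas ws) \<in> spn (Sm c m n)"
      by (cases ws rule: rev_cases) (auto simp: tm_snoc Sm_def spn_def)
  qed
  show "(tm ^^ Suc n) x = x" if "x \<in> spn (Sm c m n)"
  proof (rule lin_spn_eqI[OF that lin_funpow[OF lin_tm] lin_id])
    fix ws assume "ws \<in> Sm c m n"
    then show "(tm ^^ Suc n) (bas ws) = bas ws" using tm_pow[of ws "[]"]
      by (simp add: Sm_def del: funpow.simps mult_Suc_right mult_Suc)
  qed
  show "dm x \<in> spn (Sm c m n)" if "x \<in> spn (Sm c m (Suc n))"
    by (rule lin_spnI[OF lin_dm that subspace_spn]) (use dec2 mu_mult_in in fastforce)
  show "dm x = 0" if "x \<in> spn (Sm c m 0)"
  proof (rule lin_spn_eqI[OF that lin_dm, of "\<lambda>_. 0"])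
    fix ws assume "ws \<in> Sm c m 0"
    then show "dm (bas ws) = 0" by (cases ws) (auto simp: Sm_def)
  qed (simp add: linI)
  show "bpm x = (\<Sum>i<n. (tm ^^ i) (dm ((tm ^^ (Suc n - i)) x)))" if "x \<in> spn (Sm c m n)"
    by (rule lin_spn_eqI[OF that lin_bpm lin_sum_fun[OF lin_comp[OF lin_funpow[OF lin_tm] lin_comp[OF lin_dm lin_funpow[OF lin_tm]]]]])
      (use bpm_rotations in \<open>auto simp: Sm_def simp del: bpm_bas\<close>)
  show "Wm j x \<in> spn (Sm c m n)" if "x \<in> spn (Sm c m n)"
    by (rule lin_spnI[OF lin_Wm that subspace_spn]) (auto simp: spn_def)
  show "tm (Wm j x) = Wm (if j = n then 0 else Suc j) (tm x)" if "x \<in> spn (Sm c m n)" "j \<le> n"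
  proof (rule lin_spn_eqI[OF that(1) lin_comp[OF lin_tm lin_Wm] lin_comp[OF lin_Wm lin_tm]])
    fix ws assume "ws \<in> Sm c m n"
    then obtain p y where "ws = p @ [y]" "length p = n" by (cases ws rule: rev_cases) (auto simp: Sm_def)
    then show "tm (Wm j (bas ws)) = Wm (if j = n then 0 else Suc j) (tm (bas ws))"
      using that(2) by (simp add: tm_snoc Wm_def nth_append)
  qed
  show "dm (Wm j x) = Wm (j - 1) (dm x)" if x: "x \<in> spn (Sm c m n)" and j: "2 \<le> j" "j \<le> n"
  proof (rule lin_spn_eqI[OF x lin_comp[OF lin_dm lin_Wm] lin_comp[OF lin_Wm lin_dm]])
    fix ws assume "ws \<in> Sm c m n"
    then obtain a b q where "ws = a # b # q" using dec2[of ws "n - 1"] j by auto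
    then show "dm (Wm j (bas ws)) = Wm (j - 1) (dm (bas ws))"
      using j(1) Wm_mu[of "j - 1" a b q] by (simp add: nth_Cons' numeral_2_eq_2)
  qed
  show "dm (Wm 0 x) + dm (Wm 1 x) = Wm 0 (dm x)" if "x \<in> spn (Sm c m (Suc n))"
  proof (rule lin_spn_eqI[OF that lin_plus[OF lin_comp[OF lin_dm lin_Wm] lin_comp[OF lin_dm lin_Wm]] lin_comp[OF lin_Wm lin_dm]])
    fix ws assume "ws \<in> Sm c m (Suc n)"
    then obtain a b q where "ws = a # b # q" using dec2[of ws n] by auto
    then show "dm (Wm 0 (bas ws)) + dm (Wm 1 (bas ws)) = Wm 0 (dm (bas ws))"
      using Wm_mu_0[of a b q] by (simp add: free_vs.scale_left_distrib)
  qed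
  show "(\<Sum>j\<le>n. Wm j x) = scal (of_nat m) x" if "x \<in> spn (Sm c m n)"
  proof (rule lin_spn_eqI[OF that lin_sum_fun[OF lin_Wm] lin_scal_fun[OF lin_id]])
    fix ws assume "ws \<in> Sm c m n"
    then have "(\<Sum>j\<le>n. length (ws ! j)) = m"
      unfolding Sm_def lessThan_Suc_atMost[symmetric] by (auto simp: sum_list_sum_nth atLeast0LessThan)
    then have "(\<Sum>j\<le>n. of_nat (length (ws ! j))) = (of_nat m :: 'k)" by (metis of_nat_sum)
    then show "(\<Sum>j\<le>n. Wm j (bas ws)) = scal (of_nat m) (bas ws :: gen list list \<Rightarrow>\<^sub>0 'k)"
      by (simp add: poly_mapping_eq_iff fun_eq_iff lookup_sum lookup_single when_def)
  qed
qed

end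

context down_up_algebra
begin

section \<open>The normalised Hochschild complex\<close>

definition bm :: "(gen list list \<Rightarrow>\<^sub>0 'k) \<Rightarrow> (gen list list \<Rightarrow>\<^sub>0 'k)" where
  "bm x = bpm x + dm (tm x)"

lemma lin_bm: "lin bm"
  unfolding bm_def by (rule lin_plus[OF lin_bpm lin_comp[OF lin_dm lin_tm]])

lemmas bm_simps = lin_simps[OF lin_bm]

lemma bm_snoc: "bm (bas (x # q @ [z])) = gbar mu (x # q @ [z]) + scal ((- 1) ^ Suc (length q)) (mu z x * bas q)"
  using tm_snoc[of "x # q" z "1 :: 'k"] by (simp add: bm_def)

lemma bm_single: "bm (bas [x]) = 0"
  using tm_snoc[of "[]" x "1 :: 'k"] by (simp add: bm_def)

definition Jl :: "nat \<Rightarrow> gen list list set" where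
  "Jl l = {p. length p = l \<and> (\<forall>w\<in>set p. irr w \<and> w \<noteq> [])}"

definition Gl :: "nat \<Rightarrow> gen list list set" where
  "Gl l = {p. length p = l \<and> p \<noteq> [] \<and> (\<forall>w\<in>set p. irr w) \<and> [] \<notin> set (tl p)}"

lemma gbar_Jl: "p \<in> Jl (Suc l) \<Longrightarrow> gbar mu p \<in> spn (Jl l)"
proof (induction p arbitrary: l rule: induct_list012)
  case (3 x y q)
  then obtain l' where l: "l = Suc l'" by (auto simp: Jl_def)
  have "mu x y * bas q \<in> spn (Jl l)"
    by (rule spn_mult[OF mu_in, of _ "{q}"]) (use 3 l in \<open>auto simp: Jl_def\<close>)
  moreover have "bas [x] * gbar mu (y # q) \<in> spn (Jl l)"
    by (rule spn_mult[of _ "{[x]}" _ "Jl l'"]) (use 3 l in \<open>auto simp: Jl_def\<close>)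
  ultimately show ?case by (simp add: free_vs.subspace_diff[OF subspace_spn])
qed (auto simp: free_vs.subspace_0[OF subspace_spn])

lemma gbar_Gl: "p \<in> Gl (Suc l) \<Longrightarrow> gbar mu p \<in> spn (Gl l)"
proof (induction p rule: induct_list012)
  case (3 x y q)
  then obtain l' where l: "l = Suc l'" by (auto simp: Gl_def)
  have "mu x y * bas q \<in> spn (Gl l)"
    by (rule spn_mult[OF mu_in, of _ "{q}"]) (use 3 l in \<open>auto simp: Gl_def\<close>)
  moreover have "bas [x] * gbar mu (y # q) \<in> spn (Gl l)"
    by (rule spn_mult[of _ "{[x]}" _ "Jl l'"], simp, rule gbar_Jl) (use 3(3) l in \<open>auto simp: Gl_def Jl_def\<close>)
  ultimately show ?case by (simp add: free_vs.subspace_diff[OF subspace_spn])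
qed (auto simp: free_vs.subspace_0[OF subspace_spn])

text \<open>The normalised and the degenerate tensors of Hochschild theory; position 0 is exempt
  from the condition.\<close>

definition "Nn m n = {ws \<in> Sm False m n. [] \<notin> set (tl ws)}"
definition "Dn m n = {ws \<in> Sm False m n. [] \<in> set (tl ws)}"

text \<open>The degenerate tensors are contracted by doubling the first unit behind position 0.\<close>

fun ins :: "gen list list \<Rightarrow> (gen list list \<Rightarrow>\<^sub>0 'k)" where
  "ins [] = 0"
| "ins (w # q) = (if w = [] then bas ([] # [] # q) else - (bas [w] * ins q))"

definition hD :: "(gen list list \<Rightarrow>\<^sub>0 'k) \<Rightarrow> (gen list list \<Rightarrow>\<^sub>0 'k)" where
  "hD = lin_ext (\<lambda>ws. case ws of [] \<Rightarrow> 0 | x # r \<Rightarrow> bas [x] * ins r)"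

lemma lin_hD: "lin hD" unfolding hD_def by (rule lin_lin_ext)

lemmas hD_simps = lin_simps[OF lin_hD]

lemma ins_first: "[] \<notin> set p \<Longrightarrow> ins (p @ [] # q) = scal ((- 1) ^ length p) (bas (p @ [] # [] # q))"
  by (induction p) (auto simp: scal_mult free_vs.scale_minus_left single_uminus)

lemma hD_first:
  assumes "p \<noteq> []" "[] \<notin> set (tl p)"
  shows "hD (bas (p @ [] # q)) = scal ((- 1) ^ Suc (length p)) (bas (p @ [] # [] # q))"
  using assms by (cases p) (simp_all add: hD_def ins_first)

lemma hD_mult_left: "y \<in> spn (Gl l) \<Longrightarrow> hD (y * bas ([] # q)) = scal ((- 1) ^ Suc l) (y * bas ([] # [] # q))"
  by (rule lin_spn_eqI[OF _ lin_comp[OF lin_hD lin_mult_right[OF lin_id]] lin_scal_fun[OF lin_mult_right[OF lin_id]], of _ "Gl l"])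
    (auto simp: Gl_def hD_first)

lemma hD_mult_right:
  assumes "p \<noteq> []" "[] \<notin> set (tl p)"
  shows "hD (bas (p @ [[]]) * z) = scal ((- 1) ^ Suc (length p)) (bas (p @ [[], []]) * z)"
  by (rule lin_eqI[OF lin_comp[OF lin_hD lin_mult_left[OF lin_id]] lin_scal_fun[OF lin_mult_left[OF lin_id]]])
    (use hD_first[OF assms] in simp)

lemma hD_mu:
  assumes "[] \<notin> set p"
  shows "hD (mu z x * bas (p @ [] # q)) = scal ((- 1) ^ length p) (mu z x * bas (p @ [] # [] # q))"
proof (rule mu_eqI[OF lin_comp[OF lin_hD lin_mult_right[OF lin_id]] lin_scal_fun[OF lin_mult_right[OF lin_id]]])
  fix y
  show "hD (bas [y] * bas (p @ [] # q)) = scal ((- 1) ^ length p) (bas [y] * bas (p @ [] # [] # q))"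
    using hD_first[of "y # p" q] assms by simp
qed

text \<open>The two faces that multiply the displayed unit into its neighbours cancel. If
  \<open>q\<close> is empty, the right neighbour is \<open>x\<close>, reached by the cyclic
  face.\<close>

lemma bm_unit_split:
  assumes x: "irr x" and p: "\<forall>w\<in>set p. irr w" and q: "\<forall>w\<in>set q. irr w"
  shows "bm (bas (x # p @ [] # q)) = gbar mu (x # p) * bas ([] # q)
     + scal ((- 1) ^ length p) (bas (x # p @ [[]]) * gbar mu q)
     + (if q = [] then 0 else scal ((- 1) ^ (Suc (length p + length q))) (mu (last q) x * bas (p @ [] # butlast q)))"
proof -
  let ?p = "x # p"
  have last_irr: "irr (last ?p)" using x p by auto
  have g: "gbar mu (?p @ [] # q) = gbar mu ?p * bas ([] # q) + scal ((- 1) ^ length p) (bas (?p @ q))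
     + scal ((- 1) ^ Suc (length p)) (bas ?p * gbar mu ([] # q))"
  proof -
    have "bas (butlast ?p) * mu (last ?p) [] * bas q = (bas (?p @ q) :: gen list list \<Rightarrow>\<^sub>0 'k)"
      unfolding mu_unit(2)[OF last_irr] single_mult_list by (simp del: butlast.simps last.simps)
    then show ?thesis using gbar_append[of ?p "[] # q" mu] by simp
  qed
  show ?thesis
  proof (cases q rule: rev_cases)
    case Nil
    have "bm (bas (x # p @ [[]])) = gbar mu (?p @ [[]]) + scal ((- 1) ^ Suc (length p)) (mu [] x * bas p)"
      using bm_snoc[of x p "[]"] by simp
    then show ?thesis using g Nil mu_unit(1)[OF x] by (simp add: free_vs.scale_minus_left single_uminus[symmetric] single_add[symmetric] add.assoc)
  next
    case (snoc q' z)
    then obtain y r where yr: "q = y # r" by (metis neq_Nil_conv snoc_eq_iff_butlast)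
    then have "irr y" using q by simp
    have gq: "gbar mu ([] # q) = bas q - bas [[]] * gbar mu q"
      using yr \<open>irr y\<close> by (simp add: mu_unit(1))
    have "bm (bas (x # (p @ [] # q') @ [z])) = gbar mu (?p @ [] # q)
       + scal ((- 1) ^ (Suc (length p + length q))) (mu z x * bas (p @ [] # q'))"
      using bm_snoc[of x "p @ [] # q'" z] snoc by simp
    moreover have "scal ((- 1) ^ length p) (bas (?p @ q)) + scal ((- 1) ^ Suc (length p)) (bas ?p * gbar mu ([] # q))
       = scal ((- 1) ^ length p) (bas (x # p @ [[]]) * gbar mu q)"
      unfolding gq by (simp add: right_diff_distrib free_vs.scale_minus_left mult.assoc[symmetric] free_vs.scale_right_diff_distrib del: scal_single)
    ultimately show ?thesis using snoc g by (simp add: add.assoc)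
  qed
qed

lemma first_unit: "[] \<in> set r \<Longrightarrow> \<exists>p q. r = p @ [] # q \<and> [] \<notin> set p"
  using split_list_first by fast

text \<open>Of the three faces at the doubled unit one survives and returns \<open>ws\<close>. All
  other faces of the doubled list are doubled faces of \<open>ws\<close>, with signs opposite to
  those in \<open>hD (bm (bas ws))\<close>.\<close>

lemma hD_contraction:
  assumes "ws \<in> Dn m n"
  shows "bm (hD (bas ws)) + hD (bm (bas ws)) = bas ws"
proof -
  obtain x r where ws: "ws = x # r" using assms by (cases ws) (auto simp: Dn_def)
  with assms obtain p q where pq: "r = p @ [] # q" "[] \<notin> set p" using first_unit[of r] by (auto simp: Dn_def)
  have irr: "irr x" "\<forall>w\<in>set p. irr w" "\<forall>w\<in>set q. irr w" using assms ws pq by (auto simp: Dn_def Sm_def)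
  let ?s = "\<lambda>i. (- 1) ^ i :: 'k"
  let ?W = "\<lambda>u. if q = [] then 0 else scal (?s (Suc (length p + length q))) (mu (last q) x * bas (p @ u @ butlast q))"
  have h: "hD (bas ws) = scal (?s (length p)) (bas (x # p @ [] # [] # q))"
    using hD_first[of "x # p" q] pq ws by simp
  have b: "bm (bas ws) = gbar mu (x # p) * bas ([] # q) + scal (?s (length p)) (bas (x # p @ [[]]) * gbar mu q) + ?W [[]]"
    using bm_unit_split[OF irr] ws pq by simp
  have gG: "gbar mu (x # p) \<in> spn (Gl (length p))"
    by (rule gbar_Gl) (use irr pq in \<open>auto simp: Gl_def\<close>)
  have hb: "hD (bm (bas ws)) = scal (?s (Suc (length p))) (gbar mu (x # p) * bas ([] # [] # q))
     + bas (x # p @ [[], []]) * gbar mu q + scal (?s (length p)) (?W [[], []])"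
  proof -
    have "hD (?W [[]]) = scal (?s (length p)) (?W [[], []])"
      using hD_mu[OF pq(2), of "last q" x "butlast q"] by (simp add: hD_simps mult.commute)
    moreover have "hD (scal (?s (length p)) (bas (x # p @ [[]]) * gbar mu q)) = bas (x # p @ [[], []]) * gbar mu q"
      using hD_mult_right[of "x # p" "gbar mu q"] pq(2) by (simp add: hD_simps sgn_square)
    ultimately show ?thesis unfolding b hD_simps(1) hD_mult_left[OF gG] by simp
  qed
  have irr': "\<forall>w\<in>set ([] # q). irr w" using irr by simp
  have b2: "bm (bas (x # p @ [] # [] # q)) = gbar mu (x # p) * bas ([] # [] # q)
      + scal (?s (length p)) (bas ws) - scal (?s (length p)) (bas (x # p @ [[], []]) * gbar mu q) - ?W [[], []]"
  proof (cases q)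
    case Nil
    have "scal (?s (Suc (Suc (length p)))) (mu [] x * bas (p @ [[]])) = scal (?s (length p)) (bas ws)"
      using mu_unit(1)[OF irr(1)] ws pq Nil by simp
    then show ?thesis using bm_unit_split[OF irr(1,2) irr'] Nil by simp
  next
    case (Cons y r)
    then have "gbar mu ([] # q) = bas q - bas [[]] * gbar mu q" using irr(3) by (simp add: mu_unit(1))
    then have "scal (?s (length p)) (bas (x # p @ [[]]) * gbar mu ([] # q))
      = scal (?s (length p)) (bas ws) - scal (?s (length p)) (bas (x # p @ [[], []]) * gbar mu q)"
      using ws pq by (simp add: right_diff_distrib mult.assoc[symmetric] free_vs.scale_right_diff_distrib del: scal_single)
    moreover have "(if [] # q = [] then 0 else scal (?s (Suc (length p + length ([] # q)))) (mu (last ([] # q)) x * bas (p @ [] # butlast ([] # q)))) = - ?W [[], []]"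
      using Cons by (simp add: free_vs.scale_minus_left)
    ultimately show ?thesis using bm_unit_split[OF irr(1,2) irr'] by simp
  qed
  have "bm (hD (bas ws)) = scal (?s (length p)) (gbar mu (x # p) * bas ([] # [] # q))
      + bas ws - bas (x # p @ [[], []]) * gbar mu q - scal (?s (length p)) (?W [[], []])"
    unfolding h bm_simps(2) b2
    by (simp only: free_vs.scale_right_distrib free_vs.scale_right_diff_distrib free_vs.scale_scale sgn_square free_vs.scale_one)
  then show ?thesis unfolding hb by (simp add: free_vs.scale_minus_left)
qed

lemma spn_Int: "x \<in> spn S \<Longrightarrow> x \<in> spn T \<Longrightarrow> x \<in> spn (S \<inter> T)"
  by (auto simp: spn_def)

lemma bm_Sm:
  assumes "x \<in> spn (Sm c m (Suc n))"
  shows "bm x \<in> spn (Sm c m n)"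
proof (rule lin_spnI[OF lin_bm assms subspace_spn])
  have gb: "gbar mu ws \<in> spn (Sm c m n)" if "ws \<in> Sm c m (Suc n)" for ws m n using that
  proof (induction ws arbitrary: m n rule: induct_list012)
    case (3 x y q)
    have "bas [x] * gbar mu (y # q) \<in> spn (Sm c m n)"
    proof (cases q)
      case Nil then show ?thesis by (simp add: free_vs.subspace_0[OF subspace_spn])
    next
      case (Cons z r)
      then obtain k where k: "n = Suc k" using 3 by (auto simp: Sm_def)
      have "y # q \<in> Sm c (m - length x) (Suc k)" using 3(3) k by (auto simp: Sm_def)
      then show ?thesis
        by (intro spn_mult[of _ "{[x]}" _ "Sm c (m - length x) k"] 3(2)) (use 3(3) k in \<open>auto simp: Sm_def\<close>)
    qed
    then show ?case using mu_mult_in[OF 3(3)] by (simp add: free_vs.subspace_diff[OF subspace_spn])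
  qed (auto simp: free_vs.subspace_0[OF subspace_spn])
  fix ws assume ws: "ws \<in> Sm c m (Suc n)"
  then obtain x q z where xz: "ws = x # q @ [z]"
    by (cases ws; cases "tl ws" rule: rev_cases) (auto simp: Sm_def)
  have "z # x # q \<in> Sm c m (Suc n)" using ws xz by (auto simp: Sm_def)
  from mu_mult_in[OF this] gb[OF ws] show "bm (bas ws) \<in> spn (Sm c m n)" unfolding xz bm_snoc
    by (intro free_vs.subspace_add[OF subspace_spn] free_vs.subspace_scale[OF subspace_spn])
qed

text \<open>Nonempty words multiply to combinations of nonempty words, and faces involving factor 0
  land in position 0. So the normalised tensors form a subcomplex complementary to the degenerate
  one, not merely a quotient.\<close>

lemma bm_Nn:
  assumes "x \<in> spn (Nn m (Suc n))"
  shows "bm x \<in> spn (Nn m n)"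
proof (rule lin_spnI[OF lin_bm assms subspace_spn])
  fix ws assume ws: "ws \<in> Nn m (Suc n)"
  then obtain x q z where xz: "ws = x # q @ [z]"
    by (cases ws; cases "tl ws" rule: rev_cases) (auto simp: Nn_def Sm_def)
  have lq: "length q = n" using ws xz by (auto simp: Nn_def Sm_def)
  have "gbar mu ws \<in> spn (Gl (Suc n))"
    by (rule gbar_Gl) (use ws in \<open>auto simp: Gl_def Nn_def Sm_def\<close>)
  moreover have "mu z x * bas q \<in> spn (Gl (Suc n))"
    by (rule spn_mult[OF mu_in, of _ "{q}"]) (use ws xz in \<open>auto simp: Gl_def Nn_def Sm_def\<close>)
  ultimately have "bm (bas ws) \<in> spn (Gl (Suc n))" unfolding xz bm_snoc
    by (intro free_vs.subspace_add[OF subspace_spn] free_vs.subspace_scale[OF subspace_spn])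
  moreover have "bm (bas ws) \<in> spn (Sm False m n)"
    by (rule bm_Sm) (use ws in \<open>auto simp: Nn_def\<close>)
  ultimately have "bm (bas ws) \<in> spn (Sm False m n \<inter> Gl (Suc n))" by (intro spn_Int)
  then show "bm (bas ws) \<in> spn (Nn m n)"
    by (rule subsetD[OF spn_mono, rotated]) (auto simp: Nn_def Gl_def)
qed

lemma bm_Dn:
  assumes "x \<in> spn (Dn m (Suc n))"
  shows "bm x \<in> spn (Dn m n)"
proof (rule lin_spnI[OF lin_bm assms subspace_spn])
  fix ws assume wsD: "ws \<in> Dn m (Suc n)"
  let ?U = "{ws :: gen list list. [] \<in> set (tl ws)}"
  obtain x r where ws: "ws = x # r" using wsD by (cases ws) (auto simp: Dn_def)
  with wsD obtain p q where pq: "r = p @ [] # q" "[] \<notin> set p" using first_unit[of r] by (auto simp: Dn_def)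
  have irr: "irr x" "\<forall>w\<in>set p. irr w" "\<forall>w\<in>set q. irr w" using wsD ws pq by (auto simp: Dn_def Sm_def)
  have "gbar mu (x # p) \<in> spn (Gl (length p))"
    by (rule gbar_Gl) (use irr pq in \<open>auto simp: Gl_def\<close>)
  then have "gbar mu (x # p) * bas ([] # q) \<in> spn ?U"
    by (rule spn_mult[of _ _ _ "{[] # q}"]) (auto simp: Gl_def)
  moreover have "bas (x # p @ [[]]) * gbar mu q \<in> spn ?U"
    by (rule spn_mult[of _ "{x # p @ [[]]}" _ UNIV]) (auto simp: spn_def)
  moreover have "mu (last q) x * bas (p @ [] # butlast q) \<in> spn ?U"
    by (rule spn_mult[OF mu_in, of _ "{p @ [] # butlast q}"]) auto
  ultimately have "bm (bas ws) \<in> spn ?U"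
    unfolding ws pq bm_unit_split[OF irr]
    by (intro free_vs.subspace_add[OF subspace_spn] free_vs.subspace_scale[OF subspace_spn])
      (simp_all add: free_vs.subspace_0[OF subspace_spn] free_vs.subspace_neg[OF subspace_spn]
        free_vs.subspace_scale[OF subspace_spn] free_vs.scale_minus_left)
  moreover have "bm (bas ws) \<in> spn (Sm False m n)"
    by (rule bm_Sm) (use wsD in \<open>auto simp: Dn_def\<close>)
  ultimately have "bm (bas ws) \<in> spn (Sm False m n \<inter> ?U)" by (intro spn_Int)
  then show "bm (bas ws) \<in> spn (Dn m n)"
    by (rule subsetD[OF spn_mono, rotated]) (auto simp: Dn_def)
qed

lemma hD_in: assumes "x \<in> spn (Dn m n)" shows "hD x \<in> spn (Dn m (Suc n))"
proof (rule lin_spnI[OF lin_hD assms subspace_spn])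
  fix ws assume wsD: "ws \<in> Dn m n"
  obtain x r where ws: "ws = x # r" using wsD by (cases ws) (auto simp: Dn_def)
  with wsD obtain p q where pq: "r = p @ [] # q" "[] \<notin> set p" using first_unit[of r] by (auto simp: Dn_def)
  show "hD (bas ws) \<in> spn (Dn m (Suc n))"
    using hD_first[of "x # p" q] wsD pq ws by (auto simp: Dn_def Sm_def spn_def)
qed

lemma Dn_exact:
  assumes "x \<in> spn (Dn m n)" "bm x = 0"
  shows "\<exists>w\<in>spn (Dn m (Suc n)). x = bm w"
proof -
  have "bm (hD x) + hD (bm x) = x"
    by (rule lin_spn_eqI[OF assms(1) lin_plus[OF lin_comp[OF lin_bm lin_hD] lin_comp[OF lin_hD lin_bm]] lin_id])
      (rule hD_contraction)
  with assms show ?thesis using hD_in[OF assms(1)] by (auto simp: hD_simps intro!: bexI[of _ "hD x"])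
qed

lemma Sm_split: "Sm False m n = Nn m n \<union> Dn m n" "Nn m n \<inter> Dn m n = {}"
  by (auto simp: Nn_def Dn_def)

lemma spn_Un: "spn (S \<union> T) = {a + b | a b. a \<in> spn S \<and> b \<in> spn T}"
  by (simp add: span_bas[symmetric] image_Un free_vs.span_Un)

lemma spn_disjoint: "S \<inter> T = {} \<Longrightarrow> spn S \<inter> spn T = {0 :: 'x \<Rightarrow>\<^sub>0 'k}"
proof -
  assume ST: "S \<inter> T = {}"
  have "x = 0" if "keys x \<subseteq> S" "keys x \<subseteq> T" for x :: "'x \<Rightarrow>\<^sub>0 'k"
  proof -
    have "keys x = {}" using that ST by blast
    then show ?thesis by simp
  qed
  then show ?thesis by (auto simp: spn_def)
qed

lemma bm_Nn_0: "x \<in> spn (Sm False m 0) \<Longrightarrow> bm x = 0"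
proof (rule lin_spn_eqI[OF _ lin_bm, of _ _ "\<lambda>_. 0"])
  fix ws assume "ws \<in> Sm False m 0"
  then show "bm (bas ws) = 0" by (cases ws) (auto simp: Sm_def bm_single)
qed (auto simp: linI)

lemma cyclic_b: "0 < (m :: nat) \<Longrightarrow> cyclic_cx.b tm dm bpm = bm"
  by (rule ext) (simp add: bm_def cyclic_cx.b_def[OF cyclic_cx_Sm[of m False]])

lemma bm_bm: "0 < m \<Longrightarrow> x \<in> spn (Sm c m n) \<Longrightarrow> bm (bm x) = 0"
  using cyclic_cx.bb[OF cyclic_cx_Sm, of m x c n] cyclic_b[of m] by simp

text \<open>Normalised tensors compute Hochschild homology; the equation is arranged without
  subtraction. The degenerate summand is exact, so it adds the same number to cycles and to
  boundaries.\<close>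

lemma normalisation_dim:
  assumes "0 < m"
  shows "free_vs.dim {x \<in> spn (Sm False m n). bm x = 0} + free_vs.dim (bm ` spn (Nn m (Suc n)))
   = free_vs.dim {x \<in> spn (Nn m n). bm x = 0} + free_vs.dim (bm ` spn (Sm False m (Suc n)))"
proof -
  let ?A = "spn (Sm False m n) :: (gen list list \<Rightarrow>\<^sub>0 'k) set"
    and ?N = "spn (Nn m n) :: (gen list list \<Rightarrow>\<^sub>0 'k) set"
    and ?D = "spn (Dn m n) :: (gen list list \<Rightarrow>\<^sub>0 'k) set"
  have sub: "?N \<subseteq> ?A" "?D \<subseteq> ?A" by (rule spn_mono, simp add: Sm_split)+
  have NDn: "a = 0 \<and> b = 0" if "a \<in> spn (Nn m k)" "b \<in> spn (Dn m k)" "a + b = 0"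
    for a b :: "gen list list \<Rightarrow>\<^sub>0 'k" and k
  proof -
    have "a = - b" using that(3) by (simp add: eq_neg_iff_add_eq_0)
    then have "a \<in> spn (Nn m k) \<inter> spn (Dn m k)" using that by (simp add: free_vs.subspace_neg[OF subspace_spn])
    then have "a = 0" unfolding spn_disjoint[OF Sm_split(2)] by simp
    then show ?thesis using \<open>a = - b\<close> by simp
  qed
  have bND: "bm a = 0 \<and> bm b = 0" if "a \<in> ?N" "b \<in> ?D" "bm (a + b) = 0" for a b
  proof (cases n)
    case 0
    then have "a \<in> spn (Sm False m 0)" "b \<in> spn (Sm False m 0)" using that sub by auto
    then show ?thesis using bm_Nn_0 by blast
  next
    case (Suc k)
    then show ?thesis using NDn[of "bm a" k "bm b"] that bm_Nn bm_Dn by (simp add: bm_simps)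
  qed
  let ?ZN = "{x \<in> ?N. bm x = 0}" and ?ZD = "{x \<in> ?D. bm x = 0}"
  have ND0: "?N \<inter> ?D = {0}" by (rule spn_disjoint[OF Sm_split(2)])
  have fdA: "fd (spn (Sm False m k) :: (gen list list \<Rightarrow>\<^sub>0 'k) set)" for k by (rule fd_spn[OF finite_Sm])
  have "free_vs.dim {x \<in> ?A. bm x = 0} = free_vs.dim ?ZN + free_vs.dim ?ZD"
  proof (rule dim_complement)
    show "fd {x \<in> ?A. bm x = 0}" by (rule fd_mono[OF fdA lin_kernelI[OF lin_bm subspace_spn]]) auto
    show "free_vs.subspace ?ZN" "free_vs.subspace ?ZD" by (rule lin_kernelI[OF lin_bm subspace_spn])+
    show "?ZN \<inter> ?ZD = {0}" using ND0 lin_0[OF lin_bm] by blast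
    show "{c + u | c u. c \<in> ?ZN \<and> u \<in> ?ZD} = {x \<in> ?A. bm x = 0}"
    proof
      show "{c + u | c u. c \<in> ?ZN \<and> u \<in> ?ZD} \<subseteq> {x \<in> ?A. bm x = 0}"
      proof clarify
        fix a c :: "gen list list \<Rightarrow>\<^sub>0 'k" assume "a \<in> ?N" "c \<in> ?D" and 0: "bm a = 0" "bm c = 0"
        then have "a + c \<in> ?A" unfolding Sm_split spn_Un by blast
        then show "a + c \<in> ?A \<and> bm (a + c) = 0" using 0 by (simp add: bm_simps)
      qed
      show "{x \<in> ?A. bm x = 0} \<subseteq> {c + u | c u. c \<in> ?ZN \<and> u \<in> ?ZD}"
        using bND unfolding Sm_split spn_Un by blast
    qed
  qed
  moreover have "?ZD = bm ` spn (Dn m (Suc n))"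
  proof
    show "?ZD \<subseteq> bm ` spn (Dn m (Suc n))" using Dn_exact by blast
    show "bm ` spn (Dn m (Suc n)) \<subseteq> ?ZD"
    proof clarify
      fix x :: "gen list list \<Rightarrow>\<^sub>0 'k" assume x: "x \<in> spn (Dn m (Suc n))"
      then have "x \<in> spn (Sm False m (Suc n))" by (rule subsetD[OF spn_mono, rotated]) (auto simp: Sm_split)
      then show "bm x \<in> ?D \<and> bm (bm x) = 0" using bm_Dn[OF x] bm_bm[OF assms] by blast
    qed
  qed
  moreover have "free_vs.dim (bm ` spn (Sm False m (Suc n)))
      = free_vs.dim (bm ` spn (Nn m (Suc n))) + free_vs.dim (bm ` spn (Dn m (Suc n)))"
  proof (rule dim_complement)
    show "fd (bm ` spn (Sm False m (Suc n)))" by (rule fd_image[OF lin_bm fdA])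
    show "free_vs.subspace (bm ` spn (Nn m (Suc n)))" "free_vs.subspace (bm ` spn (Dn m (Suc n)))"
      by (rule lin_imageI[OF lin_bm subspace_spn])+
    have "bm ` spn (Nn m (Suc n)) \<subseteq> ?N" "bm ` spn (Dn m (Suc n)) \<subseteq> ?D" using bm_Nn bm_Dn by auto
    moreover have "0 \<in> bm ` spn (Nn m (Suc n))" "0 \<in> bm ` spn (Dn m (Suc n))"
      by (rule free_vs.subspace_0, rule lin_imageI[OF lin_bm subspace_spn])+
    ultimately show "bm ` spn (Nn m (Suc n)) \<inter> bm ` spn (Dn m (Suc n)) = {0}" using ND0 by blast
    show "{c + u | c u. c \<in> bm ` spn (Nn m (Suc n)) \<and> u \<in> bm ` spn (Dn m (Suc n))} = bm ` spn (Sm False m (Suc n))"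
    proof
      show "{c + u | c u. c \<in> bm ` spn (Nn m (Suc n)) \<and> u \<in> bm ` spn (Dn m (Suc n))} \<subseteq> bm ` spn (Sm False m (Suc n))"
      proof clarify
        fix a c :: "gen list list \<Rightarrow>\<^sub>0 'k" assume "a \<in> spn (Nn m (Suc n))" "c \<in> spn (Dn m (Suc n))"
        then have "a + c \<in> spn (Sm False m (Suc n))" unfolding Sm_split spn_Un by blast
        then show "bm a + bm c \<in> bm ` spn (Sm False m (Suc n))" by (metis bm_simps(1) imageI)
      qed
      show "bm ` spn (Sm False m (Suc n)) \<subseteq> {c + u | c u. c \<in> bm ` spn (Nn m (Suc n)) \<and> u \<in> bm ` spn (Dn m (Suc n))}"
      proof clarify
        fix x :: "gen list list \<Rightarrow>\<^sub>0 'k" assume "x \<in> spn (Sm False m (Suc n))"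
        then obtain a c where ac: "x = a + c" "a \<in> spn (Nn m (Suc n))" "c \<in> spn (Dn m (Suc n))"
          unfolding Sm_split spn_Un by blast
        then have "bm x = bm a + bm c" by (simp add: bm_simps)
        with ac show "\<exists>c u. bm x = c + u \<and> c \<in> bm ` spn (Nn m (Suc n)) \<and> u \<in> bm ` spn (Dn m (Suc n))" by blast
      qed
    qed
  qed
  ultimately show ?thesis by simp
qed

end

section \<open>Comparison with tensors without unit factors\<close>

context down_up_algebra
begin

abbreviation "cA m \<equiv> cyclic_cx.cn (\<lambda>n. spn (Sm False m n) :: (gen list list \<Rightarrow>\<^sub>0 'k) set) tm bpm"
abbreviation "cI m \<equiv> cyclic_cx.cn (\<lambda>n. spn (Sm True m n) :: (gen list list \<Rightarrow>\<^sub>0 'k) set) tm bpm"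

lemma hochschild_dim_A:
  assumes "0 < m"
  shows "free_vs.dim {x \<in> spn (Sm False m n). bm x = 0}
    = free_vs.dim (bm ` spn (Sm False m (Suc n))) + cA m n + (if n = 0 then 0 else cA m (n - 1))"
proof -
  have "\<exists>w\<in>spn (Sm False m (Suc n)). x = bpm w" if "x \<in> spn (Sm False m n)" "bpm x = 0" for n x
  proof (rule bexI[of _ "bas [[]] * x"])
    have "x \<in> spn IL" using that(1) spn_mono[OF Sm_IL] by blast
    then show "x = bpm (bas [[]] * x)" using bpm_unit that(2) by simp
    show "bas [[]] * x \<in> spn (Sm False m (Suc n))"
      by (rule spn_mult[OF _ that(1), of _ "{[[]]}"]) (auto simp: Sm_def)
  qed
  from cyclic_cx.hochschild_dim[OF cyclic_cx_Sm[OF assms] this] show ?thesis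
    unfolding cyclic_b[OF assms] by blast
qed

text \<open>The projection required by \<open>cone_dim\<close>; \<open>tln\<close>, a left inverse
  of inserting the unit, supplies the injectivity required there.\<close>

definition pn :: "(gen list list \<Rightarrow>\<^sub>0 'k) \<Rightarrow> (gen list list \<Rightarrow>\<^sub>0 'k)" where
  "pn = lin_ext (\<lambda>ws. if hd ws = [] then 0 else bas ws)"

definition tln :: "(gen list list \<Rightarrow>\<^sub>0 'k) \<Rightarrow> (gen list list \<Rightarrow>\<^sub>0 'k)" where
  "tln = lin_ext (\<lambda>ws. bas (tl ws))"

lemma lin_pn: "lin pn" and lin_tln: "lin tln"
  unfolding pn_def tln_def by (rule lin_lin_ext)+

text \<open>The first face removes the unit, the cyclic face removes it from the other side and
  yields minus a rotation, and the remaining faces keep it. This is the differential of the cone of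
  \<open>1 - t\<close>.\<close>

lemma bm_unit:
  assumes "y \<in> spn (Sm True m n)"
  shows "bm (bas [[]] * y) = y - tm y - bas [[]] * bpm y"
proof (rule lin_spn_eqI[OF assms lin_comp[OF lin_bm lin_mult_left[OF lin_id]]
      lin_minus_fun[OF lin_minus_fun[OF lin_id lin_tm] lin_mult_left[OF lin_bpm]]])
  fix ws assume ws: "ws \<in> Sm True m n"
  then obtain q z where qz: "ws = q @ [z]" by (cases ws rule: rev_cases) (auto simp: Sm_def)
  have "irr z" using ws qz by (auto simp: Sm_def)
  have "ws \<in> IL" using ws Sm_IL by blast
  have "bm (bas [[]] * bas ws) = bpm (bas [[]] * bas ws) + dm (tm (bas (([] # q) @ [z])))"
    by (simp add: bm_def qz)
  also have "bpm (bas [[]] * bas ws) = bas ws - bas [[]] * bpm (bas ws)"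
    by (rule bpm_unit) (simp add: \<open>ws \<in> IL\<close>)
  also have "dm (tm (bas (([] # q) @ [z]))) = - tm (bas ws)"
    unfolding qz tm_snoc using mu_unit(2)[OF \<open>irr z\<close>] by (simp add: free_vs.scale_minus_left single_uminus dm_simps)
  finally show "bm (bas [[]] * bas ws) = bas ws - tm (bas ws) - bas [[]] * bpm (bas ws)" by simp
qed

lemma normalised_dim:
  assumes "0 < m"
  shows "free_vs.dim {x \<in> spn (Nn m n). bm x = 0}
    = free_vs.dim (bm ` spn (Nn m (Suc n))) + cI m n + (if n = 0 then 0 else cI m (n - 1))"
proof -
  interpret I: cyclic_cx "\<lambda>n. spn (Sm True m n) :: (gen list list \<Rightarrow>\<^sub>0 'k) set" tm dm bpm Wm m
    by (rule cyclic_cx_Sm[OF assms])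
  let ?j = "\<lambda>y. bas [[]] * y :: gen list list \<Rightarrow>\<^sub>0 'k"
  have pX: "pn x = x" if "x \<in> spn (Sm True m n)" for n x
  proof (rule lin_spn_eqI[OF that lin_pn lin_id])
    fix ws assume "ws \<in> Sm True m n"
    then show "pn (bas ws) = bas ws" by (cases ws) (auto simp: Sm_def pn_def)
  qed
  have pj: "pn (?j y) = 0" for y
    by (rule lin_eqI[OF lin_comp[OF lin_pn lin_mult_left[OF lin_id]], of "\<lambda>_. 0"]) (auto simp: pn_def linI)
  have tj: "tln (?j y) = y" for y
    by (rule lin_eqI[OF lin_comp[OF lin_tln lin_mult_left[OF lin_id]] lin_id]) (auto simp: tln_def)
  have jinj: "y = 0" if "?j y = 0" for y
    using tj[of y] that lin_0[OF lin_tln] by simp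
  have BX: "bm x = I.b x" for x using cyclic_b[OF assms] by simp
  \<comment> \<open>A normalised tensor has no unit at all, or exactly one, in front of a tensor
    without units: the two parts of the cone.\<close>
  have Nn_eq: "{x + ?j y | x y. x \<in> spn (Sm True m n) \<and> y \<in> (if n = 0 then {0} else spn (Sm True m (n - 1)))} = spn (Nn m n)" for n
  proof -
    let ?E = "{ws. n \<noteq> 0 \<and> (\<exists>us. ws = [] # us \<and> us \<in> Sm True m (n - 1))}"
    have "Nn m n = Sm True m n \<union> ?E"
    proof (intro equalityI subsetI)
      fix ws assume ws: "ws \<in> Nn m n"
      then obtain w us where wu: "ws = w # us" by (cases ws) (auto simp: Nn_def Sm_def)
      show "ws \<in> Sm True m n \<union> ?E"
      proof (cases "w = []")
        case True
        \<comment> \<open>A lone unit has weight 0, so \<open>m > 0\<close> forces a second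
          factor.\<close>
        then have "us \<noteq> []" using ws wu assms by (auto simp: Nn_def Sm_def)
        then have "n \<noteq> 0" using ws wu by (cases us) (auto simp: Nn_def Sm_def)
        then show ?thesis using ws wu True by (auto simp: Nn_def Sm_def)
      next
        case False
        then show ?thesis using ws wu by (auto simp: Nn_def Sm_def)
      qed
    next
      fix ws assume "ws \<in> Sm True m n \<union> ?E"
      then show "ws \<in> Nn m n"
      proof
        assume ws: "ws \<in> Sm True m n"
        then have "[] \<notin> set ws" by (auto simp: Sm_def)
        then have "[] \<notin> set (tl ws)" by (cases ws) auto
        then show ?thesis using ws by (auto simp: Nn_def Sm_def)
      qed (auto simp: Nn_def Sm_def)
    qed
    moreover have "spn ?E = {?j y | y. y \<in> (if n = 0 then {0} else spn (Sm True m (n - 1)))}"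
    proof (cases "n = 0")
      case True
      then show ?thesis by (auto simp: spn_def)
    next
      case False
      show ?thesis
      proof (intro equalityI subsetI)
        fix v :: "gen list list \<Rightarrow>\<^sub>0 'k" assume v: "v \<in> spn ?E"
        have "?j (tln v) = v"
          by (rule lin_spn_eqI[OF v lin_mult_left[OF lin_tln] lin_id]) (auto simp: tln_def)
        moreover have "tln v \<in> spn (Sm True m (n - 1))"
          by (rule lin_spnI[OF lin_tln v subspace_spn]) (auto simp: tln_def)
        ultimately show "v \<in> {?j y | y. y \<in> (if n = 0 then {0} else spn (Sm True m (n - 1)))}" using False
          by (auto intro!: exI[of _ "tln v"])
      next
        fix v :: "gen list list \<Rightarrow>\<^sub>0 'k" assume "v \<in> {?j y | y. y \<in> (if n = 0 then {0} else spn (Sm True m (n - 1)))}"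
        then obtain y where y: "v = ?j y" "y \<in> spn (Sm True m (n - 1))" using False by auto
        show "v \<in> spn ?E" unfolding y(1) by (rule spn_mult[OF _ y(2), of _ "{[[]]}"]) (use False in auto)
      qed
    qed
    moreover have "{x + ?j y | x y. x \<in> spn (Sm True m n) \<and> y \<in> (if n = 0 then {0} else spn (Sm True m (n - 1)))}
      = {a + c | a c. a \<in> spn (Sm True m n) \<and> c \<in> {?j y | y. y \<in> (if n = 0 then {0} else spn (Sm True m (n - 1)))}}"
      by blast
    moreover have "spn (Sm True m n \<union> ?E) = {a + c | a c. a \<in> spn (Sm True m n) \<and> (c :: gen list list \<Rightarrow>\<^sub>0 'k) \<in> spn ?E}"
      by (rule spn_Un)
    ultimately show ?thesis by (simp only:)
  qed
  show ?thesis
    using I.cone_dim(1)[where n = n, OF lin_mult_left[OF lin_id] lin_pn lin_bm pX pj jinj BX bm_unit]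
    unfolding Nn_eq by simp
qed

text \<open>In both families \<open>c n + c (n - 1)\<close> is the dimension of the same Hochschild
  homology, by \<open>normalisation_dim\<close>, so they agree by induction; no map between the two
  cyclic complexes is constructed.\<close>

lemma cA_cI: assumes "0 < m" shows "cA m n = cI m n"
proof (induction n)
  case 0
  then show ?case using hochschild_dim_A[OF assms, of 0] normalised_dim[OF assms, of 0] normalisation_dim[OF assms, of 0] by simp
next
  case (Suc n)
  then show ?case using hochschild_dim_A[OF assms, of "Suc n"] normalised_dim[OF assms, of "Suc n"] normalisation_dim[OF assms, of "Suc n"]
    by simp
qed

section \<open>Vanishing above degree 3\<close>

text \<open>The words of the tail of a normalised tensor are cut out of their concatenation \<open>c\<close>.  A gap of
  \<open>c\<close> not covered by a forbidden subword \<open>d b u\<close> can be cut or not, independently of the other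
  gaps, and toggling the cut contracts the leading part of the complex.  If four or more words are
  present, such a gap is found among the gaps 1, 3, 4, unless \<open>c = d d u u\<close>.\<close>

definition uncovered :: "gen list \<Rightarrow> nat \<Rightarrow> bool" where
  "uncovered c g \<longleftrightarrow> (\<forall>i. i < g \<longrightarrow> g \<le> i + 2 \<longrightarrow> i + 2 < length c \<longrightarrow> \<not> (c ! i = Gen_d \<and> c ! (i + 2) = Gen_u))"

text \<open>The value 2 occurs only for \<open>d d u u\<close>, all of whose gaps are covered. It
  does no harm, since that word can be cut into four nonempty pieces in only one way.\<close>

definition gap :: "gen list \<Rightarrow> nat" where
  "gap c = (if uncovered c 1 then 1 else if uncovered c 3 then 3 else if length c \<ge> 5 then 4 else 2)"

text \<open>If gap 1 is covered, \<open>c\<close> starts with \<open>d b u\<close>. If gap 3 is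
  covered too, that third letter \<open>u\<close> forces the covering subword to start at index 1,
  so \<open>c\<close> starts with \<open>d d u u\<close> and nothing covers gap 4.\<close>

lemma gap_cases:
  assumes "length c \<ge> 4"
  shows "0 < gap c \<and> gap c < length c \<and> (uncovered c (gap c) \<or> c = [Gen_d, Gen_d, Gen_u, Gen_u] \<and> gap c = 2)"
proof (cases "uncovered c 1 \<or> uncovered c 3")
  case True
  then show ?thesis using assms by (auto simp: gap_def)
next
  case False
  have c02: "c ! 0 = Gen_d" "c ! 2 = Gen_u" using False by (auto simp: uncovered_def numeral_2_eq_2)
  obtain i where i: "i < 3" "3 \<le> i + 2" "c ! i = Gen_d" "c ! (i + 2) = Gen_u" using False by (auto simp: uncovered_def)
  have "i = 1 \<or> i = 2" using i by auto
  then have c13: "c ! 1 = Gen_d" "c ! 3 = Gen_u" using i c02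
    by (elim disjE; simp add: numeral_3_eq_3 numeral_2_eq_2)+
  show ?thesis
  proof (cases "length c \<ge> 5")
    case True
    have "uncovered c 4" unfolding uncovered_def
    proof (intro allI impI)
      fix i :: nat assume "i < 4" "4 \<le> i + 2"
      then have "i = 2 \<or> i = 3" by auto
      then show "\<not> (c ! i = Gen_d \<and> c ! (i + 2) = Gen_u)" using c02 c13 by auto
    qed
    then show ?thesis using True False by (auto simp: gap_def)
  next
    case F: False
    then have "length c = 4" using assms by simp
    then have "c = [c ! 0, c ! 1, c ! 2, c ! 3]"
      by (intro nth_equalityI) (auto simp: less_Suc_eq numeral_eq_Suc)
    then show ?thesis using F False c02 c13 assms by (auto simp: gap_def)
  qed
qed

text \<open>A forbidden subword of \<open>x @ y\<close> that lies in neither part straddles the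
  junction and so covers that gap.\<close>

lemma irr_append_uncovered:
  assumes "irr x" "irr y" "uncovered (a @ x @ y @ b) (length a + length x)"
  shows "irr (x @ y)"
  unfolding irr_iff
proof (intro allI impI notI)
  fix i assume i: "i + 2 < length (x @ y)" "(x @ y) ! i = Gen_d \<and> (x @ y) ! (i + 2) = Gen_u"
  show False
  proof (cases "i + 2 < length x")
    case True
    then show False using i assms(1) by (auto simp: irr_iff nth_append)
  next
    case F: False
    show False
    proof (cases "i < length x")
      case True
      have "(a @ x @ y @ b) ! (length a + j) = (x @ y) ! j" if "j < length (x @ y)" for j
        using that by (auto simp: nth_append)
      from this[of i] this[of "i + 2"] have "(a @ x @ y @ b) ! (length a + i) = Gen_d" "(a @ x @ y @ b) ! (length a + i + 2) = Gen_u"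
        using i by (simp_all add: add.assoc)
      then show False using assms(3)[unfolded uncovered_def, rule_format, of "length a + i"] True F i(1) by simp
    next
      case False
      then have "y ! (i - length x) = Gen_d" "y ! (i - length x + 2) = Gen_u" "i - length x + 2 < length y"
        using i by (auto simp: nth_append Suc_diff_le)
      then show False using assms(2) by (auto simp: irr_iff)
    qed
  qed
qed

lemma irr_prefix: "irr (x @ y) \<Longrightarrow> irr x" and irr_suffix: "irr (x @ y) \<Longrightarrow> irr y"
  using irr_factor[of "[]" x y] irr_factor[of x y "[]"] by simp_all

text \<open>The leading term of \<open>mu\<close>: the product of the monomial algebra in which
  forbidden subwords are 0.\<close>

definition mu0 :: "gen list \<Rightarrow> gen list \<Rightarrow> (gen list list \<Rightarrow>\<^sub>0 'k)" where
  "mu0 x y = (if irr (x @ y) then bas [x @ y] else 0)"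

definition G0 :: "(gen list list \<Rightarrow>\<^sub>0 'k) \<Rightarrow> (gen list list \<Rightarrow>\<^sub>0 'k)" where "G0 = lin_ext (gbar mu0)"

text \<open>The cut at letter position \<open>v\<close> of the concatenation, signed by the number
  of words in front; lists already cut there go to 0.\<close>

fun hs :: "nat \<Rightarrow> gen list list \<Rightarrow> (gen list list \<Rightarrow>\<^sub>0 'k)" where
  "hs v [] = 0"
| "hs v (x # us) = (if v < length x then (if v = 0 then 0 else bas (take v x # drop v x # us))
     else - (bas [x] * hs (v - length x) us))"

definition HS :: "nat \<Rightarrow> (gen list list \<Rightarrow>\<^sub>0 'k) \<Rightarrow> (gen list list \<Rightarrow>\<^sub>0 'k)" where "HS v = lin_ext (hs v)"

lemma lin_G0: "lin G0" and lin_HS: "lin (HS v)" unfolding G0_def HS_def by (rule lin_lin_ext)+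

lemma G0_bas [simp]: "G0 (Poly_Mapping.single ws c) = scal c (gbar mu0 ws)"
  and HS_bas [simp]: "HS v (Poly_Mapping.single ws c) = scal c (hs v ws)"
  by (simp_all add: G0_def HS_def)

lemmas G0_simps = lin_simps[OF lin_G0] and HS_simps = lin_simps[OF lin_HS]

definition CL :: "gen list \<Rightarrow> nat \<Rightarrow> gen list list set" where
  "CL c l = {us. concat us = c \<and> length us = l \<and> (\<forall>w\<in>set us. irr w \<and> w \<noteq> [])}"

lemma gbar_mu0_CL: "us \<in> CL c (Suc l) \<Longrightarrow> gbar mu0 us \<in> spn (CL c l)"
proof (induction us arbitrary: c l rule: induct_list012)
  case (3 x y q)
  then obtain l' where l: "l = Suc l'" by (auto simp: CL_def)
  have "mu0 x y * bas q \<in> spn (CL c l)"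
    using 3(3) l by (auto simp: mu0_def CL_def free_vs.subspace_0[OF subspace_spn])
  moreover have "bas [x] * gbar mu0 (y # q) \<in> spn (CL c l)"
    by (rule spn_mult[of _ "{[x]}" _ "CL (concat (y # q)) l'"], simp, rule 3(2)) (use 3(3) l in \<open>auto simp: CL_def\<close>)
  ultimately show ?case by (simp add: free_vs.subspace_diff[OF subspace_spn])
qed (auto simp: free_vs.subspace_0[OF subspace_spn])

lemma hs_cut: "[] \<notin> set Q \<Longrightarrow> length (concat P) = v \<Longrightarrow> hs v (P @ Q) = 0"
proof (induction P arbitrary: v)
  case Nil
  then show ?case by (cases Q) auto
qed auto

lemma hs_uncut:
  "length (concat p) + length x = v \<Longrightarrow> x \<noteq> [] \<Longrightarrow> y \<noteq> [] \<Longrightarrow>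
   hs v (p @ (x @ y) # q) = scal ((- 1) ^ length p) (bas (p @ x # y # q))"
  by (induction p arbitrary: v) (auto simp: scal_mult free_vs.scale_minus_left single_uminus)

lemma cut_cases:
  assumes "0 < v" "v < length (concat us)"
  shows "(\<exists>P Q. us = P @ Q \<and> P \<noteq> [] \<and> Q \<noteq> [] \<and> length (concat P) = v) \<or>
    (\<exists>p x y q. us = p @ (x @ y) # q \<and> x \<noteq> [] \<and> y \<noteq> [] \<and> length (concat p) + length x = v)"
  using assms
proof (induction us arbitrary: v)
  case (Cons a us)
  consider "v < length a" | "v = length a" | "v > length a" by linarith
  then show ?case
  proof cases
    case 1
    then have "a # us = [] @ (take v a @ drop v a) # us \<and> take v a \<noteq> [] \<and> drop v a \<noteq> [] \<and> length (concat []) + length (take v a) = v"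
      using Cons.prems by auto
    then show ?thesis by blast
  next
    case 2
    then have "a # us = [a] @ us \<and> [a] \<noteq> [] \<and> us \<noteq> [] \<and> length (concat [a]) = v" using Cons.prems by auto
    then show ?thesis by blast
  next
    case 3
    then have "0 < v - length a" "v - length a < length (concat us)" using Cons.prems by auto
    from Cons.IH[OF this] consider P Q where "us = P @ Q" "P \<noteq> []" "Q \<noteq> []" "length (concat P) = v - length a"
      | p x y q where "us = p @ (x @ y) # q" "x \<noteq> []" "y \<noteq> []" "length (concat p) + length x = v - length a"
      by blast
    then show ?thesis
    proof cases
      case 1
      then have "a # us = (a # P) @ Q \<and> a # P \<noteq> [] \<and> Q \<noteq> [] \<and> length (concat (a # P)) = v" using \<open>v > length a\<close> by auto
      then show ?thesis by blast
    next
      case 2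
      then have "a # us = (a # p) @ (x @ y) # q \<and> x \<noteq> [] \<and> y \<noteq> [] \<and> length (concat (a # p)) + length x = v"
        using \<open>v > length a\<close> by auto
      then show ?thesis by blast
    qed
  qed
qed simp

lemma HS_cut:
  assumes "A \<in> spn {P. length (concat P) = v}" "B \<in> spn {Q. [] \<notin> set Q}"
  shows "HS v (A * B) = 0"
proof -
  have "A * B \<in> spn {us. hs v us = 0}" by (rule spn_mult[OF assms]) (simp add: hs_cut)
  then show ?thesis
    by (rule lin_spn_eqI[OF _ lin_HS, of _ _ "\<lambda>_. 0"]) (auto simp: linI)
qed

lemma HS_uncut_left:
  assumes "A \<in> spn (CL a l)" "x \<noteq> []" "y \<noteq> []" "length a + length x = v"
  shows "HS v (A * bas ((x @ y) # q)) = scal ((- 1) ^ l) (A * bas (x # y # q))"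
  by (rule lin_spn_eqI[OF assms(1) lin_comp[OF lin_HS lin_mult_right[OF lin_id]] lin_scal_fun[OF lin_mult_right[OF lin_id]]])
    (use assms in \<open>auto simp: CL_def hs_uncut\<close>)

lemma HS_uncut_right:
  assumes "x \<noteq> []" "y \<noteq> []" "length (concat p) + length x = v"
  shows "HS v (bas (p @ [x @ y]) * B) = scal ((- 1) ^ length p) (bas (p @ [x, y]) * B)"
  by (rule lin_eqI[OF lin_comp[OF lin_HS lin_mult_left[OF lin_id]] lin_scal_fun[OF lin_mult_left[OF lin_id]]])
    (use assms hs_uncut[of p x v y] in simp)

definition "mL p w = (if p = [] then 0 else bas (butlast p) * mu0 (last p) w)"
definition "mR w q = (if q = [] then 0 else mu0 w (hd q) * bas (tl q))"

lemma gbar_right: "gbar mu0 (w # q) = mR w q - bas [w] * gbar mu0 q"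
  by (cases q) (simp_all add: mR_def)

lemma gbar_mid: "gbar mu0 (p @ w # q) = gbar mu0 p * bas (w # q) + scal ((- 1) ^ (length p - 1)) (mL p w * bas q)
   + scal ((- 1) ^ length p) (bas p * mR w q) - scal ((- 1) ^ length p) (bas (p @ [w]) * gbar mu0 q)"
proof (cases "p = []")
  case True
  then show ?thesis by (simp add: gbar_right mL_def one_eq_bas[symmetric] del: single_one)
next
  case False
  have "bas p * gbar mu0 (w # q) = bas p * mR w q - bas (p @ [w]) * gbar mu0 q"
    unfolding gbar_right by (simp add: right_diff_distrib mult.assoc[symmetric])
  then show ?thesis using gbar_append[OF False, of "w # q" mu0] False
    by (simp add: mL_def free_vs.scale_right_diff_distrib)
qed

text \<open>Only the face that merges across the cut at \<open>v\<close> can be cut there again, and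
  doing so restores the list.\<close>

lemma toggle_cut:
  assumes PQ: "P \<in> CL a (Suc l)" "Q \<in> CL b (Suc k)" and v: "length a = v" and irr: "irr (last P @ hd Q)"
  shows "G0 (hs v (P @ Q)) + HS v (gbar mu0 (P @ Q)) = bas (P @ Q)"
proof -
  have ne: "P \<noteq> []" "Q \<noteq> []" using PQ by (auto simp: CL_def)
  have nQ: "[] \<notin> set Q" and nP: "[] \<notin> set P" using PQ by (auto simp: CL_def)
  have "hs v (P @ Q) = 0" by (rule hs_cut[OF nQ]) (use PQ v in \<open>auto simp: CL_def\<close>)
  moreover have "HS v (gbar mu0 P * bas Q) = 0"
    by (rule HS_cut[OF subsetD[OF spn_mono gbar_mu0_CL[OF PQ(1)]]]) (use PQ v in \<open>auto simp: CL_def\<close>)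
  moreover have "HS v (bas P * gbar mu0 Q) = 0"
    by (rule HS_cut[OF _ subsetD[OF spn_mono gbar_mu0_CL[OF PQ(2)]]]) (use PQ v in \<open>auto simp: CL_def\<close>)
  moreover have "HS v (bas (butlast P) * mu0 (last P) (hd Q) * bas (tl Q)) = scal ((- 1) ^ (length P - 1)) (bas (P @ Q))"
  proof -
    have c: "concat P = concat (butlast P) @ last P" using ne(1) by (metis append_butlast_last_id concat.simps concat_append append_Nil2)
    have "hs v (butlast P @ (last P @ hd Q) # tl Q) = scal ((- 1) ^ length (butlast P)) (bas (butlast P @ last P # hd Q # tl Q))"
    proof (rule hs_uncut)
      show "length (concat (butlast P)) + length (last P) = v"
        using PQ(1) v arg_cong[OF c, of length] by (simp add: CL_def)
      show "last P \<noteq> []" "hd Q \<noteq> []" using ne nP nQ by (metis last_in_set, metis hd_in_set)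
    qed
    moreover have "butlast P @ last P # hd Q # tl Q = P @ Q" using ne by (metis append.assoc append_Cons append_Nil append_butlast_last_id list.collapse)
    ultimately show ?thesis using irr by (simp add: mu0_def)
  qed
  ultimately show ?thesis using gbar_append[OF ne, of mu0] 
    by (simp add: HS_simps G0_simps sgn_square power_add[symmetric] mult_2[symmetric])
qed

text \<open>Cutting at \<open>v\<close> and merging again returns the list. The other faces cancel,
  because at an uncovered gap the irreducibility of a merged word does not depend on whether the cut
  has been made.\<close>

lemma toggle_uncut:
  assumes us: "p @ (x @ y) # q \<in> CL c l" and ne: "x \<noteq> []" "y \<noteq> []" and v: "length (concat p) + length x = v"
    and uncovered: "uncovered c v"
  shows "G0 (hs v (p @ (x @ y) # q)) + HS v (gbar mu0 (p @ (x @ y) # q)) = bas (p @ (x @ y) # q)"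
proof -
  let ?s = "\<lambda>i. (- 1) ^ i :: 'k"
  have ixy: "irr (x @ y)" and c: "c = concat p @ x @ y @ concat q" using us by (auto simp: CL_def)
  have p: "p \<in> CL (concat p) (length p)" and q: "q \<in> CL (concat q) (length q)" using us by (auto simp: CL_def)
  have nq: "[] \<notin> set q" using us by (auto simp: CL_def)
  have L: "HS v (mL p (x @ y) * bas q) = scal (?s (length p - 1)) (mL p x * bas (y # q))"
  proof (cases "p = []")
    case False
    then have pz: "p = butlast p @ [last p]" by simp
    then have cp: "concat p = concat (butlast p) @ last p" by (metis append_Nil2 concat.simps concat_append)
    have ilast: "irr (last p)" using p False by (auto simp: CL_def)
    have "irr (last p @ x @ y) \<longleftrightarrow> irr (last p @ x)"
      using irr_append_uncovered[of "last p @ x" y "concat (butlast p)" "concat q"] uncovered v irr_suffix[OF ixy] irr_prefix[of "last p @ x" y]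
      unfolding c cp by (auto simp: add.assoc)
    moreover have "hs v (butlast p @ ((last p @ x) @ y) # q) = scal (?s (length (butlast p))) (bas (butlast p @ (last p @ x) # y # q))"
      by (rule hs_uncut) (use v cp ne in auto)
    ultimately show ?thesis using False by (simp add: mL_def mu0_def HS_simps)
  qed (simp add: mL_def HS_simps)
  have R: "HS v (bas p * mR (x @ y) q) = scal (?s (length p)) (bas (p @ [x]) * mR y q)"
  proof (cases q)
    case (Cons z r)
    have "irr (x @ y @ z) \<longleftrightarrow> irr (y @ z)"
      using irr_append_uncovered[of x "y @ z" "concat p" "concat r"] uncovered v irr_prefix[OF ixy] irr_suffix[of x "y @ z"]
      unfolding c Cons by (auto simp: add.assoc)
    moreover have "hs v (p @ (x @ y @ z) # r) = scal (?s (length p)) (bas (p @ x # (y @ z) # r))"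
      by (rule hs_uncut) (use v ne in auto)
    ultimately show ?thesis using Cons by (simp add: mR_def mu0_def HS_simps)
  qed (simp add: mR_def HS_simps)
  have A: "HS v (gbar mu0 p * bas ((x @ y) # q)) = scal (?s (length p - 1)) (gbar mu0 p * bas (x # y # q))"
  proof (cases "length p")
    case 0 then show ?thesis by (simp add: HS_simps)
  next
    case (Suc k)
    then have "gbar mu0 p \<in> spn (CL (concat p) k)" using p gbar_mu0_CL by simp
    from HS_uncut_left[OF this ne v] show ?thesis using Suc by simp
  qed
  have B: "HS v (bas (p @ [x @ y]) * gbar mu0 q) = scal (?s (length p)) (bas (p @ [x, y]) * gbar mu0 q)"
    by (rule HS_uncut_right[OF ne v])
  have sp: "scal (?s (length p)) (scal (?s (length p - 1)) z) = - z" if "p \<noteq> []" for z :: "gen list list \<Rightarrow>\<^sub>0 'k"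
    using that by (cases p) (simp_all add: sgn_square free_vs.scale_minus_left)
  have HSg: "HS v (gbar mu0 (p @ (x @ y) # q)) = scal (?s (length p - 1)) (gbar mu0 p * bas (x # y # q))
     + mL p x * bas (y # q) + bas (p @ [x]) * mR y q - bas (p @ [x, y]) * gbar mu0 q"
    unfolding gbar_mid HS_simps A L R B by (simp add: sgn_square)
  have "gbar mu0 (p @ x # y # q) = gbar mu0 p * bas (x # y # q) + scal (?s (length p - 1)) (mL p x * bas (y # q))
     + scal (?s (length p)) (bas p * mu0 x y * bas q) - scal (?s (length p)) (bas (p @ [x]) * (mR y q - bas [y] * gbar mu0 q))"
    unfolding gbar_mid[of p x "y # q"] gbar_right[of y q] by (simp add: mR_def mult.assoc)
  also have "bas p * mu0 x y * bas q = bas (p @ (x @ y) # q)" using ixy by (simp add: mu0_def)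
  also have "bas (p @ [x]) * (mR y q - bas [y] * gbar mu0 q) = bas (p @ [x]) * mR y q - bas (p @ [x, y]) * gbar mu0 q"
    by (simp add: right_diff_distrib mult.assoc[symmetric])
  finally have g: "gbar mu0 (p @ x # y # q) = gbar mu0 p * bas (x # y # q) + scal (?s (length p - 1)) (mL p x * bas (y # q))
     + scal (?s (length p)) (bas (p @ (x @ y) # q)) - scal (?s (length p)) (bas (p @ [x]) * mR y q - bas (p @ [x, y]) * gbar mu0 q)" .
  have G: "G0 (hs v (p @ (x @ y) # q)) = scal (?s (length p)) (gbar mu0 p * bas (x # y # q)) 
     + scal (?s (length p)) (scal (?s (length p - 1)) (mL p x * bas (y # q)))
     + bas (p @ (x @ y) # q) - (bas (p @ [x]) * mR y q - bas (p @ [x, y]) * gbar mu0 q)"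
    unfolding hs_uncut[OF v ne] G0_simps G0_bas g free_vs.scale_one free_vs.scale_right_distrib free_vs.scale_right_diff_distrib free_vs.scale_scale
    by (simp add: sgn_square)
  show ?thesis
  proof (cases "p = []")
    case True
    then show ?thesis unfolding G HSg by (simp add: mL_def)
  next
    case False
    then have "?s (length p) = - ?s (length p - 1)" by (cases p) auto
    then show ?thesis unfolding G HSg sp[OF False] by (simp add: free_vs.scale_minus_left)
  qed
qed

lemma toggle:
  assumes us: "us \<in> CL c (Suc (Suc (Suc (Suc l))))"
  shows "G0 (hs (gap c) us) + HS (gap c) (gbar mu0 us) = bas us"
proof -
  have len: "length us \<le> length (concat us)" if "[] \<notin> set us" for us :: "gen list list"
    using that
  proof (induction us)
    case (Cons a us)
    then show ?case by (cases a) auto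
  qed simp
  have cus: "c = concat us" and ne: "[] \<notin> set us" and lus: "length us \<ge> 4" using us by (auto simp: CL_def)
  have "length c \<ge> 4" using len[OF ne] lus cus by simp
  note g = gap_cases[OF this]
  show ?thesis
  proof (cases "uncovered c (gap c)")
    case True
    have "0 < gap c" "gap c < length (concat us)" using g cus by auto
    from cut_cases[OF this] consider
        P Q where "us = P @ Q" "P \<noteq> []" "Q \<noteq> []" "length (concat P) = gap c"
      | p x y q where "us = p @ (x @ y) # q" "x \<noteq> []" "y \<noteq> []" "length (concat p) + length x = gap c" by blast
    then show ?thesis
    proof cases
      case 1
      have P: "P \<in> CL (concat P) (Suc (length P - 1))" and Q: "Q \<in> CL (concat Q) (Suc (length Q - 1))"
        using us 1 by (auto simp: CL_def)
      obtain p' x where p': "P = p' @ [x]" using 1(2) by (metis rev_exhaust)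
      obtain y q' where q': "Q = y # q'" using 1(3) by (metis list.exhaust)
      have "irr (x @ y)"
        by (rule irr_append_uncovered[where a = "concat p'" and b = "concat q'"])
          (use us 1 p' q' True cus in \<open>auto simp: CL_def\<close>)
      then have "irr (last P @ hd Q)" using p' q' by simp
      from toggle_cut[OF P Q 1(4) this] show ?thesis using 1(1) by simp
    next
      case 2
      show ?thesis using toggle_uncut[OF us[unfolded 2(1)] 2(2-4) True] 2(1) by simp
    qed
  next
    case False
    with g have c: "c = [Gen_d, Gen_d, Gen_u, Gen_u]" "gap c = 2" by auto
    \<comment> \<open>At least four nonempty words out of four letters are the letters themselves.
      This list is cut at 2, and merging there gives the irreducible word \<open>d u\<close>, so
      \<open>toggle_cut\<close> applies although the gap is covered.\<close>
    obtain a1 a2 a3 a4 r where dec: "us = a1 # a2 # a3 # a4 # r" using us by (auto simp: CL_def length_Suc_conv)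
    have "r = []" "length a1 = 1" "length a2 = 1" "length a3 = 1" "length a4 = 1"
    proof -
      have "length (concat us) = 4" unfolding cus[symmetric] c(1) by simp
      then have "length a1 + length a2 + length a3 + length a4 + length (concat r) = 4" by (simp add: dec)
      moreover have "length a1 \<ge> 1" "length a2 \<ge> 1" "length a3 \<ge> 1" "length a4 \<ge> 1" "length r \<le> length (concat r)"
        using ne dec len[of r] by (auto simp: Suc_le_eq)
      ultimately have "length a1 = 1" "length a2 = 1" "length a3 = 1" "length a4 = 1" "length r = 0" by linarith+
      then show "r = []" "length a1 = 1" "length a2 = 1" "length a3 = 1" "length a4 = 1" by simp_all
    qed
    then have "us = [[Gen_d], [Gen_d], [Gen_u], [Gen_u]]"
      using cus c(1) dec by (auto simp: length_Suc_conv One_nat_def)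
    then have "us = [[Gen_d], [Gen_d]] @ [[Gen_u], [Gen_u]]" by simp
    moreover have "irr [Gen_d, Gen_u]" "irr [Gen_d]" "irr [Gen_u]" by (simp_all add: irr_def)
    ultimately show ?thesis
      using toggle_cut[of "[[Gen_d], [Gen_d]]" "[Gen_d, Gen_d]" 1 "[[Gen_u], [Gen_u]]" "[Gen_u, Gen_u]" 1 2] c(2)
      by (simp add: CL_def)
  qed
qed

end

section \<open>The contraction up to smaller tails, and exactness\<close>

context down_up_algebra
begin

text \<open>Orders words by length first and by \<open>bval\<close> second: the binary number with
  an additional leading 1.\<close>

definition rho :: "gen list \<Rightarrow> nat" where "rho w = 2 ^ length w + bval w"

lemma rho_less: "length v < length w \<Longrightarrow> rho v < rho w" "length v = length w \<Longrightarrow> bval v < bval w \<Longrightarrow> rho v < rho w"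
proof -
  assume "length v < length w"
  then have "(2::nat) ^ Suc (length v) \<le> 2 ^ length w" by (intro power_increasing) auto
  then show "rho v < rho w" using bval_less[of v] by (simp add: rho_def)
qed (simp add: rho_def)

text \<open>Only the tail is measured, because the faces involving factor 0 shorten it whatever they
  do to factor 0.\<close>

definition low :: "nat \<Rightarrow> (gen list list \<Rightarrow>\<^sub>0 'k) set" where
  "low r = spn {ws. rho (concat (tl ws)) < r}"

lemma sub_low: "free_vs.subspace (low r)" by (simp add: low_def)

lemmas low_cl = free_vs.subspace_add[OF sub_low] free_vs.subspace_diff[OF sub_low] free_vs.subspace_neg[OF sub_low]
  free_vs.subspace_scale[OF sub_low] free_vs.subspace_0[OF sub_low]

lemma mu_leading:
  "mu x y - mu0 x y \<in> spn {[v] | v. length v = length x + length y \<and> bval v < bval (x @ y)}"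
proof (cases "irr (x @ y)")
  case True
  then show ?thesis by (simp add: mu_def mu0_def nf_irr free_vs.subspace_0[OF subspace_spn])
next
  case False
  have "nf (x @ y) \<in> spn {v. length v = length x + length y \<and> bval v < bval (x @ y)}"
    using keys_nf[of _ "x @ y"] False by (auto simp: spn_def)
  from iota_in[OF this] show ?thesis using False unfolding mu_def mu0_def
    by (simp add: setcompr_eq_image)
qed

lemma bval_mono: "bval v < bval w \<Longrightarrow> bval (v @ s) < bval (w @ s)"
  by (simp add: bval_append)

lemma gbar_leading:
  "gbar mu us - gbar mu0 us \<in> spn {vs. length (concat vs) = length (concat us) \<and> bval (concat vs) < bval (concat us)}"
proof (induction us rule: induct_list012)
  case (3 x y q)
  have "(mu x y - mu0 x y) * bas q \<in> spn {vs. length (concat vs) = length (concat (x # y # q)) \<and> bval (concat vs) < bval (concat (x # y # q))}"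
    by (rule spn_mult[OF mu_leading, of _ "{q}"]) (use bval_mono[of _ "x @ y" "concat q"] in auto)
  moreover have "bas [x] * (gbar mu (y # q) - gbar mu0 (y # q))
      \<in> spn {vs. length (concat vs) = length (concat (x # y # q)) \<and> bval (concat vs) < bval (concat (x # y # q))}"
    by (rule spn_mult[OF _ 3(2), of _ "{[x]}"]) (auto simp: bval_append)
  ultimately have "(mu x y - mu0 x y) * bas q - bas [x] * (gbar mu (y # q) - gbar mu0 (y # q))
      \<in> spn {vs. length (concat vs) = length (concat (x # y # q)) \<and> bval (concat vs) < bval (concat (x # y # q))}"
    by (rule free_vs.subspace_diff[OF subspace_spn])
  then show ?case by (simp add: algebra_simps)
qed (auto simp: free_vs.subspace_0[OF subspace_spn])

text \<open>The two faces at factor 0 shorten the tail, and passing from \<open>mu\<close> to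
  \<open>mu0\<close> in the others lowers its \<open>bval\<close>. The factor in front of
  \<open>us\<close> accounts for the sign.\<close>

lemma bm_leading:
  assumes us: "us \<in> CL c (Suc l)"
  shows "bm (bas (w0 # us)) + bas [w0] * gbar mu0 us \<in> low (rho c)"
proof -
  obtain u us' where u: "us = u # us'" "u \<noteq> []" using us by (cases us) (auto simp: CL_def)
  obtain q z where qz: "us = q @ [z]" "z \<noteq> []" using us by (cases us rule: rev_cases) (auto simp: CL_def)
  have c: "c = concat us" using us by (simp add: CL_def)
  have 1: "mu w0 u * bas us' \<in> low (rho c)" unfolding low_def
    by (rule spn_mult[OF mu_in, of _ "{us'}"]) (use u c in \<open>auto intro!: rho_less(1)\<close>)
  have 2: "mu z w0 * bas q \<in> low (rho c)" unfolding low_def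
    by (rule spn_mult[OF mu_in, of _ "{q}"]) (use qz c in \<open>auto intro!: rho_less(1)\<close>)
  have 3: "bas [w0] * (gbar mu us - gbar mu0 us) \<in> low (rho c)" unfolding low_def
    by (rule spn_mult[OF _ gbar_leading, of _ "{[w0]}"]) (use c in \<open>auto intro!: rho_less(2)\<close>)
  have "bm (bas (w0 # us)) = gbar mu (w0 # us) + scal ((- 1) ^ Suc (length q)) (mu z w0 * bas q)"
    unfolding qz(1) by (rule bm_snoc)
  also have "gbar mu (w0 # us) = mu w0 u * bas us' - bas [w0] * gbar mu us" by (simp add: u)
  finally have "bm (bas (w0 # us)) + bas [w0] * gbar mu0 us
     = mu w0 u * bas us' - bas [w0] * (gbar mu us - gbar mu0 us) + scal ((- 1) ^ Suc (length q)) (mu z w0 * bas q)"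
    by (simp add: algebra_simps)
  then show ?thesis using 1 2 3 by (auto intro!: low_cl simp: free_vs.scale_minus_left)
qed

text \<open>The minus sign matches the one with which \<open>gbar mu0\<close> appears in
  \<open>bm_leading\<close>.\<close>

definition hM :: "(gen list list \<Rightarrow>\<^sub>0 'k) \<Rightarrow> (gen list list \<Rightarrow>\<^sub>0 'k)" where
  "hM = lin_ext (\<lambda>ws. case ws of [] \<Rightarrow> 0 | w # us \<Rightarrow> - (bas [w] * hs (gap (concat us)) us))"

lemma lin_hM: "lin hM" unfolding hM_def by (rule lin_lin_ext)

lemmas hM_simps = lin_simps[OF lin_hM]

lemma hM_mult:
  assumes "z \<in> spn {us. concat us = c}"
  shows "hM (bas [w] * z) = - (bas [w] * HS (gap c) z)"
proof -
  have "hM (bas [w] * z) = scal (- 1) (bas [w] * HS (gap c) z)"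
    by (rule lin_spn_eqI[OF assms lin_comp[OF lin_hM lin_mult_left[OF lin_id]] lin_scal_fun[OF lin_mult_left[OF lin_HS]]])
      (auto simp: hM_def free_vs.scale_minus_left)
  then show ?thesis by (simp add: free_vs.scale_minus_left)
qed

lemma hs_concat: "hs v us \<in> spn {us'. concat us' = concat us}"
proof (induction us arbitrary: v)
  case (Cons x us)
  show ?case
  proof (cases "v < length x")
    case True
    then show ?thesis by (auto simp: free_vs.subspace_0[OF subspace_spn] append_take_drop_id[symmetric] simp flip: append.assoc)
  next
    case False
    have "bas [x] * hs (v - length x) us \<in> spn {us'. concat us' = concat (x # us)}"
      by (rule spn_mult[OF _ Cons, of _ "{[x]}"]) auto
    then show ?thesis using False by (simp add: free_vs.subspace_neg[OF subspace_spn])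
  qed
qed (simp add: free_vs.subspace_0[OF subspace_spn])

lemma hs_CL: "us \<in> CL c l \<Longrightarrow> hs v us \<in> spn (CL c (Suc l))"
proof (induction us arbitrary: v c l)
  case (Cons x us)
  show ?case
  proof (cases "v < length x")
    case True
    have "irr (take v x)" "irr (drop v x)" using Cons.prems irr_prefix[of "take v x" "drop v x"] irr_suffix[of "take v x" "drop v x"]
      by (auto simp: CL_def)
    then have "v \<noteq> 0 \<Longrightarrow> take v x # drop v x # us \<in> CL c (Suc l)" using True Cons.prems
      by (auto simp: CL_def simp flip: append.assoc)
    then show ?thesis using True by (auto simp: free_vs.subspace_0[OF subspace_spn])
  next
    case False
    have "us \<in> CL (concat us) (length us)" using Cons.prems by (auto simp: CL_def)
    then have "bas [x] * hs (v - length x) us \<in> spn (CL c (Suc l))"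
      by (intro spn_mult[OF _ Cons.IH, of _ "{[x]}"]) (use Cons.prems in \<open>auto simp: CL_def\<close>)
    then show ?thesis using False by (simp add: free_vs.subspace_neg[OF subspace_spn])
  qed
qed (simp add: free_vs.subspace_0[OF subspace_spn])

lemma hM_low: "x \<in> low r \<Longrightarrow> hM x \<in> low r"
proof -
  have "hM (bas ws) \<in> low r" if "rho (concat (tl ws)) < r" for ws
  proof (cases ws)
    case (Cons w us)
    have "bas [w] * hs (gap (concat us)) us \<in> low r" unfolding low_def
      by (rule spn_mult[OF _ hs_concat, of _ "{[w]}"]) (use that Cons in auto)
    then show ?thesis using Cons by (simp add: hM_def low_cl)
  qed (simp add: hM_def low_cl)
  then show "x \<in> low r \<Longrightarrow> hM x \<in> low r" using lin_spnI[OF lin_hM _ sub_low, of x] by (auto simp: low_def)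
qed

lemma bm_mult_leading:
  assumes "z \<in> spn (CL c (Suc l))"
  shows "bm (bas [w] * z) + bas [w] * G0 z \<in> low (rho c)"
  by (rule lin_spnI[where f = "\<lambda>z. bm (bas [w] * z) + bas [w] * G0 z" and S = "CL c (Suc l)",
        OF lin_plus[OF lin_comp[OF lin_bm lin_mult_left[OF lin_id]] lin_mult_left[OF lin_G0]] assms sub_low])
    (use bm_leading in simp)

lemma Nn_CL: "ws \<in> Nn m n \<Longrightarrow> \<exists>w us. ws = w # us \<and> irr w \<and> us \<in> CL (concat us) n"
  by (cases ws) (auto simp: Nn_def Sm_def CL_def)

text \<open>This is \<open>toggle\<close> behind factor 0, with the errors collected in
  \<open>low\<close>; \<open>toggle\<close> needs four words in the tail, whence the bound on
  \<open>n\<close>.\<close>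

lemma hM_contraction:
  assumes ws: "ws \<in> Nn m n" and n: "4 \<le> n"
  shows "bm (hM (bas ws)) + hM (bm (bas ws)) - bas ws \<in> low (rho (concat (tl ws)))"
proof -
  obtain w us where wu: "ws = w # us" "us \<in> CL (concat us) n" using Nn_CL[OF ws] by blast
  define c where "c = concat us"
  define l where "l = n - 4"
  have l: "n = Suc (Suc (Suc (Suc l)))" using n by (simp add: l_def)
  have us: "us \<in> CL c n" using wu(2) c_def by simp
  let ?z = "hs (gap c) us"
  have h: "hM (bas ws) = - (bas [w] * ?z)" by (simp add: hM_def wu(1) c_def)
  have b1: "bm (bas [w] * ?z) + bas [w] * G0 ?z \<in> low (rho c)" by (rule bm_mult_leading[OF hs_CL[OF us]])
  have b2: "bm (bas ws) + bas [w] * gbar mu0 us \<in> low (rho c)"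
    using bm_leading[of us c "Suc (Suc (Suc l))" w] us l wu(1) by simp
  have gz: "gbar mu0 us \<in> spn {us. concat us = c}"
    by (rule subsetD[OF spn_mono gbar_mu0_CL[of us c "Suc (Suc (Suc l))"]]) (use us l in \<open>auto simp: CL_def\<close>)
  have "hM (bm (bas ws)) + hM (bas [w] * gbar mu0 us) \<in> low (rho c)"
    using hM_low[OF b2] by (simp add: hM_simps)
  then have b3: "hM (bm (bas ws)) - bas [w] * HS (gap c) (gbar mu0 us) \<in> low (rho c)"
    unfolding hM_mult[OF gz] by simp
  have t: "G0 ?z + HS (gap c) (gbar mu0 us) = bas us" by (rule toggle) (use us l in simp)
  have "bas ws = bas [w] * G0 ?z + bas [w] * HS (gap c) (gbar mu0 us)"
    unfolding distrib_left[symmetric] t using wu(1) by simp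
  then have eq: "bm (hM (bas ws)) + hM (bm (bas ws)) - bas ws
    = (hM (bm (bas ws)) - bas [w] * HS (gap c) (gbar mu0 us)) - (bm (bas [w] * ?z) + bas [w] * G0 ?z)"
    unfolding h by (simp add: bm_simps algebra_simps)
  have "concat (tl ws) = c" using wu(1) c_def by simp
  then show ?thesis unfolding eq using low_cl(2)[OF b3 b1] by simp
qed

lemma hM_Nn:
  assumes "x \<in> spn (Nn m n)"
  shows "hM x \<in> spn (Nn m (Suc n))"
proof (rule lin_spnI[OF lin_hM assms subspace_spn])
  fix ws assume ws: "ws \<in> Nn m n"
  then obtain w us where wu: "ws = w # us" "irr w" "us \<in> CL (concat us) n" using Nn_CL by blast
  have m: "length w + length (concat us) = m" using ws wu(1) by (simp add: Nn_def Sm_def length_concat)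
  have "bas [w] * hs (gap (concat us)) us \<in> spn (Nn m (Suc n))"
    by (rule spn_mult[OF _ hs_CL[OF wu(3)], of _ "{[w]}"])
      (use wu m in \<open>auto simp: CL_def Nn_def Sm_def length_concat[symmetric]\<close>)
  then show "hM (bas ws) \<in> spn (Nn m (Suc n))" by (simp add: hM_def wu(1) free_vs.subspace_neg[OF subspace_spn])
qed

text \<open>For a cycle \<open>x\<close> the difference \<open>bm (hM x) - x\<close> is a cycle with
  strictly smaller tails; induction on a bound for the tails ends at 0.\<close>

lemma Nn_exact:
  assumes "4 \<le> n" and m: "0 < m"
  shows "x \<in> spn (Nn m n) \<Longrightarrow> bm x = 0 \<Longrightarrow> \<exists>w\<in>spn (Nn m (Suc n)). x = bm w"
proof -
  have sub: "spn (Nn m k) \<subseteq> spn (Sm False m k)" for k by (rule spn_mono) (auto simp: Nn_def)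
  have *: "\<exists>w\<in>spn (Nn m (Suc n)). x = bm w" if "x \<in> spn (Nn m n)" "x \<in> low r" "bm x = 0" for x r
    using that
  proof (induction r arbitrary: x)
    case 0
    then have "x = 0" by (simp add: low_def spn_def)
    then show ?case by (intro bexI[of _ 0]) (auto simp: bm_simps free_vs.subspace_0[OF subspace_spn])
  next
    case (Suc r)
    let ?\<phi> = "\<lambda>x. bm (hM x) + hM (bm x) - x"
    have "?\<phi> x \<in> low r"
    proof (rule lin_spnI[where f = ?\<phi> and S = "Nn m n \<inter> {ws. rho (concat (tl ws)) < Suc r}"])
      show "lin ?\<phi>"
        by (rule lin_minus_fun[OF lin_plus[OF lin_comp[OF lin_bm lin_hM] lin_comp[OF lin_hM lin_bm]] lin_id])
      show "x \<in> spn (Nn m n \<inter> {ws. rho (concat (tl ws)) < Suc r})" using Suc.prems by (intro spn_Int) (auto simp: low_def)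
      fix ws assume "ws \<in> Nn m n \<inter> {ws. rho (concat (tl ws)) < Suc r}"
      then have "?\<phi> (bas ws) \<in> low (rho (concat (tl ws)))" "rho (concat (tl ws)) \<le> r" using hM_contraction assms by auto
      then show "?\<phi> (bas ws) \<in> low r" unfolding low_def by (rule_tac subsetD[OF spn_mono]) auto
    qed (rule sub_low)
    then have l: "bm (hM x) - x \<in> low r" using Suc.prems(3) by (simp add: hM_simps)
    have hN: "hM x \<in> spn (Nn m (Suc n))" by (rule hM_Nn[OF Suc.prems(1)])
    have bN: "bm (hM x) - x \<in> spn (Nn m n)" by (rule free_vs.subspace_diff[OF subspace_spn bm_Nn[OF hN] Suc.prems(1)])
    have "bm (bm (hM x)) = 0" by (rule bm_bm[OF m]) (use sub hN in blast)
    then have "bm (bm (hM x) - x) = 0" using Suc.prems(3) by (simp add: bm_simps)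
    from Suc.IH[OF bN l this] obtain w where w: "w \<in> spn (Nn m (Suc n))" "bm (hM x) - x = bm w" by blast
    have "x = bm (hM x) - bm w" using w(2) by (simp add: algebra_simps)
    also have "\<dots> = bm (hM x - w)" by (simp add: bm_simps)
    finally show ?case using free_vs.subspace_diff[OF subspace_spn hN w(1)] by blast
  qed
  assume x: "x \<in> spn (Nn m n)" "bm x = 0"
  have "x \<in> low (Suc (Max ((\<lambda>ws. rho (concat (tl ws))) ` keys x)))"
    unfolding low_def spn_def by (auto simp: less_Suc_eq_le intro!: Max_ge)
  from *[OF x(1) this x(2)] show "\<exists>w\<in>spn (Nn m (Suc n)). x = bm w" .
qed

text \<open>Exactness in degree \<open>n + 1\<close>, which is at least 4, makes the sum of
  \<open>cI m (Suc n)\<close> and \<open>cI m n\<close> zero, hence each of them.\<close>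

lemma cI_vanish:
  assumes m: "0 < m" and n: "3 \<le> n"
  shows "cI m n = 0"
proof -
  have sub: "spn (Nn m k) \<subseteq> spn (Sm False m k)" for k by (rule spn_mono) (auto simp: Nn_def)
  have "{x \<in> spn (Nn m (Suc n)). bm x = 0} = bm ` spn (Nn m (Suc (Suc n)))"
    using Nn_exact[of "Suc n" m] bm_Nn[of _ m "Suc n"] bm_bm[OF m] sub[of "Suc (Suc n)"] n m by fastforce
  then show ?thesis using normalised_dim[OF m, of "Suc n"] by simp
qed

end

section \<open>Lists fixed by a rotation\<close>

lemma concat_replicate_comm: "concat (replicate n us) @ us = us @ concat (replicate n us)"
  by (induction n) auto

lemma commuting_replicate:
  assumes "r @ us = us @ r" "length r = e * length us"
  shows "r = concat (replicate e us)"
  using assms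
proof (induction e arbitrary: r)
  case (Suc e)
  have "take (length us) (r @ us) = take (length us) (us @ r)" using Suc.prems(1) by simp
  then have "take (length us) r = us" using Suc.prems(2) by simp
  then obtain r' where r': "r = us @ r'" by (metis append_take_drop_id)
  with Suc.prems have "r' @ us = us @ r'" "length r' = e * length us" by auto
  with Suc.IH r' show ?case by simp
qed simp

lemma rotate_mult_fixed: "rotate k ws = ws \<Longrightarrow> rotate (k * a) ws = ws"
  by (induction a) (simp_all add: rotate_rotate[symmetric])

text \<open>Multiples of a fixing rotation fix the list, and so does a rotation by the length;
  Bezout's identity combines the two.\<close>

lemma rotate_gcd:
  assumes "0 < k"
  shows "rotate k ws = ws \<longleftrightarrow> rotate (gcd k (length ws)) ws = ws"
proof
  assume r: "rotate k ws = ws"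
  obtain x y where xy: "k * x = length ws * y + gcd k (length ws)"
    using bezout_nat[of k "length ws"] assms by auto
  have "rotate (gcd k (length ws)) ws = rotate ((length ws * y + gcd k (length ws)) mod length ws) ws"
    by (subst rotate_conv_mod) simp
  also have "\<dots> = rotate (k * x) ws" unfolding xy by (rule rotate_conv_mod[symmetric])
  also have "\<dots> = ws" by (rule rotate_mult_fixed[OF r])
  finally show "rotate (gcd k (length ws)) ws = ws" .
next
  assume "rotate (gcd k (length ws)) ws = ws"
  from rotate_mult_fixed[OF this] show "rotate k ws = ws" by (metis dvd_mult_div_cancel gcd_dvd1)
qed

lemma rotate_fixed_iff:
  assumes "length ws = e * g" "0 < e"
  shows "rotate g ws = ws \<longleftrightarrow> (\<exists>us. length us = g \<and> ws = concat (replicate e us))"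
proof
  assume r: "rotate g ws = ws"
  have gl: "g \<le> length ws" using assms by simp
  define us r where "us = take g ws" and "r = drop g ws"
  have ws: "ws = us @ r" and lus: "length us = g" using gl by (simp_all add: us_def r_def)
  have "r @ us = us @ r" using r ws lus rotate_append[of us r] by simp
  moreover have "length r = (e - 1) * length us" using assms lus by (simp add: r_def diff_mult_distrib)
  ultimately have "r = concat (replicate (e - 1) us)" by (rule commuting_replicate)
  then have "ws = concat (replicate (Suc (e - 1)) us)" using ws by simp
  then show "\<exists>us. length us = g \<and> ws = concat (replicate e us)" using lus assms(2) by auto
next
  assume "\<exists>us. length us = g \<and> ws = concat (replicate e us)"
  then obtain us where us: "length us = g" "ws = concat (replicate e us)" by blast
  then have "ws = us @ concat (replicate (e - 1) us)" using assms(2) by (cases e) auto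
  then show "rotate g ws = ws" using us(1) rotate_append[of us] concat_replicate_comm by metis
qed

text \<open>\<open>tm\<close> moves the last factor to the front while \<open>rotate\<close> moves
  the first one to the end, so \<open>k\<close> becomes \<open>Suc n - k\<close>.\<close>

lemma tm_pow_rotate:
  assumes "length ws = Suc n" "k \<le> n"
  shows "(tm ^^ k) (bas ws) = scal ((- 1) ^ (n * k)) (bas (rotate (Suc n - k) ws) :: 'a list \<Rightarrow>\<^sub>0 'k::field)"
proof -
  let ?p = "take (Suc n - k) ws" and ?q = "drop (Suc n - k) ws"
  have "rotate (Suc n - k) ws = ?q @ ?p"
    using assms rotate_append[of ?p ?q] by simp
  then show ?thesis using tm_pow[of ?q ?p, where 'k = 'k] assms by simp
qed

section \<open>Counting irreducible words\<close>

lemma irr_Cons3: "irr (x # b # z # q) \<longleftrightarrow> \<not> (x = Gen_d \<and> z = Gen_u) \<and> irr (b # z # q)"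
  by (auto simp: irr_def)

lemma irr_u: "irr (Gen_u # w) \<longleftrightarrow> irr w"
  by (cases w; cases "tl w") (auto simp: irr_Cons3 irr_def)

text \<open>After \<open>d d\<close> a letter \<open>u\<close> would complete a forbidden subword,
  and a further \<open>d\<close> recreates the same situation.\<close>

lemma irr_dd: "irr (Gen_d # Gen_d # r) \<longleftrightarrow> r = replicate (length r) Gen_d"
proof (induction r)
  case Nil then show ?case by (simp add: irr_def)
next
  case (Cons x r)
  then show ?case by (cases x) (auto simp: irr_Cons3)
qed

lemma irr_du: "irr (Gen_d # Gen_u # r) \<longleftrightarrow> irr r \<and> (r = [] \<or> hd r = Gen_d)"
  by (cases r) (auto simp: irr_Cons3 irr_u gen_neq, simp add: irr_def)

definition iw :: "nat \<Rightarrow> gen list set" where "iw l = {w. irr w \<and> length w = l}"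

text \<open>The irreducible words are \<open>u^i (d u)^j d^k\<close>; these are the ones with
  \<open>i = 0\<close>.\<close>

definition idw :: "nat \<Rightarrow> gen list set" where "idw l = {w \<in> iw l. w = [] \<or> hd w = Gen_d}"

lemma finite_iw: "finite (iw l)"
  by (rule finite_subset[OF _ finite_words[of l]]) (auto simp: iw_def)

lemma finite_idw: "finite (idw l)"
  by (rule finite_subset[OF _ finite_iw[of l]]) (auto simp: idw_def)

lemma card_idw: "card (idw 0) = 1" "card (idw 1) = 1" "card (idw (l + 2)) = card (idw l) + 1"
proof -
  have "idw 0 = {[]}" by (auto simp: idw_def iw_def)
  then show "card (idw 0) = 1" by simp
  have "idw 1 = {[Gen_d]}" by (auto simp: idw_def iw_def length_Suc_conv)
  then show "card (idw 1) = 1" by simp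
  have eq: "idw (l + 2) = insert (replicate (l + 2) Gen_d) ((\<lambda>w. Gen_d # Gen_u # w) ` idw l)"
  proof (intro equalityI subsetI)
    fix w assume w: "w \<in> idw (l + 2)"
    then obtain y r where yr: "w = Gen_d # y # r" "length r = l"
      by (auto simp: idw_def iw_def length_Suc_conv)
    show "w \<in> insert (replicate (l + 2) Gen_d) ((\<lambda>w. Gen_d # Gen_u # w) ` idw l)"
      using w yr by (cases y) (auto simp: idw_def iw_def irr_dd irr_du)
  next
    fix w assume "w \<in> insert (replicate (l + 2) Gen_d) ((\<lambda>w. Gen_d # Gen_u # w) ` idw l)"
    then show "w \<in> idw (l + 2)" by (auto simp: idw_def iw_def irr_dd irr_du)
  qed
  have "replicate (l + 2) Gen_d \<notin> (\<lambda>w. Gen_d # Gen_u # w) ` idw l" by auto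
  then show "card (idw (l + 2)) = card (idw l) + 1"
    unfolding eq using finite_idw[of l] by (simp add: card_image inj_on_def)
qed

lemma card_iw: "card (iw 0) = 1" "card (iw (Suc l)) = card (iw l) + card (idw (Suc l))"
proof -
  have "iw 0 = {[]}" by (auto simp: iw_def)
  then show "card (iw 0) = 1" by simp
  have "iw (Suc l) = (#) Gen_u ` iw l \<union> idw (Suc l)"
  proof (intro equalityI subsetI)
    fix w assume w: "w \<in> iw (Suc l)"
    then obtain x r where "w = x # r" by (cases w) (auto simp: iw_def)
    with w show "w \<in> (#) Gen_u ` iw l \<union> idw (Suc l)" by (cases x) (auto simp: iw_def idw_def irr_u)
  qed (auto simp: iw_def idw_def irr_u)
  moreover have "(#) Gen_u ` iw l \<inter> idw (Suc l) = {}" by (auto simp: idw_def)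
  ultimately show "card (iw (Suc l)) = card (iw l) + card (idw (Suc l))"
    by (simp add: card_Un_disjoint finite_iw finite_idw card_image inj_on_def)
qed

definition Hs :: "rat fps" where "Hs = Abs_fps (\<lambda>l. of_nat (card (iw l)))"

lemma fps_1_X_nth: "((1 - fps_X) * f) $ n = f $ n - (if n = 0 then 0 else f $ (n - 1))" for f :: "rat fps"
  by (simp add: left_diff_distrib)

text \<open>The three parts of \<open>u^i (d u)^j d^k\<close> contribute the factors 1/(1 - t), 1/(1
  - t^2) and 1/(1 - t) to the Hilbert series.\<close>

lemma Hs_inverse: "(1 - fps_X) ^ 2 * (1 - fps_X ^ 2) * Hs = 1"
proof -
  let ?B = "Abs_fps (\<lambda>l. of_nat (card (idw l))) :: rat fps"
  have 1: "(1 - fps_X) * Hs = ?B"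
    by (rule fps_ext) (simp add: fps_1_X_nth Hs_def card_iw card_idw split: nat.split, metis card_iw(2) Suc_pred add_diff_cancel_left' of_nat_add)
  have 2: "((1 - fps_X ^ 2) * ?B) $ n = 1" for n
  proof -
    consider "n = 0" | "n = 1" | l where "n = l + 2" by (metis One_nat_def add_2_eq_Suc' not0_implies_Suc)
    then show ?thesis
      by cases (use card_idw in \<open>simp_all add: left_diff_distrib fps_X_power_mult_nth\<close>)
  qed
  have 3: "(1 - fps_X) * ((1 - fps_X ^ 2) * ?B) = 1"
    by (rule fps_ext) (simp add: fps_1_X_nth 2 del: fps_mult_nth_0)
  show ?thesis using 3 unfolding 1[symmetric] by (simp add: power2_eq_square mult_ac)
qed

section \<open>The logarithm of the Hilbert series\<close>

definition hser :: "rat fps" where "hser = Abs_fps (\<lambda>l. if l = 0 then 0 else of_nat (card (iw l)))"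

lemma hser_nth: "hser $ l = (if l = 0 then 0 else of_nat (card (iw l)))"
  by (simp add: hser_def)

lemma Hs_hser: "Hs = 1 + hser"
  by (rule fps_ext) (simp add: Hs_def hser_def card_iw)

text \<open>With \<open>q\<close> the inverse of \<open>Hs\<close> this is t Hs'/Hs = - t q'/q. The
  two factors 1 - t give 2 in every positive degree, and 1 - t^2 gives 2 more in even
  degrees.\<close>

lemma log_derivative:
  "fps_X * fps_deriv hser * ((1 - fps_X) ^ 2 * (1 - fps_X ^ 2)) = Abs_fps (\<lambda>n. if n = 0 then 0 else if even n then 4 else 2)"
proof -
  let ?q = "(1 - fps_X) ^ 2 * (1 - fps_X ^ 2) :: rat fps"
  let ?G = "Abs_fps (\<lambda>n. if n = 0 then 0 else if even n then 4 else 2) :: rat fps"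
  have G1: "(1 - fps_X ^ 2) * ?G = 2 * fps_X + 4 * fps_X ^ 2"
  proof (rule fps_ext)
    fix n :: nat
    consider "n = 0" | "n = 1" | l where "n = l + 2" by (metis One_nat_def add_2_eq_Suc' not0_implies_Suc)
    then show "((1 - fps_X ^ 2) * ?G) $ n = (2 * fps_X + 4 * fps_X ^ 2) $ n"
      by cases (auto simp: left_diff_distrib fps_X_power_mult_nth numeral_fps_const)
  qed
  have "fps_deriv (?q * Hs) = 0" unfolding Hs_inverse by simp
  then have d: "?q * fps_deriv Hs = - (fps_deriv ?q * Hs)" by (simp add: eq_neg_iff_add_eq_0)
  have dq: "- (fps_X * fps_deriv ?q) = ?G * ?q"
  proof -
    have "?G * ?q = (1 - fps_X) ^ 2 * ((1 - fps_X ^ 2) * ?G)" by (simp add: mult_ac)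
    also have "\<dots> = - (fps_X * fps_deriv ?q)" unfolding G1
      by (simp add: fps_deriv_power power2_eq_square algebra_simps numeral_fps_const[symmetric])
    finally show ?thesis by simp
  qed
  have "fps_X * fps_deriv hser * ?q = fps_X * (?q * fps_deriv Hs)" unfolding Hs_hser by (simp add: mult_ac)
  also have "\<dots> = (- (fps_X * fps_deriv ?q)) * Hs" unfolding d by (simp add: mult_ac)
  also have "\<dots> = ?G * (?q * Hs)" unfolding dq by (simp add: mult_ac)
  finally show ?thesis unfolding Hs_inverse by simp
qed

definition Wset :: "nat \<Rightarrow> nat \<Rightarrow> gen list list set" where
  "Wset g d = {ws. length ws = g \<and> (\<forall>w\<in>set ws. irr w \<and> w \<noteq> []) \<and> (\<Sum>w\<leftarrow>ws. length w) = d}"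

lemma finite_Wset: "finite (Wset g d)"
proof (rule finite_subset)
  show "Wset g d \<subseteq> {ws. set ws \<subseteq> {w. length w \<le> d} \<and> length ws = g}"
  proof
    fix ws assume ws: "ws \<in> Wset g d"
    have "length w \<le> d" if "w \<in> set ws" for w
      using member_le_sum_list[of "length w" "map length ws"] ws that by (auto simp: Wset_def)
    with ws show "ws \<in> {ws. set ws \<subseteq> {w. length w \<le> d} \<and> length ws = g}" by (auto simp: Wset_def)
  qed
  show "finite {ws. set ws \<subseteq> {w :: gen list. length w \<le> d} \<and> length ws = g}"
    by (rule finite_lists_length_eq[OF finite_words])
qed

lemma card_Wset: "of_nat (card (Wset g d)) = (hser ^ g) $ d"
proof (induction g arbitrary: d)
  case 0
  have "Wset 0 d = (if d = 0 then {[]} else {})" by (auto simp: Wset_def)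
  then show ?case by simp
next
  case (Suc g)
  let ?S = "SIGMA l:{..d}. (if l = 0 then {} else iw l) \<times> Wset g (d - l)"
  have "bij_betw (\<lambda>(l, w, ws). w # ws) ?S (Wset (Suc g) d)"
  proof (rule bij_betw_byWitness[where f' = "\<lambda>ws. (length (hd ws), hd ws, tl ws)"])
    show "(\<lambda>(l, w, ws). w # ws) ` ?S \<subseteq> Wset (Suc g) d" by (auto simp: Wset_def iw_def split: if_splits)
    show "(\<lambda>ws. (length (hd ws), hd ws, tl ws)) ` Wset (Suc g) d \<subseteq> ?S"
      by (auto simp: Wset_def iw_def length_Suc_conv)
  qed (auto simp: Wset_def iw_def length_Suc_conv split: if_splits)
  then have "card (Wset (Suc g) d) = card ?S" by (rule bij_betw_same_card[symmetric])
  also have "\<dots> = (\<Sum>l\<le>d. (if l = 0 then 0 else card (iw l)) * card (Wset g (d - l)))"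
    by (subst card_SigmaI) (auto simp: card_cartesian_product finite_iw finite_Wset intro!: sum.cong)
  finally have "of_nat (card (Wset (Suc g) d)) = (\<Sum>l\<le>d. hser $ l * (hser ^ g) $ (d - l))"
    by (auto simp: Suc[symmetric] hser_nth intro!: sum.cong)
  then show ?case by (simp add: fps_mult_nth atLeast0AtMost)
qed

text \<open>The coefficient of \<open>t\<^sup>d\<close> in \<open>log (1 + h)\<close>, computed from its logarithmic derivative.\<close>

lemma log_coeff:
  assumes "0 < d"
  shows "(\<Sum>g=1..d. (- 1) ^ (g - 1) * of_nat (card (Wset g d)) / of_nat g) = ((if even d then 4 else 2) / of_nat d :: rat)"
proof -
  let ?q = "(1 - fps_X) ^ 2 * (1 - fps_X ^ 2) :: rat fps"
  \<comment> \<open>The geometric series for 1/(1 + h), truncated to \<open>d\<close> terms;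
    \<open>hser\<close> has no constant term, so the rest starts in degree \<open>d\<close>.\<close>
  let ?S = "\<Sum>g<d. (- hser) ^ g"
  have qh: "?q * (1 + hser) = 1" using Hs_inverse unfolding Hs_hser .
  have "(1 - (- hser)) * ?S = 1 - (- hser) ^ d" by (rule one_diff_power_eq[symmetric])
  then have S: "?S = ?q * (1 - (- hser) ^ d)"
    using qh by (metis (no_types, lifting) diff_minus_eq_add mult.assoc mult.left_neutral)
  have h0: "(- hser) $ 0 = 0" by (simp add: hser_def)
  have z: "((- hser) ^ d * f) $ k = 0" if "k < d" for k f
    using startsby_zero_power_prefix[OF h0, of d] that by (auto simp: fps_mult_nth intro!: sum.neutral)
  \<comment> \<open>In degree \<open>d\<close>, the operator t d/dt multiplies a coefficient by
    \<open>d\<close>, and it takes h^g/g to t h' h^(g-1).\<close>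
  have "of_nat d * ((- 1) ^ (g - 1) * of_nat (card (Wset g d)) / of_nat g) = (fps_X * fps_deriv hser * (- hser) ^ (g - 1)) $ d"
    if g1: "1 \<le> g" for g
  proof -
    obtain k where k: "g = Suc k" using g1 by (cases g) auto
    have "of_nat d * (hser ^ g) $ d = (fps_X * fps_deriv (hser ^ g)) $ d" using assms by (cases d) auto
    also have "fps_X * fps_deriv (hser ^ g) = of_nat g * (fps_X * fps_deriv hser * hser ^ (g - 1))"
      by (simp add: fps_deriv_power fps_of_nat[symmetric] mult_ac)
    finally have "of_nat d * (hser ^ g) $ d = of_nat g * (fps_X * fps_deriv hser * hser ^ (g - 1)) $ d"
      by (simp add: fps_of_nat[symmetric])
    moreover have pw: "(- hser) ^ (g - 1) = fps_const ((- 1) ^ (g - 1)) * hser ^ (g - 1)"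
      by (metis fps_const_1_eq_1 fps_const_neg fps_const_power mult_minus1 power_mult_distrib)
    have "(fps_X * fps_deriv hser * (- hser) ^ (g - 1)) $ d = (- 1) ^ (g - 1) * (fps_X * fps_deriv hser * hser ^ (g - 1)) $ d"
      unfolding pw mult.left_commute[of "fps_X * fps_deriv hser" "fps_const _"] by (rule fps_mult_left_const_nth)
    moreover define A where "A = (fps_X * fps_deriv hser * hser ^ (g - 1)) $ d"
    ultimately show ?thesis using g1 unfolding card_Wset A_def[symmetric] by (simp add: field_simps)
  qed
  then have "of_nat d * (\<Sum>g=1..d. (- 1) ^ (g - 1) * of_nat (card (Wset g d)) / of_nat g)
    = (\<Sum>g=1..d. (fps_X * fps_deriv hser * (- hser) ^ (g - 1)) $ d)"
    unfolding sum_distrib_left by (intro sum.cong) auto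
  also have "\<dots> = (\<Sum>g<d. (fps_X * fps_deriv hser * (- hser) ^ g) $ d)"
    by (rule sum.reindex_bij_witness[of _ Suc "\<lambda>g. g - 1"]) auto
  also have "\<dots> = (fps_X * fps_deriv hser * ?S) $ d" by (simp add: sum_distrib_left fps_sum_nth)
  also have "\<dots> = (fps_X * fps_deriv hser * ?q) $ d - (fps_X * ((- hser) ^ d * (fps_deriv hser * ?q))) $ d"
    unfolding S by (simp add: algebra_simps)
  \<comment> \<open>The additional factor \<open>fps_X\<close> pushes the truncation error beyond
    degree \<open>d\<close>.\<close>
  also have "(fps_X * ((- hser) ^ d * (fps_deriv hser * ?q))) $ d = 0"
    using z[of "d - 1"] assms by simp
  finally show ?thesis using assms unfolding log_derivative by (simp add: field_simps)
qed

section \<open>The Euler characteristic of cyclic homology\<close>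

context down_up_algebra
begin

text \<open>A fixed list is the \<open>e\<close>-fold repetition of its first \<open>g\<close>
  words, so the weight \<open>m\<close> has to be \<open>e\<close> times that of the block.\<close>

lemma card_fixed:
  assumes "0 < k" "L = Suc n"
  shows "card {ws \<in> Sm True m n. rotate k ws = ws}
    = (let g = gcd k L; e = L div g in if e dvd m then card (Wset g (m div e)) else 0)"
proof -
  define g e where "g = gcd k L" and "e = L div g"
  have L: "L = e * g" and g: "0 < g" using assms by (simp_all add: g_def e_def)
  have e: "0 < e" using L assms by (cases e) auto
  have fixed: "rotate k ws = ws \<longleftrightarrow> (\<exists>us. length us = g \<and> ws = concat (replicate e us))" if "length ws = L" for ws :: "gen list list"
  proof -
    have "rotate k ws = ws \<longleftrightarrow> rotate g ws = ws" using rotate_gcd[OF assms(1), of ws] unfolding that g_def .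
    also have "\<dots> \<longleftrightarrow> (\<exists>us. length us = g \<and> ws = concat (replicate e us))"
      by (rule rotate_fixed_iff[OF trans[OF that L] e])
    finally show ?thesis .
  qed
  have sum: "(\<Sum>w\<leftarrow>concat (replicate e us). length w) = e * (\<Sum>w\<leftarrow>us. length w)" for us :: "gen list list"
    by (induction e) auto
  have len: "length (concat (replicate e us)) = e * length us" for us :: "gen list list" by (induction e) auto
  have "{ws \<in> Sm True m n. rotate k ws = ws} = (\<lambda>us. concat (replicate e us)) ` {us. us \<in> Wset g (m div e) \<and> e dvd m}"
  proof (intro equalityI subsetI)
    fix ws assume ws: "ws \<in> {ws \<in> Sm True m n. rotate k ws = ws}"
    then obtain us where us: "length us = g" "ws = concat (replicate e us)" using fixed assms(2) by (auto simp: Sm_def)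
    have "m = e * (\<Sum>w\<leftarrow>us. length w)" using ws us sum by (auto simp: Sm_def)
    then show "ws \<in> (\<lambda>us. concat (replicate e us)) ` {us. us \<in> Wset g (m div e) \<and> e dvd m}"
      using ws us e by (auto simp: Sm_def Wset_def)
  next
    fix ws assume "ws \<in> (\<lambda>us. concat (replicate e us)) ` {us. us \<in> Wset g (m div e) \<and> e dvd m}"
    then obtain us where us: "ws = concat (replicate e us)" "us \<in> Wset g (m div e)" "e dvd m" by auto
    then have "length ws = L" using L len by (simp add: Wset_def)
    moreover have "(\<Sum>w\<leftarrow>ws. length w) = m" using us sum by (auto simp: Wset_def)
    ultimately show "ws \<in> {ws \<in> Sm True m n. rotate k ws = ws}"
      using us fixed[of ws] assms(2) by (auto simp: Sm_def Wset_def)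
  qed
  moreover have "inj_on (\<lambda>us. concat (replicate e us)) {us. us \<in> Wset g (m div e) \<and> e dvd m}"
  proof (rule inj_onI)
    fix us vs :: "gen list list"
    assume "us \<in> {us. us \<in> Wset g (m div e) \<and> e dvd m}" "vs \<in> {us. us \<in> Wset g (m div e) \<and> e dvd m}"
      and eq: "concat (replicate e us) = concat (replicate e vs)"
    then have "length us = length vs" by (auto simp: Wset_def)
    obtain e' where "e = Suc e'" using e by (cases e) auto
    with eq \<open>length us = length vs\<close> show "us = vs" by simp
  qed
  ultimately show ?thesis by (simp add: card_image Let_def g_def[symmetric] e_def[symmetric])
qed

text \<open>The invariants are the image of the averaging projection \<open>P\<close>. Its trace
  counts, rotation by rotation, the fixed lists with the sign of the rotation.\<close>

lemma dim_K:
  assumes "0 < m"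
  shows "int (Suc n) * int (free_vs.dim (cyclic_cx.K (\<lambda>n. spn (Sm True m n) :: (gen list list \<Rightarrow>\<^sub>0 'k) set) tm n))
    = (\<Sum>k\<in>{0<..Suc n}. (- 1) ^ (n * k) * int (card {ws \<in> Sm True m n. rotate k ws = ws}))"
proof -
  interpret I: cyclic_cx "\<lambda>n. spn (Sm True m n) :: (gen list list \<Rightarrow>\<^sub>0 'k) set" tm dm bpm Wm m
    by (rule cyclic_cx_Sm[OF assms])
  let ?V = "spn (Sm True m n) :: (gen list list \<Rightarrow>\<^sub>0 'k) set"
  let ?c = "1 / of_nat (Suc n) :: 'k"
  define P where "P x = scal ?c (I.N n x)" for x
  have lin_P: "lin P" unfolding P_def by (rule lin_scal_fun[OF I.lin_N])
  have PK: "P x \<in> I.K n" if "x \<in> ?V" for x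
    unfolding P_def by (rule free_vs.subspace_scale[OF I.subK I.N_inK[OF that]])
  have Pid: "P y = y" if "y \<in> I.K n" for y
    using that I.N_inv[of y n] by (simp add: P_def I.K_def del: of_nat_Suc)
  have KV: "I.K n \<subseteq> ?V" by (auto simp: I.K_def)
  have im: "P ` ?V = I.K n"
  proof (intro equalityI subsetI)
    show "y \<in> P ` ?V" if "y \<in> I.K n" for y using that Pid[OF that, symmetric] KV by blast
  qed (use PK in blast)
  have "of_nat (free_vs.dim (I.K n)) = (\<Sum>ws\<in>Sm True m n. lookup (P (bas ws)) ws)"
    using trace_idempotent[OF lin_P finite_Sm, of True m n] im KV PK Pid by auto
  also have "\<dots> = (\<Sum>ws\<in>Sm True m n. ?c * (\<Sum>k\<le>n. if rotate (Suc n - k) ws = ws then (- 1) ^ (n * k) else 0))"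
  proof (rule sum.cong[OF refl])
    fix ws assume "ws \<in> Sm True m n"
    then have "length ws = Suc n" by (simp add: Sm_def)
    then show "lookup (P (bas ws)) ws = ?c * (\<Sum>k\<le>n. if rotate (Suc n - k) ws = ws then (- 1) ^ (n * k) else 0)"
      unfolding P_def I.N_def lookup_scal lookup_sum
      by (intro arg_cong[where f = "\<lambda>x. ?c * x"] sum.cong refl)
        (simp add: tm_pow_rotate lookup_single when_def)
  qed
  finally have "of_nat (Suc n) * of_nat (free_vs.dim (I.K n))
    = (\<Sum>ws\<in>Sm True m n. \<Sum>k\<le>n. if rotate (Suc n - k) ws = ws then (- 1 :: 'k) ^ (n * k) else 0)"
    by (simp add: sum_distrib_left[symmetric] sum_divide_distrib[symmetric] del: of_nat_Suc)
  also have "\<dots> = (\<Sum>k\<le>n. \<Sum>ws\<in>Sm True m n. if rotate (Suc n - k) ws = ws then (- 1) ^ (n * k) else 0)"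
    by (rule sum.swap)
  also have "\<dots> = (\<Sum>k\<le>n. (- 1) ^ (n * k) * of_nat (card {ws \<in> Sm True m n. rotate (Suc n - k) ws = ws}))"
    by (intro sum.cong refl) (simp add: sum.If_cases finite_Sm Int_def mult.commute)
  also have "\<dots> = (\<Sum>k\<in>{0<..Suc n}. (- 1) ^ (n * k) * of_nat (card {ws \<in> Sm True m n. rotate k ws = ws}))"
  proof (rule sum.reindex_bij_witness[of _ "\<lambda>k. Suc n - k" "\<lambda>k. Suc n - k"])
    fix k assume "k \<in> {..n}"
    then have "even (n * (Suc n - k)) \<longleftrightarrow> even (n * k)" by (auto simp: Suc_diff_le)
    then have "(- 1 :: 'k) ^ (n * (Suc n - k)) = (- 1) ^ (n * k)" by (simp only: minus_one_power_iff)
    then show "(- 1) ^ (n * (Suc n - k)) * of_nat (card {ws \<in> Sm True m n. rotate (Suc n - k) ws = ws}) =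
      (- 1 :: 'k) ^ (n * k) * of_nat (card {ws \<in> Sm True m n. rotate (Suc n - k) ws = ws})" by simp
  qed auto
  \<comment> \<open>The count holds in \<open>'k\<close> and descends to the integers by
    characteristic 0.\<close>
  finally have "(of_int (int (Suc n) * int (free_vs.dim (I.K n))) :: 'k)
    = of_int (\<Sum>k\<in>{0<..Suc n}. (- 1) ^ (n * k) * int (card {ws \<in> Sm True m n. rotate k ws = ws}))"
    by simp
  then show ?thesis by (simp only: of_int_eq_iff)
qed

text \<open>The sign of the Euler characteristic and that of the rotation combine into one that
  depends on the gcd alone, and it is the sign of the corresponding term in log(1 + h).\<close>

lemma sign_gcd: assumes "0 < L" shows "(- 1) ^ (L - 1) * (- 1) ^ ((L - 1) * k) = ((- 1) ^ (gcd k L - 1) :: rat)"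
proof -
  have "0 < gcd k L" using assms by simp
  have "even (gcd k L) \<longleftrightarrow> even k \<and> even L" by simp
  then have "even ((L - 1) + (L - 1) * k) \<longleftrightarrow> even (gcd k L - 1)"
    using assms \<open>0 < gcd k L\<close> by (cases "even L") (auto simp: even_diff_nat)
  then have "(- 1 :: rat) ^ ((L - 1) + (L - 1) * k) = (- 1) ^ (gcd k L - 1)" by (simp only: minus_one_power_iff)
  then show ?thesis by (simp only: power_add)
qed

lemma euler_K:
  assumes m: "0 < m"
  shows "(\<Sum>n<m. (- 1) ^ n * of_nat (free_vs.dim (cyclic_cx.K (\<lambda>n. spn (Sm True m n) :: (gen list list \<Rightarrow>\<^sub>0 'k) set) tm n)))
    = (if even m then 3 else 2 :: rat)"
proof -
  let ?K = "\<lambda>n. free_vs.dim (cyclic_cx.K (\<lambda>n. spn (Sm True m n) :: (gen list list \<Rightarrow>\<^sub>0 'k) set) tm n)"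
  define W where "W g e = (if e dvd m then rat_of_nat (card (Wset g (m div e))) else 0)" for g e
  have KL: "(- 1) ^ (L - 1) * of_nat (?K (L - 1)) = (\<Sum>g | g dvd L. of_nat (totient (L div g)) * ((- 1) ^ (g - 1) * W g (L div g)) / of_nat L)"
    if L: "0 < L" for L
  proof -
    obtain n where n: "L = Suc n" using L by (cases L) auto
    have "rat_of_int (int L * int (?K n)) = of_int (\<Sum>k\<in>{0<..L}. (- 1) ^ (n * k) * int (card {ws \<in> Sm True m n. rotate k ws = ws}))"
      using dim_K[OF m, of n] unfolding n by (simp only:)
    then have "of_nat L * of_nat (?K n) = (\<Sum>k\<in>{0<..L}. (- 1) ^ (n * k) * rat_of_nat (card {ws \<in> Sm True m n. rotate k ws = ws}))"
      by simp
    also have "\<dots> = (\<Sum>k\<in>{0<..L}. (- 1) ^ (n * k) * W (gcd k L) (L div gcd k L))"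
    proof (intro sum.cong refl)
      fix k assume "k \<in> {0<..L}"
      then show "(- 1) ^ (n * k) * rat_of_nat (card {ws \<in> Sm True m n. rotate k ws = ws}) = (- 1) ^ (n * k) * W (gcd k L) (L div gcd k L)"
        by (subst card_fixed[OF _ n]) (auto simp: W_def Let_def)
    qed
    finally have "(- 1) ^ n * (of_nat L * of_nat (?K n)) = (\<Sum>k\<in>{0<..L}. (- 1) ^ n * ((- 1) ^ (n * k) * W (gcd k L) (L div gcd k L)))"
      by (simp add: sum_distrib_left)
    also have "\<dots> = (\<Sum>k\<in>{0<..L}. (- 1) ^ (gcd k L - 1) * W (gcd k L) (L div gcd k L))"
      using sign_gcd[OF L] n by (intro sum.cong refl) (simp add: mult.assoc[symmetric])
    also have "\<dots> = (\<Sum>g | g dvd L. \<Sum>k | k \<in> {0<..L} \<and> gcd k L = g. (- 1) ^ (gcd k L - 1) * W (gcd k L) (L div gcd k L))"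
      by (rule sum.group[symmetric]) (use L in auto)
    also have "\<dots> = (\<Sum>g | g dvd L. of_nat (totient (L div g)) * ((- 1) ^ (g - 1) * W g (L div g)))"
    proof (intro sum.cong refl)
      fix g assume "g \<in> {g. g dvd L}"
      then have "card {k \<in> {0<..L}. gcd k L = g} = totient (L div g)" using L card_gcd_eq_totient by auto
      then show "(\<Sum>k | k \<in> {0<..L} \<and> gcd k L = g. (- 1) ^ (gcd k L - 1) * W (gcd k L) (L div gcd k L))
        = of_nat (totient (L div g)) * ((- 1) ^ (g - 1) * W g (L div g))" by simp
    qed
    finally show ?thesis using n by (simp add: sum_divide_distrib[symmetric] field_simps del: of_nat_Suc)
  qed
  have mk: "k \<le> m" if "0 < b" "b * k \<le> m" for b k :: nat
    using that by (cases b) auto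
  have "(\<Sum>n<m. (- 1) ^ n * rat_of_nat (?K n)) = (\<Sum>L\<in>{1..m}. (- 1) ^ (L - 1) * of_nat (?K (L - 1)))"
    by (rule sum.reindex_bij_witness[of _ "\<lambda>L. L - 1" Suc]) auto
  also have "\<dots> = (\<Sum>L\<in>{1..m}. \<Sum>g | g dvd L. of_nat (totient (L div g)) * ((- 1) ^ (g - 1) * W g (L div g)) / of_nat L)"
    by (intro sum.cong refl KL) auto
  also have "\<dots> = (\<Sum>(L, g)\<in>(SIGMA L:{1..m}. {g. g dvd L}). of_nat (totient (L div g)) * ((- 1) ^ (g - 1) * W g (L div g)) / of_nat L)"
    by (rule sum.Sigma) auto
  \<comment> \<open>With \<open>L = e * g\<close> the sum runs over the repetition number
    \<open>e\<close> and the block length \<open>g\<close>; the bound \<open>m\<close> on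
    \<open>L\<close> becomes \<open>m div e\<close> for \<open>g\<close>.\<close>
  also have "\<dots> = (\<Sum>(e, g)\<in>(SIGMA e:{1..m}. {1..m div e}). of_nat (totient e) * ((- 1) ^ (g - 1) * W g e) / (of_nat e * of_nat g))"
    by (rule sum.reindex_bij_witness[of _ "\<lambda>(e, g). (e * g, g)" "\<lambda>(L, g). (L div g, g)"])
      (auto simp: less_eq_div_iff_mult_less_eq mult.commute dvd_div_eq_0_iff Suc_le_eq dvd_imp_le intro!: Nat.gr0I elim!: dvdE, erule (1) mk)
  also have "\<dots> = (\<Sum>e\<in>{1..m}. \<Sum>g\<in>{1..m div e}. of_nat (totient e) * ((- 1) ^ (g - 1) * W g e) / (of_nat e * of_nat g))"
    by (rule sum.Sigma[symmetric]) auto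
  \<comment> \<open>For \<open>e\<close> dividing \<open>m\<close> the inner sum is a coefficient of
    the logarithm in degree \<open>m div e\<close>, which is also its upper limit, as
    \<open>log_coeff\<close> demands.\<close>
  also have "\<dots> = (\<Sum>e\<in>{1..m}. if e dvd m then of_nat (totient e) * (if even (m div e) then 4 else 2) / of_nat m else 0)"
  proof (intro sum.cong refl)
    fix e assume e: "e \<in> {1..m}"
    show "(\<Sum>g\<in>{1..m div e}. of_nat (totient e) * ((- 1) ^ (g - 1) * W g e) / (of_nat e * of_nat g))
      = (if e dvd m then of_nat (totient e) * (if even (m div e) then 4 else 2) / of_nat m else 0)"
    proof (cases "e dvd m")
      case True
      then have "0 < m div e" using m e by (auto simp: dvd_div_eq_0_iff)
      have "(\<Sum>g\<in>{1..m div e}. of_nat (totient e) * ((- 1) ^ (g - 1) * W g e) / (of_nat e * of_nat g))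
        = of_nat (totient e) / of_nat e * (\<Sum>g=1..m div e. (- 1) ^ (g - 1) * of_nat (card (Wset g (m div e))) / of_nat g)"
        using True by (simp add: sum_distrib_left W_def mult_ac)
      also have "\<dots> = of_nat (totient e) / of_nat e * ((if even (m div e) then 4 else 2) / of_nat (m div e))"
        unfolding log_coeff[OF \<open>0 < m div e\<close>] ..
      also have "\<dots> = of_nat (totient e) * (if even (m div e) then 4 else 2) / (of_nat (e * (m div e)))" by simp
      also have "e * (m div e) = m" using True by simp
      finally show ?thesis using True by simp
    qed (simp add: W_def)
  qed
  also have "\<dots> = (\<Sum>e | e dvd m. of_nat (totient e) * (if even (m div e) then 4 else 2) / of_nat m)"
    by (rule sum.mono_neutral_cong_right) (use m in \<open>auto simp: dvd_imp_le Suc_le_eq intro!: Nat.gr0I\<close>)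
  \<comment> \<open>The values 4 and 2 are split into a constant 2 and another 2 for even
    \<open>m div e\<close>. By the divisor sum of the totient the first part gives 2; the second
    involves the divisors of m/2 and gives 1 for even \<open>m\<close>.\<close>
  also have "\<dots> = ((\<Sum>e | e dvd m. 2 * of_nat (totient e)) + (\<Sum>e | e dvd m. if even (m div e) then 2 * of_nat (totient e) else 0)) / of_nat m"
    unfolding sum.distrib[symmetric] sum_divide_distrib[symmetric]
    by (intro arg_cong[where f = "\<lambda>x. x / of_nat m"] sum.cong refl) auto
  also have "(\<Sum>e | e dvd m. 2 * of_nat (totient e)) = (2 * of_nat m :: rat)"
    unfolding sum_distrib_left[symmetric] of_nat_sum[symmetric] totient_divisor_sum ..
  also have "(\<Sum>e | e dvd m. if even (m div e) then 2 * of_nat (totient e) else 0) = (if even m then of_nat m else 0 :: rat)"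
  proof (cases "even m")
    case True
    then obtain l where l: "m = 2 * l" by blast
    have "{e. e dvd m \<and> even (m div e)} = {e. e dvd l}"
    proof (intro equalityI subsetI)
      fix e assume "e \<in> {e. e dvd m \<and> even (m div e)}"
      then have "e dvd m" "even (m div e)" by auto
      from this(2) obtain b where "m div e = 2 * b" by (rule evenE)
      then have "m = e * (2 * b)" using \<open>e dvd m\<close> by (metis dvd_mult_div_cancel)
      then have "l = e * b" using l by simp
      then show "e \<in> {e. e dvd l}" by simp
    next
      fix e assume "e \<in> {e. e dvd l}"
      then obtain b where b: "l = e * b" by (auto elim: dvdE)
      then have "m = e * (2 * b)" using l by simp
      moreover have "e \<noteq> 0" using b l m by auto
      ultimately show "e \<in> {e. e dvd m \<and> even (m div e)}" by auto
    qed
    moreover have "(\<Sum>e | e dvd m. if even (m div e) then 2 * rat_of_nat (totient e) else 0)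
      = (\<Sum>e | e dvd m \<and> even (m div e). 2 * of_nat (totient e))"
      using m by (simp add: sum.If_cases Int_def)
    ultimately show ?thesis using l totient_divisor_sum[of l]
      by (simp add: sum_distrib_left[symmetric] of_nat_sum[symmetric])
  next
    case False
    have "odd (m div e)" if "e dvd m" for e using False that by (metis dvd_mult dvd_mult_div_cancel)
    then show ?thesis using False by simp
  qed
  finally show ?thesis using m by (simp add: add_divide_distrib)
qed

lemma euler_cI:
  assumes m: "0 < m"
  shows "rat_of_nat (cI m 0) - of_nat (cI m 1) + of_nat (cI m 2) = (if even m then 3 else 2)"
proof -
  interpret I: cyclic_cx "\<lambda>n. spn (Sm True m n) :: (gen list list \<Rightarrow>\<^sub>0 'k) set" tm dm bpm Wm m
    by (rule cyclic_cx_Sm[OF assms])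
  \<comment> \<open>Homology vanishes from degree 3 on and the chains from \<open>m\<close> on; the
    common range has to contain both.\<close>
  let ?M = "max m 3"
  have big: "spn (Sm True m n) = {0 :: gen list list \<Rightarrow>\<^sub>0 'k}" if "m \<le> n" for n
  proof -
    have "length ws \<le> (\<Sum>w\<leftarrow>ws. length w)" if "\<forall>w\<in>set ws. w \<noteq> []" for ws :: "gen list list"
      using that
    proof (induction ws)
      case (Cons a ws)
      then show ?case by (cases a) auto
    qed simp
    then have "Sm True m n = {}" using that by (fastforce simp: Sm_def)
    then show ?thesis by (simp add: spn_def)
  qed
  have "(\<Sum>n<?M. (- 1) ^ n * int (I.cn n)) = (\<Sum>n<?M. (- 1) ^ n * int (free_vs.dim (I.K n)))"
    by (rule I.euler_cn) (simp add: big)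
  moreover have "(\<Sum>n<?M. (- 1) ^ n * int (I.cn n)) = (\<Sum>n<3. (- 1) ^ n * int (I.cn n))"
    by (rule sum.mono_neutral_right) (use cI_vanish[OF m] in auto)
  moreover have "(\<Sum>n<?M. (- 1) ^ n * int (free_vs.dim (I.K n))) = (\<Sum>n<m. (- 1) ^ n * int (free_vs.dim (I.K n)))"
  proof (rule sum.mono_neutral_right)
    show "\<forall>n\<in>{..<?M} - {..<m}. (- 1) ^ n * int (free_vs.dim (I.K n)) = 0"
    proof
      fix n assume "n \<in> {..<?M} - {..<m}"
      then have "I.K n = {0}" using big[of n] free_vs.subspace_0[OF I.subK, of n] by (auto simp: I.K_def)
      then show "(- 1) ^ n * int (free_vs.dim (I.K n)) = 0" by (simp add: I.dim_zero)
    qed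
  qed auto
  ultimately have "(\<Sum>n<3. (- 1) ^ n * int (I.cn n)) = (\<Sum>n<m. (- 1) ^ n * int (free_vs.dim (I.K n)))" by simp
  then have "rat_of_int (\<Sum>n<3. (- 1) ^ n * int (I.cn n)) = (if even m then 3 else 2)"
    using euler_K[OF m] by simp
  then show ?thesis by (simp add: numeral_3_eq_3 numeral_2_eq_2)
qed

end

lemma quot_dim_subset:
  fixes V W :: "('b \<Rightarrow>\<^sub>0 'k::field) set"
  assumes V: "free_vs.subspace V" and W: "free_vs.subspace W" and "V \<subseteq> W"
  shows "quot_dim V W = 0"
proof -
  let ?L = "\<lambda>_ :: 'b \<Rightarrow>\<^sub>0 'k. 0 :: 'b \<Rightarrow>\<^sub>0 'k"
  have "?L ` V = {0}" using free_vs.subspace_0[OF V] by auto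
  then have "quot_dim V W + free_vs.dim {0 :: 'b \<Rightarrow>\<^sub>0 'k} = free_vs.dim {0 :: 'b \<Rightarrow>\<^sub>0 'k}"
    using assms by (intro quot_dim_transfer[where L = ?L]) (auto simp: linI fd_def)
  then show ?thesis by simp
qed

lemma in_column_bas [simp]: "in_column p (Poly_Mapping.single xs c) = Poly_Mapping.single (p, xs) c"
  by (simp add: in_column_def)

lemma lin_in_column: "lin (in_column p)"
  unfolding in_column_def by (rule lin_lin_ext)

lemmas in_column_simps = lin_simps[OF lin_in_column]

text \<open>The norm as one linear map for all lengths at once, since the columns of a total chain
  consist of tensors of different lengths.\<close>

definition NNm :: "('a list \<Rightarrow>\<^sub>0 'k::field) \<Rightarrow> ('a list \<Rightarrow>\<^sub>0 'k)" where "NNm = lin_ext cyclic_norm"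

lemma lin_NNm: "lin NNm" unfolding NNm_def by (rule lin_lin_ext)

lemma NNm_eq:
  assumes "x \<in> spn {xs. length xs = l}"
  shows "NNm x = (\<Sum>k<l. (tm ^^ k) x)"
  by (rule lin_spn_eqI[OF assms lin_NNm lin_sum_fun[OF lin_funpow[OF lin_tm]]])
    (auto simp: NNm_def cyclic_norm_def tm_def)

context down_up_algebra
begin

section \<open>Tensors over the algebra and their coordinates\<close>

definition tens :: "'k free_alg set list \<Rightarrow> (gen list list \<Rightarrow>\<^sub>0 'k)" where
  "tens xs = prod_list (map (\<lambda>a. iota (kap a)) xs)"

lemma tens_simps [simp]: "tens [] = bas []" "tens (a # xs) = iota (kap a) * tens xs" "tens (xs @ ys) = tens xs * tens ys"
  by (simp_all add: tens_def one_eq_bas)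

text \<open>The coordinate map of the formal tensor powers; \<open>Ps\<close> below lifts basis
  tensors back to lists of classes.\<close>

definition Ph :: "('k free_alg set list \<Rightarrow>\<^sub>0 'k) \<Rightarrow> (gen list list \<Rightarrow>\<^sub>0 'k)" where "Ph = lin_ext tens"

lemma lin_Ph: "lin Ph" unfolding Ph_def by (rule lin_lin_ext)

lemmas Ph_simps = lin_simps[OF lin_Ph]

lemma Ph_bas [simp]: "Ph (Poly_Mapping.single xs c) = scal c (tens xs)" by (simp add: Ph_def)

lemma Ph_mult: "Ph (x * y) = Ph x * Ph y"
proof -
  have "Ph (bas p * y) = Ph (bas p) * Ph y" for p
    by (rule lin_eqI[OF lin_comp[OF lin_Ph lin_mult_left[OF lin_id]] lin_mult_left[OF lin_Ph]]) simp
  then show ?thesis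
    by (rule lin_eqI[OF lin_comp[OF lin_Ph lin_mult_right[OF lin_id]] lin_mult_right[OF lin_Ph]])
qed

definition Ps :: "(gen list list \<Rightarrow>\<^sub>0 'k) \<Rightarrow> ('k free_alg set list \<Rightarrow>\<^sub>0 'k)" where
  "Ps = lin_ext (\<lambda>ws. bas (map (\<lambda>w. cls (bas w)) ws))"

lemma lin_Ps: "lin Ps" unfolding Ps_def by (rule lin_lin_ext)

lemmas Ps_simps = lin_simps[OF lin_Ps]

lemma Ps_bas [simp]: "Ps (Poly_Mapping.single ws c) = Poly_Mapping.single (map (\<lambda>w. cls (bas w)) ws) c"
  by (simp add: Ps_def)

lemma Ps_mult: "Ps (x * y) = Ps x * Ps y"
proof -
  have "Ps (bas p * y) = Ps (bas p) * Ps y" for p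
    by (rule lin_eqI[OF lin_comp[OF lin_Ps lin_mult_left[OF lin_id]] lin_mult_left[OF lin_Ps]]) simp
  then show ?thesis
    by (rule lin_eqI[OF lin_comp[OF lin_Ps lin_mult_right[OF lin_id]] lin_mult_right[OF lin_Ps]])
qed

abbreviation "tS \<equiv> free_vs.span (tensor_rels dA)"

text \<open>The entry type also contains sets that are no elements of the algebra; multilinearity
  relations exist only for lists over the carrier.\<close>

definition CA :: "'k free_alg set list set" where "CA = {xs. set xs \<subseteq> carrier dA}"

lemma Ph_tS: "x \<in> tS \<Longrightarrow> Ph x = 0"
proof -
  have "tensor_rels dA \<subseteq> {x. Ph x = 0}"
  proof
    fix r assume "r \<in> tensor_rels dA"
    then consider xs a b ys where "r = bas (xs @ (a \<oplus>\<^bsub>dA\<^esub> b) # ys) - bas (xs @ a # ys) - bas (xs @ b # ys)"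
        "a \<in> carrier dA" "b \<in> carrier dA"
      | xs c a ys where "r = bas (xs @ (c \<odot>\<^bsub>dA\<^esub> a) # ys) - Poly_Mapping.single (xs @ a # ys) c" "a \<in> carrier dA"
      unfolding tensor_rels_def by blast
    then show "r \<in> {x. Ph x = 0}"
    proof cases
      case 1
      then show ?thesis by (simp add: Ph_simps kap_simps iota_simps distrib_left distrib_right)
    next
      case 2
      then show ?thesis by (simp add: Ph_simps kap_simps(3) iota_simps scal_mult)
    qed
  qed
  then have "tS \<subseteq> {x. Ph x = 0}"
    by (rule free_vs.span_minimal) (auto simp: free_vs.subspace_def Ph_simps)
  then show "x \<in> tS \<Longrightarrow> Ph x = 0" by auto
qed

text \<open>The vectors \<open>y\<close> for which one slot can be expanded modulo multilinearity
  form a subspace containing all words.\<close>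

lemma slot_expand:
  assumes "ps \<in> CA" "qs \<in> CA"
  shows "bas (ps @ cls y # qs) - bas ps * Ps (iota y) * bas qs \<in> tS"
proof -
  let ?P = "{y. bas (ps @ cls y # qs) - bas ps * Ps (iota y) * bas qs \<in> tS}"
  have pq: "set ps \<subseteq> carrier dA" "set qs \<subseteq> carrier dA" using assms by (auto simp: CA_def)
  have "free_vs.subspace ?P"
  proof (unfold free_vs.subspace_def, intro conjI ballI allI CollectI; (elim CollectE)?)
    \<comment> \<open>The relation for the scalar 0 says that a list with a zero entry is 0 modulo
      multilinearity.\<close>
    have "bas (ps @ (0 \<odot>\<^bsub>dA\<^esub> cls 0) # qs) - Poly_Mapping.single (ps @ cls 0 # qs) 0 \<in> tensor_rels dA"
      using pq cls_in unfolding tensor_rels_def by blast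
    then have "bas (ps @ cls 0 # qs) \<in> tS" using free_vs.span_base by (simp add: smult_dA) blast
    then show "bas (ps @ cls 0 # qs) - bas ps * Ps (iota 0) * bas qs \<in> tS" by (simp add: iota_simps Ps_simps)
  next
    fix x y
    assume h: "bas (ps @ cls x # qs) - bas ps * Ps (iota x) * bas qs \<in> tS"
      "bas (ps @ cls y # qs) - bas ps * Ps (iota y) * bas qs \<in> tS"
    have "bas (ps @ (cls x \<oplus>\<^bsub>dA\<^esub> cls y) # qs) - bas (ps @ cls x # qs) - bas (ps @ cls y # qs) \<in> tensor_rels dA"
      using pq cls_in unfolding tensor_rels_def by blast
    then have "bas (ps @ cls (x + y) # qs) - bas (ps @ cls x # qs) - bas (ps @ cls y # qs) \<in> tS"
      unfolding add_dA by (rule free_vs.span_base)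
    from free_vs.span_add[OF free_vs.span_add[OF this h(1)] h(2)]
    show "bas (ps @ cls (x + y) # qs) - bas ps * Ps (iota (x + y)) * bas qs \<in> tS"
      by (simp add: iota_simps Ps_simps algebra_simps)
  next
    fix c x
    assume h: "bas (ps @ cls x # qs) - bas ps * Ps (iota x) * bas qs \<in> tS"
    have "bas (ps @ (c \<odot>\<^bsub>dA\<^esub> cls x) # qs) - Poly_Mapping.single (ps @ cls x # qs) c \<in> tensor_rels dA"
      using pq cls_in unfolding tensor_rels_def by blast
    then have "bas (ps @ cls (scal c x) # qs) - scal c (bas (ps @ cls x # qs)) \<in> tS"
      unfolding smult_dA by (simp add: free_vs.span_base)
    from free_vs.span_add[OF this free_vs.span_scale[OF h, of c]]
    show "bas (ps @ cls (scal c x) # qs) - bas ps * Ps (iota (scal c x)) * bas qs \<in> tS"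
      by (simp add: iota_simps Ps_simps scal_mult free_vs.scale_right_diff_distrib)
  qed
  moreover have "bas w \<in> ?P" for w by (simp add: free_vs.span_zero)
  ultimately have "y \<in> ?P" using lin_spnI[OF lin_id, of y UNIV ?P] by (simp add: spn_def)
  then show ?thesis by simp
qed

text \<open>The slots are expanded from the left. The prefix \<open>ps\<close> is arbitrary, because
  the induction hypothesis is needed behind every basis word of the slot just expanded.\<close>

lemma tens_expand:
  "xs \<in> CA \<Longrightarrow> ps \<in> CA \<Longrightarrow> bas (ps @ xs) - bas ps * Ps (tens xs) \<in> tS"
proof (induction xs arbitrary: ps)
  case (Cons a xs)
  have a: "cls (kap a) = a" and xs: "xs \<in> CA" using Cons.prems by (auto simp: CA_def cls_kap)
  have 1: "bas (ps @ a # xs) - bas ps * Ps (iota (kap a)) * bas xs \<in> tS"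
    using slot_expand[OF Cons.prems(2) xs, of "kap a"] a by simp
  have "bas ps * z * (bas xs - Ps (tens xs)) \<in> tS" if z: "z \<in> spn {[c] | c. c \<in> carrier dA}" for z
  proof (rule lin_spnI[OF _ z, of "\<lambda>z. bas ps * z * (bas xs - Ps (tens xs))"])
    show "lin (\<lambda>z. bas ps * z * (bas xs - Ps (tens xs)))" by (rule lin_mult_right[OF lin_mult_left[OF lin_id]])
    show "free_vs.subspace tS" by simp
    fix b assume "b \<in> {[c] | c. c \<in> carrier dA}"
    then obtain c where c: "b = [c]" "c \<in> carrier dA" by blast
    then have "ps @ [c] \<in> CA" using Cons.prems by (auto simp: CA_def)
    from Cons.IH[OF xs this] show "bas ps * bas b * (bas xs - Ps (tens xs)) \<in> tS"
      unfolding c by (simp add: right_diff_distrib)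
  qed
  moreover have "Ps (iota (kap a)) \<in> spn {[c] | c. c \<in> carrier dA}"
    by (rule lin_spnI[OF lin_comp[OF lin_Ps lin_iota], of _ UNIV], simp add: spn_def) auto
  ultimately have "bas ps * Ps (iota (kap a)) * (bas xs - Ps (tens xs)) \<in> tS" by blast
  from free_vs.span_add[OF 1 this] show ?case
    by (simp add: Ps_mult algebra_simps)
qed (simp add: free_vs.span_zero)

lemma Ps_Ph: "x \<in> spn CA \<Longrightarrow> x - Ps (Ph x) \<in> tS"
proof (rule lin_spnI[where f = "\<lambda>x. x - Ps (Ph x)"])
  show "lin (\<lambda>x. x - Ps (Ph x))" by (rule lin_minus_fun[OF lin_id lin_comp[OF lin_Ps lin_Ph]])
  fix xs assume "xs \<in> CA"
  then show "bas xs - Ps (Ph (bas xs)) \<in> tS" using tens_expand[of xs "[]"]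
    by (simp add: CA_def one_eq_bas[symmetric] del: single_one)
qed auto

text \<open>Relations evaluate to 0, and conversely \<open>Ps_Ph\<close> recovers \<open>x\<close>
  from its coordinates; so the formal tensor power has the lists of irreducible words as a
  basis.\<close>

lemma in_tS_iff: "x \<in> spn CA \<Longrightarrow> x \<in> tS \<longleftrightarrow> Ph x = 0"
  using Ph_tS Ps_Ph[of x] by (auto simp: Ps_simps)

lemma Ph_Ps: "y \<in> spn {ws. \<forall>w\<in>set ws. irr w} \<Longrightarrow> Ph (Ps y) = y"
proof (rule lin_spn_eqI[OF _ lin_comp[OF lin_Ph lin_Ps] lin_id])
  fix ws :: "gen list list" assume "ws \<in> {ws. \<forall>w\<in>set ws. irr w}"
  then show "Ph (Ps (bas ws)) = bas ws" by (induction ws) (auto simp: nf_irr)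
qed

lemma Sm_irr: "Sm c m n \<subseteq> {ws. \<forall>w\<in>set ws. irr w}" by (auto simp: Sm_def)

lemma homog_CA: "homog_tensors dG m n \<subseteq> CA"
  by (auto simp: homog_tensors_def CA_def list_all2_conv_all_nth in_set_conv_nth dG_iff)

lemma tens_homog: "xs \<in> homog_tensors dG m n \<Longrightarrow> tens xs \<in> spn (Sm False m n)"
proof -
  have *: "tens xs \<in> spn {ws. length ws = length xs \<and> (\<forall>w\<in>set ws. irr w) \<and> (\<Sum>w\<leftarrow>ws. length w) = sum_list ds}"
    if "list_all2 (\<lambda>x d. x \<in> dG d) xs ds" for xs ds
    using that
  proof (induction rule: list_all2_induct)
    case (Cons x xs d ds)
    have "iota (kap x) \<in> spn ((\<lambda>w. [w]) ` NWl d)" using Cons(1) by (intro iota_in) (simp add: dG_iff)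
    then show ?case unfolding tens_simps by (rule spn_mult[OF _ Cons(3)]) (auto simp: NWl_def)
  qed simp
  assume "xs \<in> homog_tensors dG m n"
  then obtain ds where ds: "length xs = n + 1" "list_all2 (\<lambda>x d. x \<in> dG d) xs ds" "sum_list ds = m"
    by (auto simp: homog_tensors_def)
  show "tens xs \<in> spn (Sm False m n)"
    using *[OF ds(2)] unfolding ds by (rule subsetD[OF spn_mono, rotated]) (auto simp: Sm_def)
qed

lemma map_cls_homog: "ws \<in> Sm False m n \<Longrightarrow> map (\<lambda>w. cls (bas w)) ws \<in> homog_tensors dG m n"
proof -
  have "list_all2 (\<lambda>x d. x \<in> dG d) (map (\<lambda>w. cls (bas w)) ws) (map length ws)" if "\<forall>w\<in>set ws. irr w" for ws :: "gen list list"
    using that by (induction ws) (auto simp: dG_iff nf_irr NWl_def)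
  then show "ws \<in> Sm False m n \<Longrightarrow> map (\<lambda>w. cls (bas w)) ws \<in> homog_tensors dG m n"
    unfolding homog_tensors_def Sm_def by (auto intro!: exI[of _ "map length ws"])
qed

lemma Ph_homog: "x \<in> spn (homog_tensors dG m n) \<Longrightarrow> Ph x \<in> spn (Sm False m n)"
  by (rule lin_spnI[OF lin_Ph]) (auto simp: tens_homog)

lemma Ps_homog: "y \<in> spn (Sm False m n) \<Longrightarrow> Ps y \<in> spn (homog_tensors dG m n)"
  by (rule lin_spnI[OF lin_Ps]) (auto simp: map_cls_homog)

lemma Ph_Ps_Sm: "y \<in> spn (Sm c m n) \<Longrightarrow> Ph (Ps y) = y"
  by (rule Ph_Ps) (use spn_mono[OF Sm_irr] in blast)

section \<open>The differentials in coordinates\<close>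

definition muA :: "'k free_alg set \<Rightarrow> 'k free_alg set \<Rightarrow> ('k free_alg set list \<Rightarrow>\<^sub>0 'k)" where
  "muA a b = bas [a \<otimes>\<^bsub>dA\<^esub> b]"

lemma bar_bd_gbar: "bar_bd dA xs = gbar muA xs"
  unfolding bar_bd_def gbar_sum muA_def by simp

text \<open>The recursion of \<open>gbar\<close>, extended linearly from words to arbitrary elements
  in the first two factors, one factor at a time.\<close>

lemma bpm_iota: "bpm (iota u * (iota v * z)) = iota (NF (u * v)) * z - iota u * bpm (iota v * z)"
proof -
  have 1: "bpm (bas [a] * (bas [b] * z)) = mu a b * z - bas [a] * bpm (bas [b] * z)" for a b z
    by (rule lin_eqI[OF lin_comp[OF lin_bpm lin_mult_left[OF lin_mult_left[OF lin_id]]]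
          lin_minus_fun[OF lin_mult_left[OF lin_id] lin_mult_left[OF lin_comp[OF lin_bpm lin_mult_left[OF lin_id]]]]]) simp
  have 2: "bpm (bas [a] * (iota v * z)) = iota (NF (bas a * v)) * z - bas [a] * bpm (iota v * z)" for a
    by (rule lin_eqI[OF lin_comp[OF lin_bpm lin_mult_left[OF lin_mult_right[OF lin_iota]]]
          lin_minus_fun[OF lin_mult_right[OF lin_comp[OF lin_iota lin_comp[OF lin_NF lin_mult_left[OF lin_id]]]]
            lin_mult_left[OF lin_comp[OF lin_bpm lin_mult_right[OF lin_iota]]]]])
      (simp add: 1 mu_def)
  show ?thesis
    by (rule lin_eqI[OF lin_comp[OF lin_bpm lin_mult_right[OF lin_iota]]
          lin_minus_fun[OF lin_mult_right[OF lin_comp[OF lin_iota lin_comp[OF lin_NF lin_mult_right[OF lin_id]]]]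
            lin_mult_right[OF lin_iota]]])
      (simp add: 2)
qed

lemma dm_iota: "dm (iota u * (iota v * z)) = iota (NF (u * v)) * z"
proof -
  have 1: "dm (bas [a] * (bas [b] * z)) = mu a b * z" for a b z
    by (rule lin_eqI[OF lin_comp[OF lin_dm lin_mult_left[OF lin_mult_left[OF lin_id]]] lin_mult_left[OF lin_id]]) simp
  have 2: "dm (bas [a] * (iota v * z)) = iota (NF (bas a * v)) * z" for a
    by (rule lin_eqI[OF lin_comp[OF lin_dm lin_mult_left[OF lin_mult_right[OF lin_iota]]]
          lin_mult_right[OF lin_comp[OF lin_iota lin_comp[OF lin_NF lin_mult_left[OF lin_id]]]]])
      (simp add: 1 mu_def)
  show ?thesis
    by (rule lin_eqI[OF lin_comp[OF lin_dm lin_mult_right[OF lin_iota]]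
          lin_mult_right[OF lin_comp[OF lin_iota lin_comp[OF lin_NF lin_mult_right[OF lin_id]]]]])
      (simp add: 2)
qed

lemma bpm_iota_single: "bpm (iota u) = 0"
  by (rule lin_eqI[OF lin_comp[OF lin_bpm lin_iota], of "\<lambda>_. 0"]) (auto simp: linI)

lemma dm_iota_single: "dm (iota u) = 0"
  by (rule lin_eqI[OF lin_comp[OF lin_dm lin_iota], of "\<lambda>_. 0"]) (auto simp: linI)

lemma Ph_bar: "xs \<in> CA \<Longrightarrow> Ph (bar_bd dA xs) = bpm (tens xs)"
  unfolding bar_bd_gbar
proof (induction xs rule: induct_list012)
  case 1 then show ?case by (simp add: Ph_simps)
next
  case (2 x) then show ?case by (simp add: Ph_simps bpm_iota_single one_eq_bas[symmetric] del: single_one)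
next
  case (3 x y q)
  have "Ph (gbar muA (y # q)) = bpm (tens (y # q))" using 3 by (auto simp: CA_def)
  moreover have "Ph (muA x y * bas q) = iota (NF (kap x * kap y)) * tens q"
    using 3(3) by (simp add: muA_def kap_simps CA_def)
  ultimately show ?case
    by (simp add: Ph_simps Ph_mult[of "bas [x]"] bpm_iota one_eq_bas[symmetric] del: single_one)
qed

lemma tens_length: "tens xs \<in> spn {ws. length ws = length xs}"
proof (induction xs)
  case (Cons x xs)
  have "iota (kap x) \<in> spn ((\<lambda>w. [w]) ` UNIV)" by (rule iota_in) (simp add: spn_def)
  then show ?case unfolding tens_simps by (rule spn_mult[OF _ Cons]) auto
qed simp

lemma tm_iota: "y \<in> spn {ws. length ws = l} \<Longrightarrow> tm (y * iota u) = scal ((- 1) ^ l) (iota u * y)"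
proof -
  have 1: "tm (bas ws * iota u) = scal ((- 1) ^ length ws) (iota u * bas ws)" for ws
    by (rule lin_eqI[OF lin_comp[OF lin_tm lin_mult_left[OF lin_iota]] lin_scal_fun[OF lin_mult_right[OF lin_iota]]])
      (simp add: tm_snoc)
  show "y \<in> spn {ws. length ws = l} \<Longrightarrow> tm (y * iota u) = scal ((- 1) ^ l) (iota u * y)"
    by (rule lin_spn_eqI[OF _ lin_comp[OF lin_tm lin_mult_right[OF lin_id]] lin_scal_fun[OF lin_mult_left[OF lin_id]], of _ "{ws. length ws = l}"])
      (auto simp: 1)
qed

lemma tens_tm: "xs \<noteq> [] \<Longrightarrow> Ph (tm (bas xs)) = tm (tens xs)"
proof -
  assume "xs \<noteq> []"
  then obtain p a where p: "xs = p @ [a]" by (metis rev_exhaust)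
  show ?thesis using tm_iota[OF tens_length[of p], of "kap a"]
    by (simp add: p tm_snoc one_eq_bas[symmetric] del: single_one)
qed

lemma Ph_hochschild:
  assumes "xs \<in> CA"
  shows "Ph (hochschild_bd dA xs) = bm (tens xs)"
proof -
  consider "xs = []" | x where "xs = [x]" | x q z where "xs = x # q @ [z]"
    by (metis list.exhaust rev_exhaust)
  then show ?thesis
  proof cases
    case 1
    then show ?thesis by (simp add: hochschild_bd_def bar_bd_def Ph_simps bm_def tm_def cyclic_op_def)
  next
    case (2 x)
    have "tm (iota (kap x)) = iota (kap x)"
    proof -
      have "tm (bas [] * iota (kap x)) = scal ((- 1) ^ 0) (iota (kap x) * bas [])" by (rule tm_iota) simp
      then show ?thesis by (simp add: one_eq_bas[symmetric] del: single_one)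
    qed
    then show ?thesis using 2 Ph_bar[OF assms]
      by (simp add: hochschild_bd_def Ph_simps bm_def dm_iota_single one_eq_bas[symmetric] del: single_one)
  next
    case (3 x q z)
    have xz: "x \<in> carrier dA" "z \<in> carrier dA" using assms 3 by (auto simp: CA_def)
    have "tm (tens xs) = scal ((- 1) ^ Suc (length q)) (iota (kap z) * (iota (kap x) * tens q))"
      using tm_iota[OF tens_length[of "x # q"], of "kap z"] 3
      by (simp add: one_eq_bas[symmetric] mult.assoc del: single_one)
    then have "dm (tm (tens xs)) = scal ((- 1) ^ Suc (length q)) (iota (NF (kap z * kap x)) * tens q)"
      by (simp only: dm_simps dm_iota)
    moreover have "hochschild_bd dA xs = bar_bd dA xs + Poly_Mapping.single ((z \<otimes>\<^bsub>dA\<^esub> x) # q) ((- 1) ^ Suc (length q))"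
      using 3 by (simp add: hochschild_bd_def)
    ultimately show ?thesis by (simp add: Ph_simps Ph_bar[OF assms] bm_def kap_simps xz)
  qed
qed

lemma gbar_CA: "xs \<in> CA \<Longrightarrow> gbar muA xs \<in> spn CA"
proof (induction xs rule: induct_list012)
  case (3 x y q)
  have "bas [x] * gbar muA (y # q) \<in> spn CA"
    by (rule spn_mult[of _ "{[x]}" _ CA], simp, rule 3(2)) (use 3(3) in \<open>auto simp: CA_def\<close>)
  moreover have "muA x y * bas q \<in> spn CA" using 3(3) by (simp add: muA_def CA_def kap_simps)
  ultimately show ?case by (simp add: free_vs.subspace_diff[OF subspace_spn])
qed (simp_all add: free_vs.subspace_0[OF subspace_spn])

lemma hochschild_CA: assumes "xs \<in> CA" shows "hochschild_bd dA xs \<in> spn CA"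
proof -
  have "Poly_Mapping.single ((last xs \<otimes>\<^bsub>dA\<^esub> hd xs) # butlast (tl xs)) ((- 1) ^ (length xs - 1)) \<in> spn CA"
    if "\<not> length xs \<le> 1"
  proof -
    have ne: "xs \<noteq> []" using that by auto
    have "last xs \<in> carrier dA" "hd xs \<in> carrier dA" using assms last_in_set[OF ne] hd_in_set[OF ne] by (auto simp: CA_def)
    moreover have "set (butlast (tl xs)) \<subseteq> carrier dA"
    proof
      fix y assume "y \<in> set (butlast (tl xs))"
      then have "y \<in> set (tl xs)" by (rule in_set_butlastD)
      then have "y \<in> set xs" by (rule list.set_sel(2)[OF ne])
      then show "y \<in> carrier dA" using assms by (auto simp: CA_def)
    qed
    ultimately show ?thesis by (auto simp: spn_def CA_def kap_simps)
  qed
  then show ?thesis unfolding hochschild_bd_def bar_bd_gbar using gbar_CA[OF assms]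
    by (auto intro!: free_vs.subspace_add[OF subspace_spn] simp: free_vs.subspace_0[OF subspace_spn])
qed

definition "bA = lin_ext (hochschild_bd dA)"

lemma lin_bA: "lin bA" unfolding bA_def by (rule lin_lin_ext)

lemma bA: assumes "x \<in> spn CA" shows "Ph (bA x) = bm (Ph x)" "bA x \<in> spn CA"
proof -
  show "Ph (bA x) = bm (Ph x)"
    by (rule lin_spn_eqI[OF assms lin_comp[OF lin_Ph lin_bA] lin_comp[OF lin_bm lin_Ph]])
      (simp add: bA_def Ph_hochschild)
  show "bA x \<in> spn CA" by (rule lin_spnI[OF lin_bA assms subspace_spn]) (simp add: bA_def hochschild_CA)
qed

text \<open>This is \<open>quot_dim_transfer\<close> along \<open>Ph\<close>. That \<open>bm\<close>
  squares to 0 is left to the caller, since \<open>bm_bm\<close> is about positive \<open>m\<close>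
  and degree 0 is treated on its own.\<close>

lemma HH_dim_model:
  assumes bb: "\<And>x. x \<in> spn (Sm False m (Suc n)) \<Longrightarrow> bm (bm x) = 0"
  shows "HH_dim dA dG n m + free_vs.dim (bm ` spn (Sm False m (Suc n))) = free_vs.dim {x \<in> spn (Sm False m n). bm x = 0}"
proof -
  let ?C = "\<lambda>n. spn (homog_tensors dG m n) :: ('k free_alg set list \<Rightarrow>\<^sub>0 'k) set"
  have sub: "?C n \<subseteq> spn CA" for n by (rule spn_mono[OF homog_CA])
  have Wdec: "free_vs.span (bA ` ?C (Suc n) \<union> tS) = {x + y | x y. x \<in> bA ` ?C (Suc n) \<and> y \<in> tS}"
    using lin_imageI[OF lin_bA subspace_spn, of "homog_tensors dG m (Suc n)"] unfolding free_vs.span_Un free_vs.span_span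
    by (simp only: free_vs.span_eq_iff[THEN iffD2])
  have "quot_dim {x \<in> ?C n. bA x \<in> tS} (free_vs.span (bA ` ?C (Suc n) \<union> tS)) + free_vs.dim (bm ` spn (Sm False m (Suc n)))
    = free_vs.dim {x \<in> spn (Sm False m n). bm x = 0}"
  proof (rule quot_dim_transfer[OF lin_Ph])
    show "free_vs.subspace {x \<in> ?C n. bA x \<in> tS}" by (rule lin_preimageI[OF lin_bA]) auto
    show "free_vs.subspace (free_vs.span (bA ` ?C (Suc n) \<union> tS))" by simp
    show "fd {x \<in> spn (Sm False m n). bm x = 0}"
      by (rule fd_mono[OF fd_spn[OF finite_Sm] lin_kernelI[OF lin_bm subspace_spn]]) auto
    show "free_vs.subspace (bm ` spn (Sm False m (Suc n)))" by (rule lin_imageI[OF lin_bm subspace_spn])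
    show "bm ` spn (Sm False m (Suc n)) \<subseteq> {x \<in> spn (Sm False m n). bm x = 0}" using bb bm_Sm by auto
    have cyc: "bA x \<in> tS \<longleftrightarrow> bm (Ph x) = 0" if "x \<in> ?C n" for x
    proof -
      have xC: "x \<in> spn CA" using that sub by blast
      show ?thesis unfolding in_tS_iff[OF bA(2)[OF xC]] bA(1)[OF xC] ..
    qed
    show "Ph ` {x \<in> ?C n. bA x \<in> tS} = {x \<in> spn (Sm False m n). bm x = 0}"
    proof (intro equalityI subsetI)
      fix y assume "y \<in> {x \<in> spn (Sm False m n). bm x = 0}"
      then have y: "y \<in> spn (Sm False m n)" "bm y = 0" by auto
      have "Ps y \<in> {x \<in> ?C n. bA x \<in> tS}" using cyc[OF Ps_homog[OF y(1)]] Ps_homog[OF y(1)] y(2) Ph_Ps_Sm[OF y(1)] by simp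
      then show "y \<in> Ph ` {x \<in> ?C n. bA x \<in> tS}" by (rule image_eqI[where f = Ph, OF Ph_Ps_Sm[OF y(1), symmetric]])
    next
      fix y assume "y \<in> Ph ` {x \<in> ?C n. bA x \<in> tS}"
      then obtain x where "y = Ph x" "x \<in> ?C n" "bA x \<in> tS" by blast
      then show "y \<in> {x \<in> spn (Sm False m n). bm x = 0}" using cyc Ph_homog by blast
    qed
    fix x assume "x \<in> {x \<in> ?C n. bA x \<in> tS}"
    then have x: "x \<in> ?C n" by simp
    show "x \<in> free_vs.span (bA ` ?C (Suc n) \<union> tS) \<longleftrightarrow> Ph x \<in> bm ` spn (Sm False m (Suc n))"
    proof
      assume "x \<in> free_vs.span (bA ` ?C (Suc n) \<union> tS)"
      then obtain c s where cs: "x = bA c + s" "c \<in> ?C (Suc n)" "s \<in> tS" unfolding Wdec by blast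
      have "Ph x = bm (Ph c)"
        unfolding cs(1) Ph_simps(1) Ph_tS[OF cs(3)] bA(1)[OF subsetD[OF sub cs(2)]] by simp
      then show "Ph x \<in> bm ` spn (Sm False m (Suc n))" using Ph_homog[OF cs(2)] by simp
    next
      assume "Ph x \<in> bm ` spn (Sm False m (Suc n))"
      then obtain y where y: "Ph x = bm y" "y \<in> spn (Sm False m (Suc n))" by blast
      have P: "Ps y \<in> ?C (Suc n)" by (rule Ps_homog[OF y(2)])
      have "Ph (bA (Ps y)) = bm y" using bA(1)[OF subsetD[OF sub P]] Ph_Ps_Sm[OF y(2)] by simp
      then have "Ph (x - bA (Ps y)) = 0" using y(1) by (simp add: Ph_simps)
      moreover have "x - bA (Ps y) \<in> spn CA"
        using free_vs.subspace_diff[OF subspace_spn subsetD[OF sub x] bA(2)[OF subsetD[OF sub P]]] .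
      ultimately have "x - bA (Ps y) \<in> tS" using in_tS_iff by blast
      moreover have "x = bA (Ps y) + (x - bA (Ps y))" by simp
      ultimately show "x \<in> free_vs.span (bA ` ?C (Suc n) \<union> tS)" unfolding Wdec using P by blast
    qed
  qed
  then show ?thesis unfolding HH_dim_def homology_dim_def span_bas bA_def[symmetric] .
qed

lemma HH_dim_pos:
  assumes "0 < m"
  shows "HH_dim dA dG n m = cI m n + (if n = 0 then 0 else cI m (n - 1))"
proof -
  have "bm (bm x) = 0" if "x \<in> spn (Sm False m (Suc n))" for x by (rule bm_bm[OF assms that])
  from HH_dim_model[where m = m and n = n, OF this] show ?thesis using hochschild_dim_A[OF assms, of n] cA_cI[OF assms] by simp
qed

section \<open>Hochschild homology in degree 0\<close>

lemma Sm_zero: "Sm False 0 n = {replicate (Suc n) []}"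
proof (intro equalityI subsetI)
  have *: "ws = replicate (length ws) []" if "(\<Sum>w\<leftarrow>ws. length w) = 0" for ws :: "gen list list"
    using that by (induction ws) auto
  fix ws assume "ws \<in> Sm False 0 n"
  then have "length ws = Suc n" "(\<Sum>w\<leftarrow>ws. length w) = 0" by (simp_all add: Sm_def)
  with *[of ws] show "ws \<in> {replicate (Suc n) []}" by (simp only: singleton_iff)
next
  fix ws :: "gen list list" assume "ws \<in> {replicate (Suc n) []}"
  then show "ws \<in> Sm False 0 n" by (simp add: Sm_def sum_list_replicate)
qed

text \<open>All faces of a tensor of units coincide, so their alternating signs either cancel or
  leave one of them.\<close>

lemma bm_replicate: "bm (bas (replicate (Suc n) [])) = (if even n \<and> 0 < n then bas (replicate n []) else 0)"
proof -
  have g: "gbar mu (replicate (Suc n) []) = (if odd n then bas (replicate n []) else 0)" for n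
    by (induction n) (auto simp: mu_unit one_eq_bas[symmetric] simp del: single_one)
  show ?thesis
  proof (cases n)
    case 0 then show ?thesis using bm_single[of "[]"] by simp
  next
    case (Suc k)
    have "replicate (Suc n) [] = [] # replicate k [] @ [[] :: gen list]" using Suc by (simp add: replicate_append_same)
    then have "bm (bas (replicate (Suc n) [])) = gbar mu (replicate (Suc n) []) + scal ((- 1) ^ Suc k) (mu [] [] * bas (replicate k []))"
      using bm_snoc[of "[]" "replicate k []" "[]"] by simp
    then show ?thesis unfolding g using Suc by (auto simp: mu_unit single_add[symmetric])
  qed
qed

text \<open>In degree 0 the algebra is the ground field. For positive \<open>n\<close> every tensor
  of units is degenerate, so \<open>Dn_exact\<close> yields exactness.\<close>

lemma HH_dim_zero: "HH_dim dA dG n 0 = (if n = 0 then 1 else 0)"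
proof -
  have bb: "bm (bm x) = 0" if "x \<in> spn (Sm False 0 (Suc n))" for x n
  proof (rule lin_spn_eqI[OF that lin_comp[OF lin_bm lin_bm], of "\<lambda>_. 0"])
    fix ws assume "ws \<in> Sm False 0 (Suc n)"
    then have ws: "ws = replicate (Suc (Suc n)) []" by (simp only: Sm_zero singleton_iff)
    show "bm (bm (bas ws)) = 0" unfolding ws bm_replicate[of "Suc n"] using bm_replicate[of n]
      by (auto simp: bm_simps simp del: replicate_Suc)
  qed (simp add: linI)
  note H = HH_dim_model[where m = 0 and n = n, OF bb]
  show ?thesis
  proof (cases n)
    case 0
    have "bm x = 0" if "x \<in> spn (Sm False 0 1)" for x
    proof (rule lin_spn_eqI[OF that lin_bm, of "\<lambda>_. 0"])
      fix ws assume "ws \<in> Sm False 0 1"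
      then have "ws = replicate (Suc 1) []" by (simp only: Sm_zero singleton_iff)
      then show "bm (bas ws) = 0" using bm_replicate[of 1] by simp
    qed (simp add: linI)
    then have "bm ` spn (Sm False 0 (Suc 0)) = {0}" using free_vs.subspace_0[OF subspace_spn] by fastforce
    moreover have "{x \<in> spn (Sm False 0 0). bm x = 0} = spn (Sm False 0 0)" using bm_Nn_0 by blast
    moreover have "free_vs.dim {0 :: gen list list \<Rightarrow>\<^sub>0 'k} = 0"
      using dim_spn[of "{} :: gen list list set", where 'k = 'k] by (simp add: spn_def)
    moreover have "free_vs.dim (spn (Sm False 0 0) :: (gen list list \<Rightarrow>\<^sub>0 'k) set) = 1"
    proof -
      have "free_vs.dim (spn (Sm False 0 0) :: (gen list list \<Rightarrow>\<^sub>0 'k) set) = card (Sm False 0 0)"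
        by (rule dim_spn[OF finite_Sm])
      also have "\<dots> = 1" unfolding Sm_zero by simp
      finally show ?thesis .
    qed
    ultimately show ?thesis using H 0 by simp
  next
    case (Suc k)
    have "Dn 0 i = Sm False 0 i" if "0 < i" for i using that by (cases i) (auto simp: Dn_def Sm_zero)
    then have D: "Dn 0 n = Sm False 0 n" "Dn 0 (Suc n) = Sm False 0 (Suc n)" using Suc by auto
    have "{x \<in> spn (Sm False 0 n). bm x = 0} = bm ` spn (Sm False 0 (Suc n))"
      using Dn_exact[of _ 0 n] bb bm_Sm unfolding D by fastforce
    then show ?thesis using H Suc by simp
  qed
qed

end

context down_up_algebra
begin

section \<open>Reduced cyclic homology in coordinates\<close>

text \<open>Reading off the columns separately turns a total chain into the kind of family treated
  in \<open>total_chase\<close>.\<close>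

definition col :: "nat \<Rightarrow> (nat \<times> 'k free_alg set list \<Rightarrow>\<^sub>0 'k) \<Rightarrow> (gen list list \<Rightarrow>\<^sub>0 'k)" where
  "col p = lin_ext (\<lambda>(p', xs). if p' = p then tens xs else 0)"

lemma lin_col: "lin (col p)" unfolding col_def by (rule lin_lin_ext)

lemmas col_simps = lin_simps[OF lin_col]

lemma col_bas: "col p (bas (p', xs)) = (if p' = p then tens xs else 0)" by (simp add: col_def)

lemma col_in_column: "col p (in_column p' x) = (if p' = p then Ph x else 0)"
proof (cases "p' = p")
  case True
  have "col p (in_column p' x) = Ph x"
    by (rule lin_eqI[OF lin_comp[OF lin_col lin_in_column] lin_Ph]) (simp add: col_def True)
  then show ?thesis using True by simp
next
  case False
  have "col p (in_column p' x) = 0"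
    by (rule lin_eqI[OF lin_comp[OF lin_col lin_in_column], of "\<lambda>_. 0"]) (simp_all add: col_def False linI)
  then show ?thesis using False by simp
qed

definition "relS = free_vs.span ((\<Union>p. in_column p ` tensor_rels dA)
          \<union> {Poly_Mapping.single (p, replicate (q + 1) \<one>\<^bsub>dA\<^esub>) (1 :: 'k) | p q. True})"

lemma subspace_relS [simp]: "free_vs.subspace relS" by (simp add: relS_def)

lemma relS_one: "bas (p, replicate (q + 1) \<one>\<^bsub>dA\<^esub>) \<in> relS"
  unfolding relS_def by (rule free_vs.span_base) blast

definition "Z0 = {ws :: gen list list. (\<Sum>w\<leftarrow>ws. length w) = 0}"

text \<open>Multilinearity relations have coordinates 0 and tensors of units have weight 0. Dividing
  by the ground field is therefore invisible in positive degree.\<close>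

lemma col_relS: assumes "x \<in> relS" shows "col p x \<in> spn Z0"
proof -
  have "((\<Union>p. in_column p ` tensor_rels dA) \<union> {Poly_Mapping.single (p, replicate (q + 1) \<one>\<^bsub>dA\<^esub>) (1 :: 'k) | p q. True})
      \<subseteq> {x. col p x \<in> spn Z0}"
  proof
    fix x :: "nat \<times> 'k free_alg set list \<Rightarrow>\<^sub>0 'k"
    assume "x \<in> (\<Union>p. in_column p ` tensor_rels dA) \<union> {Poly_Mapping.single (p, replicate (q + 1) \<one>\<^bsub>dA\<^esub>) 1 | p q. True}"
    then consider p' r where "x = in_column p' r" "r \<in> tensor_rels dA"
      | p' q where "x = bas (p', replicate (q + 1) \<one>\<^bsub>dA\<^esub>)" by blast
    then show "x \<in> {x. col p x \<in> spn Z0}"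
    proof cases
      case 1
      have "Ph r = 0" by (rule Ph_tS[OF free_vs.span_base[OF 1(2)]])
      then show ?thesis unfolding 1(1) by (simp add: col_in_column free_vs.subspace_0[OF subspace_spn])
    next
      case 2
      have "tens (replicate k \<one>\<^bsub>dA\<^esub>) = bas (replicate k [])" for k
        by (induction k) (simp_all add: kap_one)
      then have "tens (replicate (q + 1) \<one>\<^bsub>dA\<^esub>) \<in> spn Z0" by (simp only: bas_in_spn) (simp add: Z0_def sum_list_replicate)
      moreover have "0 \<in> (spn Z0 :: (gen list list \<Rightarrow>\<^sub>0 'k) set)" by (rule free_vs.subspace_0[OF subspace_spn])
      ultimately show ?thesis unfolding 2 mem_Collect_eq col_bas by presburger
    qed
  qed
  then have "relS \<subseteq> {x. col p x \<in> spn Z0}" unfolding relS_def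
    by (rule free_vs.span_minimal) (auto simp: free_vs.subspace_def col_simps free_vs.subspace_0[OF subspace_spn]
        intro: free_vs.subspace_add[OF subspace_spn] free_vs.subspace_scale[OF subspace_spn])
  then show ?thesis using assms by blast
qed

lemma tS_relS: assumes "x \<in> tS" shows "in_column p x \<in> relS"
proof -
  have "in_column p x \<in> in_column p ` tS" using assms by blast
  also have "in_column p ` tS = free_vs.span (in_column p ` tensor_rels dA)"
    by (rule module_hom.span_image[symmetric]) (use lin_in_column in \<open>simp add: linear_iff_module_hom\<close>)
  also have "\<dots> \<subseteq> relS" unfolding relS_def by (rule free_vs.span_mono) blast
  finally show ?thesis .
qed

definition CAc :: "nat \<Rightarrow> (nat \<times> 'k free_alg set list) set" where
  "CAc M = {(p, xs). p \<le> M \<and> xs \<in> CA}"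

text \<open>Modulo multilinearity \<open>x\<close> is rebuilt from its columns through
  \<open>Ps\<close>; the bound \<open>M\<close> makes this a finite sum.\<close>

lemma col_zero_relS:
  assumes "x \<in> spn (CAc M)" "\<And>p. col p x = 0"
  shows "x \<in> relS"
proof -
  have "x - (\<Sum>p\<le>M. in_column p (Ps (col p x))) \<in> relS"
  proof (rule lin_spnI[OF _ assms(1), of "\<lambda>x. x - (\<Sum>p\<le>M. in_column p (Ps (col p x)))"])
    show "lin (\<lambda>x. x - (\<Sum>p\<le>M. in_column p (Ps (col p x))))"
      by (rule lin_minus_fun[OF lin_id lin_sum_fun[OF lin_comp[OF lin_in_column lin_comp[OF lin_Ps lin_col]]]])
    show "free_vs.subspace relS" by simp
    fix pxs assume "pxs \<in> CAc M"
    then obtain p xs where pxs: "pxs = (p, xs)" "p \<le> M" "xs \<in> CA" by (auto simp: CAc_def)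
    have "(\<Sum>p'\<le>M. in_column p' (Ps (col p' (bas (p, xs))))) = (\<Sum>p'\<le>M. if p' = p then in_column p (Ps (tens xs)) else 0)"
      by (rule sum.cong) (auto simp: col_bas Ps_simps in_column_simps)
    also have "\<dots> = in_column p (Ps (tens xs))" using pxs(2) by simp
    finally have "bas pxs - (\<Sum>p'\<le>M. in_column p' (Ps (col p' (bas pxs)))) = in_column p (bas xs - Ps (tens xs))"
      by (simp add: pxs(1) in_column_simps)
    also have "\<dots> \<in> relS" using Ps_Ph[of "bas xs"] pxs(3) by (intro tS_relS) simp
    finally show "bas pxs - (\<Sum>p\<le>M. in_column p (Ps (col p (bas pxs)))) \<in> relS" .
  qed
  then show ?thesis by (simp add: assms(2) Ps_simps in_column_simps)
qed

definition cb where "cb = lin_ext (cyclic_bd dA)"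

lemma lin_cb: "lin cb" unfolding cb_def by (rule lin_lin_ext)

definition dc where "dc p x = (if even p then bm x else - bpm x)" for p :: nat
definition rc :: "nat \<Rightarrow> (gen list list \<Rightarrow>\<^sub>0 'k) \<Rightarrow> (gen list list \<Rightarrow>\<^sub>0 'k)" where
  "rc p x = (if odd p then x - tm x else NNm x)"

lemma lin_dc: "lin (dc p)"
  unfolding dc_def using lin_bm lin_scal_fun[OF lin_bpm, of "- 1"] by (cases "even p") (simp_all add: free_vs.scale_minus_left)

lemma lin_rc: "lin (rc p)"
  unfolding rc_def using lin_NNm lin_minus_fun[OF lin_id lin_tm] by (cases "odd p") simp_all

lemma Ph_tm_pow: "xs \<noteq> [] \<Longrightarrow> Ph ((tm ^^ k) (bas xs :: 'k free_alg set list \<Rightarrow>\<^sub>0 'k)) = (tm ^^ k) (tens xs)"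
proof (induction k)
  case (Suc k)
  have "(tm ^^ k) (bas xs :: 'k free_alg set list \<Rightarrow>\<^sub>0 'k) \<in> spn {xs. xs \<noteq> []}"
  proof (induction k)
    case (Suc k)
    have "tm (bas ys :: 'k free_alg set list \<Rightarrow>\<^sub>0 'k) \<in> spn {xs. xs \<noteq> []}" if "ys \<noteq> []" for ys :: "'k free_alg set list"
      by (simp add: tm_def cyclic_op_def spn_def)
    then show ?case using lin_spnI[OF lin_tm Suc subspace_spn] by simp
  qed (use Suc in simp)
  moreover have "Ph (tm y) = tm (Ph y)" if "y \<in> spn {xs. xs \<noteq> []}" for y
    by (rule lin_spn_eqI[OF that lin_comp[OF lin_Ph lin_tm] lin_comp[OF lin_tm lin_Ph]]) (simp add: tens_tm)
  ultimately show ?case using Suc by simp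
qed simp

lemma Ph_rc:
  assumes "xs \<noteq> []"
  shows "Ph (if odd p then bas xs - cyclic_op xs else cyclic_norm xs) = rc p (tens xs)"
proof (cases "odd p")
  case True
  have "Ph (cyclic_op xs) = tm (tens xs)" using tens_tm[OF assms] by (simp add: tm_def)
  then show ?thesis using True by (simp add: rc_def Ph_simps)
next
  case False
  have "Ph (cyclic_norm xs) = NNm (tens xs)"
    unfolding NNm_eq[OF tens_length] cyclic_norm_def tm_def[symmetric] Ph_simps
    by (intro sum.cong refl Ph_tm_pow assms)
  then show ?thesis using False by (simp add: rc_def)
qed

lemma col_cb:
  assumes "x \<in> spn {(p, xs). xs \<in> CA \<and> xs \<noteq> []}"
  shows "col p (cb x) = dc p (col p x) + rc (Suc p) (col (Suc p) x)"
proof (rule lin_spn_eqI[OF assms lin_comp[OF lin_col lin_cb]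
      lin_plus[OF lin_comp[OF lin_dc lin_col] lin_comp[OF lin_rc lin_col]]])
  fix pxs assume "pxs \<in> {(p :: nat, xs). xs \<in> CA \<and> xs \<noteq> []}"
  then obtain p' xs where pxs: "pxs = (p', xs)" "xs \<in> CA" "xs \<noteq> []" by auto
  define D where "D = (if even p' then hochschild_bd dA xs else - bar_bd dA xs)"
  define R where "R = (if odd p' then bas xs - cyclic_op xs else cyclic_norm xs :: 'k free_alg set list \<Rightarrow>\<^sub>0 'k)"
  have d: "Ph D = dc p' (tens xs)"
    using Ph_hochschild[OF pxs(2)] Ph_bar[OF pxs(2)] by (simp add: D_def dc_def Ph_simps)
  have r: "Ph R = rc p' (tens xs)" unfolding R_def by (rule Ph_rc[OF pxs(3)])
  have "cb (bas pxs) = in_column p' D + (if p' = 0 then 0 else in_column (p' - 1) R)"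
    unfolding D_def R_def by (simp add: cb_def cyclic_bd_def pxs(1) split del: if_split)
  then have "col p (cb (bas pxs)) = (if p' = p then dc p' (tens xs) else 0) + (if p' = Suc p then rc p' (tens xs) else 0)"
    by (cases "p' = 0") (auto simp: col_simps col_in_column d r)
  then show "col p (cb (bas pxs)) = dc p (col p (bas pxs)) + rc (Suc p) (col (Suc p) (bas pxs))"
    by (auto simp: pxs(1) col_bas lin_0[OF lin_dc] lin_0[OF lin_rc])
qed

definition Cc :: "nat \<Rightarrow> nat \<Rightarrow> (nat \<times> 'k free_alg set list) set" where
  "Cc m n = {(p, xs). p \<le> n \<and> xs \<in> homog_tensors dG m (n - p)}"

lemma Cc_sub: "Cc m n \<subseteq> {(p, xs). xs \<in> CA \<and> xs \<noteq> []}" "Cc m n \<subseteq> CAc n"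
  using homog_CA by (force simp: Cc_def CAc_def homog_tensors_def)+

lemma HC_chain: "free_vs.span {Poly_Mapping.single (p, xs) (1 :: 'k) | p q xs. p + q = n \<and> xs \<in> homog_tensors dG m q} = spn (Cc m n)"
proof -
  have "{Poly_Mapping.single (p, xs) (1 :: 'k) | p q xs. p + q = n \<and> xs \<in> homog_tensors dG m q} = bas ` Cc m n"
  proof (intro equalityI subsetI)
    fix x assume "x \<in> {Poly_Mapping.single (p, xs) (1 :: 'k) | p q xs. p + q = n \<and> xs \<in> homog_tensors dG m q}"
    then show "x \<in> bas ` Cc m n" by (auto simp: Cc_def)
  next
    fix x :: "nat \<times> 'k free_alg set list \<Rightarrow>\<^sub>0 'k" assume "x \<in> bas ` Cc m n"
    then obtain p xs where "x = bas (p, xs)" "p \<le> n" "xs \<in> homog_tensors dG m (n - p)" by (auto simp: Cc_def)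
    then show "x \<in> {Poly_Mapping.single (p, xs) (1 :: 'k) | p q xs. p + q = n \<and> xs \<in> homog_tensors dG m q}"
      by (intro CollectI exI[of _ p] exI[of _ "n - p"] exI[of _ xs]) simp
  qed
  then show ?thesis by (simp only: span_bas)
qed

lemma cb_CAc: assumes "x \<in> spn (Cc m n)" shows "cb x \<in> spn (CAc n)"
proof (rule lin_spnI[OF lin_cb assms subspace_spn])
  fix pxs assume "pxs \<in> Cc m n"
  then have "pxs \<in> {(p, xs). xs \<in> CA \<and> xs \<noteq> []}" "pxs \<in> CAc n"
    using Cc_sub[of m n] by blast+
  then obtain p xs where pxs: "pxs = (p, xs)" "p \<le> n" "xs \<in> CA" "xs \<noteq> []"
    by (auto simp: CAc_def)
  let ?N = "CA \<inter> {xs. xs \<noteq> []}"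
  have ic: "in_column p' y \<in> spn (CAc n)" if "y \<in> spn CA" "p' \<le> n" for p' y
    by (rule lin_spnI[OF lin_in_column that(1) subspace_spn]) (use that(2) in \<open>auto simp: CAc_def\<close>)
  have d: "(if even p then hochschild_bd dA xs else - bar_bd dA xs) \<in> spn CA"
    using hochschild_CA[OF pxs(3)] gbar_CA[OF pxs(3)] by (auto simp: bar_bd_gbar free_vs.subspace_neg[OF subspace_spn])
  have op: "tm y \<in> spn ?N" if "y \<in> spn ?N" for y :: "'k free_alg set list \<Rightarrow>\<^sub>0 'k"
  proof (rule lin_spnI[OF lin_tm that subspace_spn])
    fix ys :: "'k free_alg set list" assume ys: "ys \<in> ?N"
    then show "tm (bas ys) \<in> spn ?N"
      by (cases ys rule: rev_cases) (auto simp: tm_snoc spn_def CA_def)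
  qed
  have xsN: "bas xs \<in> (spn ?N :: ('k free_alg set list \<Rightarrow>\<^sub>0 'k) set)" using pxs by simp
  have pw: "(tm ^^ k) (bas xs) \<in> (spn ?N :: ('k free_alg set list \<Rightarrow>\<^sub>0 'k) set)" for k
    by (induction k) (use xsN op in auto)
  have NC: "(spn ?N :: ('k free_alg set list \<Rightarrow>\<^sub>0 'k) set) \<subseteq> spn CA" by (rule spn_mono) auto
  have "cyclic_norm xs \<in> (spn CA :: ('k free_alg set list \<Rightarrow>\<^sub>0 'k) set)"
    unfolding cyclic_norm_def tm_def[symmetric] by (rule free_vs.subspace_sum[OF subspace_spn]) (use pw NC in blast)
  moreover have "bas xs - cyclic_op xs \<in> (spn CA :: ('k free_alg set list \<Rightarrow>\<^sub>0 'k) set)"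
    using op[OF xsN] xsN NC by (intro free_vs.subspace_diff[OF subspace_spn]) (auto simp: tm_def)
  ultimately have r: "(if odd p then bas xs - cyclic_op xs else cyclic_norm xs) \<in> (spn CA :: ('k free_alg set list \<Rightarrow>\<^sub>0 'k) set)" by simp
  have "cb (bas pxs) = in_column p (if even p then hochschild_bd dA xs else - bar_bd dA xs) +
     (if p = 0 then 0 else in_column (p - 1) (if odd p then bas xs - cyclic_op xs else cyclic_norm xs))"
    by (simp add: cb_def cyclic_bd_def pxs(1) split del: if_split)
  moreover have "in_column p (if even p then hochschild_bd dA xs else - bar_bd dA xs) \<in> spn (CAc n)" by (rule ic[OF d pxs(2)])
  moreover have "in_column (p - 1) (if odd p then bas xs - cyclic_op xs else cyclic_norm xs) \<in> (spn (CAc n) :: (_ \<Rightarrow>\<^sub>0 'k) set)"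
    by (rule ic[OF r]) (use pxs(2) in simp)
  ultimately show "cb (bas pxs) \<in> spn (CAc n)"
    by (cases "p = 0") (simp_all add: free_vs.subspace_add[OF subspace_spn])
qed

definition "TD m = {ws :: gen list list. (\<Sum>w\<leftarrow>ws. length w) = m}"

lemma relS_col_zero:
  assumes "0 < m" "x \<in> relS" "col p x \<in> spn (TD m)"
  shows "col p x = 0"
proof -
  have "Z0 \<inter> TD m = {}" using assms(1) unfolding Z0_def TD_def by fastforce
  from spn_disjoint[OF this] col_relS[OF assms(2), of p] assms(3) show ?thesis by blast
qed

text \<open>The transfer map is the norm of column 0. It takes total cycles onto invariant cycles,
  and \<open>total_chase\<close> shows that a cycle sent to a boundary of (K, bp) is a
  boundary.\<close>

lemma HC_dim_pos:
  assumes m: "0 < m"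
  shows "HC_red_dim dA dG n m = cA m n"
proof -
  interpret A: cyclic_cx "\<lambda>n. spn (Sm False m n) :: (gen list list \<Rightarrow>\<^sub>0 'k) set" tm dm bpm Wm m
    by (rule cyclic_cx_Sm[OF m])
  have Ab: "A.b = bm" by (rule cyclic_b[OF m])
  have Adc: "A.dcol = dc" by (intro ext) (simp add: A.dcol_def dc_def Ab)
  have NN: "NNm x = A.N k x" if "x \<in> spn (Sm False m k)" for x k
  proof -
    have "x \<in> spn {ws. length ws = Suc k}" using that by (rule subsetD[OF spn_mono, rotated]) (auto simp: Sm_def)
    from NNm_eq[OF this] show ?thesis by (simp add: A.N_def lessThan_Suc_atMost del: sum.lessThan_Suc)
  qed
  have TD: "spn (Sm False m k) \<subseteq> (spn (TD m) :: (gen list list \<Rightarrow>\<^sub>0 'k) set)" for k by (rule spn_mono) (auto simp: Sm_def TD_def)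
  have TD0: "0 \<in> (spn (TD m) :: (gen list list \<Rightarrow>\<^sub>0 'k) set)" by (rule free_vs.subspace_0[OF subspace_spn])
  have ColTD: "A.Col k p \<subseteq> spn (TD m)" for k p using TD TD0 by (auto simp: A.Col_def)
  have colC: "col p x \<in> A.Col k p" if "x \<in> spn (Cc m k)" for x k p
    by (rule lin_spnI[OF lin_col that A.subCol])
      (auto simp: Cc_def col_bas A.Col_def tens_homog free_vs.subspace_0[OF subspace_spn])
  have dcTD: "dc p y \<in> spn (TD m)" if y: "y \<in> A.Col k p" for k p y
  proof (cases k)
    case 0
    have "y \<in> spn (Sm False m 0)" using y 0 by (auto simp: A.Col_def free_vs.subspace_0[OF subspace_spn] split: if_splits)
    then have "dc p y = 0" unfolding dc_def using A.b_0 A.bp_0 Ab by simp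
    then show ?thesis using TD0 by simp
  next
    case (Suc l)
    then show ?thesis using A.dcol_in[of y l p] y ColTD unfolding Adc by blast
  qed
  have rcTD: "rc p y \<in> spn (TD m)" if y: "y \<in> A.Col k q" for k p q y
  proof -
    obtain l where l: "y \<in> spn (Sm False m l)" using y by (auto simp: A.Col_def free_vs.subspace_0[OF subspace_spn] split: if_splits)
    have "rc p y \<in> spn (Sm False m l)" unfolding rc_def using NN[OF l] A.N_in[OF l] A.TX_cl(2)[OF l A.t_in[OF l]] by simp
    then show ?thesis using TD by blast
  qed
  have colcb: "col p (cb x) = dc p (col p x) + rc (Suc p) (col (Suc p) x)" if "x \<in> spn (Cc m k)" for x p k
    by (rule col_cb) (use that spn_mono[OF Cc_sub(1)[of m k]] in blast)
  have colcbTD: "col p (cb x) \<in> spn (TD m)" if "x \<in> spn (Cc m k)" for x p k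
    unfolding colcb[OF that] by (intro free_vs.subspace_add[OF subspace_spn] dcTD[OF colC[OF that]] rcTD[OF colC[OF that]])
  have cyc: "cb x \<in> relS \<longleftrightarrow> (\<forall>p. dc p (col p x) + rc (Suc p) (col (Suc p) x) = 0)" if "x \<in> spn (Cc m k)" for x k
  proof
    assume "cb x \<in> relS"
    then show "\<forall>p. dc p (col p x) + rc (Suc p) (col (Suc p) x) = 0"
      using relS_col_zero[OF m _ colcbTD[OF that]] colcb[OF that] by metis
  next
    assume "\<forall>p. dc p (col p x) + rc (Suc p) (col (Suc p) x) = 0"
    then show "cb x \<in> relS" using col_zero_relS[OF cb_CAc[OF that]] colcb[OF that] by metis
  qed
  let ?V = "{x \<in> spn (Cc m n). cb x \<in> relS}"
  let ?W = "free_vs.span (cb ` spn (Cc m (Suc n)) \<union> relS)"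
  let ?V' = "{y \<in> A.K n. bpm y = 0}"
  have Wdec: "?W = {x + y | x y. x \<in> cb ` spn (Cc m (Suc n)) \<and> y \<in> relS}"
    unfolding free_vs.span_Un free_vs.span_eq_iff[THEN iffD2, OF lin_imageI[OF lin_cb subspace_spn]]
      free_vs.span_eq_iff[THEN iffD2, OF subspace_relS] by blast
  have col0: "col 0 x \<in> spn (Sm False m k)" if "x \<in> spn (Cc m k)" for x k
    using colC[OF that, of 0] by (simp add: A.Col_def)
  have "quot_dim ?V ?W + free_vs.dim (bpm ` A.K (Suc n)) = free_vs.dim ?V'"
  proof (rule quot_dim_transfer[OF lin_comp[OF lin_NNm lin_col[of 0]]])
    show "free_vs.subspace ?V" by (rule lin_preimageI[OF lin_cb]) auto
    show "free_vs.subspace ?W" by simp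
    show "fd ?V'" by (rule fd_mono[OF A.fdK A.sub_cyc]) auto
    show "free_vs.subspace (bpm ` A.K (Suc n))" by (rule lin_imageI[OF lin_bpm A.subK])
    show "bpm ` A.K (Suc n) \<subseteq> ?V'" by (rule A.bpK_sub)
    show "(\<lambda>x. NNm (col 0 x)) ` ?V = ?V'"
    proof (intro equalityI subsetI)
      fix y assume "y \<in> (\<lambda>x. NNm (col 0 x)) ` ?V"
      then obtain x where x: "y = NNm (col 0 x)" "x \<in> spn (Cc m n)" "cb x \<in> relS" by blast
      have y: "y = A.N n (col 0 x)" using x(1) NN[OF col0[OF x(2)]] by simp
      \<comment> \<open>Column 0 of the cycle condition: \<open>bm\<close> of column 0 lies in the
        image of \<open>1 - t\<close>, which the norm kills.\<close>
      have "bm (col 0 x) + (col 1 x - tm (col 1 x)) = 0" using cyc[OF x(2)] x(3) by (auto simp: dc_def rc_def dest: spec[of _ 0])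
      then have b: "bm (col 0 x) = - (col 1 x - tm (col 1 x))" by (simp only: eq_neg_iff_add_eq_0)
      have "A.N (n - 1) (col 1 x - tm (col 1 x)) = 0"
      proof (cases n)
        case 0
        then have "col 1 x = 0" using colC[OF x(2), of 1] by (simp add: A.Col_def)
        then show ?thesis by (simp add: A.t_simps A.N_simps)
      next
        case (Suc k)
        then have "col 1 x \<in> spn (Sm False m (n - 1))" using colC[OF x(2), of 1] by (simp add: A.Col_def)
        then show ?thesis by (rule A.N_1t)
      qed
      then have "bpm y = 0" unfolding y A.bp_N'[OF col0[OF x(2)]] Ab b by (simp only: A.N_simps neg_equal_0_iff_equal)
      then show "y \<in> ?V'" using A.N_inK[OF col0[OF x(2)]] y by simp
    next
      fix z assume z: "z \<in> ?V'"
      then have zK: "z \<in> A.K n" and bz: "bpm z = 0" by auto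
      have sz: "A.sec z \<in> spn (Sm False m n)" by (rule A.sec(1)[OF zK])
      \<comment> \<open>The section of \<open>z\<close>, placed in column 0 alone, is a total cycle,
        because \<open>sec\<close> is a chain map and \<open>bpm z = 0\<close>.\<close>
      let ?x = "in_column 0 (Ps (A.sec z))"
      have x: "?x \<in> spn (Cc m n)"
        by (rule lin_spnI[OF lin_in_column Ps_homog[OF sz] subspace_spn]) (auto simp: Cc_def)
      have cx: "col p ?x = (if p = 0 then A.sec z else 0)" for p
        using Ph_Ps_Sm[OF sz] by (simp add: col_in_column)
      have "bm (A.sec z) = 0" using A.sec(3)[OF zK] bz A.sec_0 Ab by simp
      then have "dc p (col p ?x) + rc (Suc p) (col (Suc p) ?x) = 0" for p
        unfolding cx by (simp add: lin_0[OF lin_rc] lin_0[OF lin_dc]) (simp add: dc_def)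
      then have "cb ?x \<in> relS" using cyc[OF x] by blast
      moreover have "z = NNm (col 0 ?x)" using cx[of 0] NN[OF sz] A.sec(2)[OF zK] by simp
      ultimately show "z \<in> (\<lambda>x. NNm (col 0 x)) ` ?V" using x by blast
    qed
    fix x assume "x \<in> ?V"
    then have x: "x \<in> spn (Cc m n)" and cx: "cb x \<in> relS" by auto
    show "x \<in> ?W \<longleftrightarrow> NNm (col 0 x) \<in> bpm ` A.K (Suc n)"
    proof
      assume "x \<in> ?W"
      then obtain c s where cs: "x = cb c + s" "c \<in> spn (Cc m (Suc n))" "s \<in> relS" unfolding Wdec by blast
      \<comment> \<open>The relation \<open>s\<close> has column 0 of weight \<open>m > 0\<close>,
        whereas relations have coordinates of weight 0 only; so this column vanishes.\<close>
      have "col 0 s = col 0 x - col 0 (cb c)" by (simp add: cs(1) col_simps)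
      also have "\<dots> \<in> spn (TD m)" using colC[OF x, of 0] ColTD colcbTD[OF cs(2)] free_vs.subspace_diff[OF subspace_spn] by blast
      finally have "col 0 s = 0" by (rule relS_col_zero[OF m cs(3)])
      then have e: "col 0 x = bm (col 0 c) + (col 1 c - tm (col 1 c))"
        using colcb[OF cs(2), of 0] by (simp add: cs(1) col_simps dc_def rc_def)
      have c0: "col 0 c \<in> spn (Sm False m (Suc n))" by (rule col0[OF cs(2)])
      have c1: "col 1 c \<in> spn (Sm False m n)" using colC[OF cs(2), of 1] by (simp add: A.Col_def)
      have "NNm (col 0 x) = A.N n (bm (col 0 c)) + A.N n (col 1 c - tm (col 1 c))"
        unfolding NN[OF col0[OF x]] by (simp only: e A.N_simps)
      also have "\<dots> = bpm (A.N (Suc n) (col 0 c))" using A.bp_N[OF c0] A.N_1t[OF c1] Ab by simp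
      finally show "NNm (col 0 x) \<in> bpm ` A.K (Suc n)" using A.N_inK[OF c0] by blast
    next
      assume bd: "NNm (col 0 x) \<in> bpm ` A.K (Suc n)"
      have "\<exists>y. (\<forall>p. y p \<in> A.Col (Suc n) p) \<and> (\<forall>p. col p x = A.dcol p (y p) + (if odd (Suc p) then y (Suc p) - tm (y (Suc p)) else NNm (y (Suc p))))"
      proof (rule A.total_chase[OF lin_NNm NN])
        show "col p x \<in> A.Col n p" for p by (rule colC[OF x])
        show "A.dcol p (col p x) + (if odd (Suc p) then col (Suc p) x - tm (col (Suc p) x) else NNm (col (Suc p) x)) = 0" for p
          using cyc[OF x] cx unfolding Adc rc_def by blast
        show "NNm (col 0 x) \<in> bpm ` A.K (Suc n)" by (rule bd)
      qed
      then obtain y where y: "\<And>p. y p \<in> A.Col (Suc n) p" "\<And>p. col p x = dc p (y p) + rc (Suc p) (y (Suc p))"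
        unfolding Adc rc_def by blast
      \<comment> \<open>The lift of the family found by the chase; it has the same columns, so
        \<open>x - cb w\<close> has none and is a relation.\<close>
      define w where "w = (\<Sum>p\<le>Suc n. in_column p (Ps (y p)))"
      have yS: "y p \<in> spn (Sm False m (Suc n - p))" if "p \<le> Suc n" for p using y(1)[of p] that by (simp add: A.Col_def)
      have w: "w \<in> spn (Cc m (Suc n))" unfolding w_def
      proof (rule free_vs.subspace_sum[OF subspace_spn])
        fix p assume "p \<in> {..Suc n}"
        then show "in_column p (Ps (y p)) \<in> spn (Cc m (Suc n))"
          by (intro lin_spnI[OF lin_in_column Ps_homog[OF yS] subspace_spn]) (auto simp: Cc_def)
      qed
      have cw: "col p w = y p" for p
      proof -
        have "col p w = (\<Sum>p'\<le>Suc n. if p' = p then Ph (Ps (y p')) else 0)"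
          unfolding w_def by (simp only: col_simps col_in_column)
        also have "\<dots> = (if p \<le> Suc n then Ph (Ps (y p)) else 0)" by (simp add: sum.delta del: sum.atMost_Suc)
        also have "\<dots> = y p"
        proof (cases "p \<le> Suc n")
          case True then show ?thesis using Ph_Ps_Sm[OF yS[OF True]] by simp
        next
          case False then show ?thesis using y(1)[of p] by (simp add: A.Col_def)
        qed
        finally show ?thesis .
      qed
      have sub: "CAc n \<subseteq> CAc (Suc n)" by (auto simp: CAc_def)
      have "x \<in> spn (CAc (Suc n))" using x spn_mono[OF Cc_sub(2)[of m n]] spn_mono[OF sub] by blast
      then have "x - cb w \<in> spn (CAc (Suc n))" using cb_CAc[OF w] by (rule free_vs.subspace_diff[OF subspace_spn])
      moreover have "col p (x - cb w) = 0" for p using y(2)[of p] colcb[OF w, of p] cw by (simp add: col_simps)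
      ultimately have "x - cb w \<in> relS" by (rule col_zero_relS)
      moreover have "x = cb w + (x - cb w)" by simp
      ultimately show "x \<in> ?W" unfolding Wdec using w by blast
    qed
  qed
  then have "HC_red_dim dA dG n m + free_vs.dim (bpm ` A.K (Suc n)) = A.zk n"
    unfolding HC_red_dim_def homology_dim_def HC_chain cb_def[symmetric] relS_def[symmetric] A.zk_def .
  then show ?thesis using A.cn_dim[of n] by simp
qed

text \<open>In degree 0 every tensor is, modulo multilinearity, a multiple of a tensor of units, and
  these are divided out.\<close>

lemma HC_dim_zero: "HC_red_dim dA dG n 0 = 0"
proof -
  have in_rel: "bas pxs \<in> relS" if pC: "pxs \<in> Cc 0 n" for pxs
  proof -
    obtain p xs where pxs: "pxs = (p, xs)" "xs \<in> homog_tensors dG 0 (n - p)" using pC by (auto simp: Cc_def)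
    have "bas xs - Ps (tens xs) \<in> tS" using Ps_Ph[of "bas xs"] homog_CA pxs(2) by auto
    then have 1: "in_column p (bas xs - Ps (tens xs)) \<in> relS" by (rule tS_relS)
    have 2: "in_column p (Ps (tens xs)) \<in> relS"
    proof (rule lin_spnI[OF lin_comp[OF lin_in_column lin_Ps] tens_homog[OF pxs(2)]])
      show "free_vs.subspace relS" by simp
      fix ws assume "ws \<in> Sm False 0 (n - p)"
      then have ws: "ws = replicate (Suc (n - p)) []" by (simp only: Sm_zero singleton_iff)
      have "in_column p (Ps (bas ws)) = bas (p, replicate (n - p + 1) \<one>\<^bsub>dA\<^esub>)"
        unfolding ws one_dA by simp
      also have "\<dots> \<in> relS" by (rule relS_one)
      finally show "in_column p (Ps (bas ws)) \<in> relS" .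
    qed
    have "bas pxs = in_column p (bas xs - Ps (tens xs)) + in_column p (Ps (tens xs))"
      by (simp add: pxs(1) in_column_simps)
    then show ?thesis using free_vs.subspace_add[OF subspace_relS 1 2] by simp
  qed
  have sub: "spn (Cc 0 n) \<subseteq> relS"
  proof
    fix x :: "_ \<Rightarrow>\<^sub>0 'k" assume "x \<in> spn (Cc 0 n)"
    then show "x \<in> relS" by (rule lin_spnI[OF lin_id]) (simp_all add: in_rel)
  qed
  have "quot_dim {x \<in> spn (Cc 0 n). cb x \<in> relS} (free_vs.span (cb ` spn (Cc 0 (Suc n)) \<union> relS)) = 0"
  proof (rule quot_dim_subset)
    show "free_vs.subspace {x \<in> spn (Cc 0 n). cb x \<in> relS}" by (rule lin_preimageI[OF lin_cb]) auto
    show "{x \<in> spn (Cc 0 n). cb x \<in> relS} \<subseteq> free_vs.span (cb ` spn (Cc 0 (Suc n)) \<union> relS)"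
      using sub free_vs.span_superset by blast
  qed simp
  then show ?thesis unfolding HC_red_dim_def homology_dim_def HC_chain cb_def[symmetric] relS_def[symmetric] .
qed

lemma hilbert_series:
  defines "E \<equiv> fps_X * (2 + 3 * fps_X) / (1 - fps_X ^ 2) :: rat fps"
  shows "HC_red_series dA dG 0 = HH_red_series dA dG 0"
    and "HC_red_series dA dG 1 = HH_red_series dA dG 0 + HH_series dA dG 3 - E"
    and "HC_red_series dA dG 2 = HH_series dA dG 3"
    and "HH_series dA dG 1 = 2 * HH_red_series dA dG 0 + HH_series dA dG 3 - E"
    and "HH_series dA dG 2 = HH_red_series dA dG 0 + 2 * HH_series dA dG 3 - E"
proof -
  \<comment> \<open>The expansion of \<open>E\<close>; for positive \<open>m\<close> its
    coefficients are the Euler characteristics of \<open>euler_cI\<close>.\<close>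
  let ?F = "Abs_fps (\<lambda>m. if m = 0 then 0 else if even m then 3 else 2) :: rat fps"
  have "?F * (1 - fps_X ^ 2) = fps_X * (2 + 3 * fps_X)"
  proof (rule fps_ext)
    fix n :: nat
    consider "n = 0" | "n = 1" | "n = 2" | l where "n = l + 3"
      by (metis One_nat_def Suc_1 add.commute add_2_eq_Suc' add_Suc_right not0_implies_Suc numeral_3_eq_3)
    then show "(?F * (1 - fps_X ^ 2)) $ n = (fps_X * (2 + 3 * fps_X)) $ n"
      by cases (auto simp: right_diff_distrib fps_X_power_mult_right_nth numeral_fps_const distrib_left)
  qed
  moreover have "(1 - fps_X ^ 2 :: rat fps) \<noteq> 0"
  proof
    assume "1 - fps_X ^ 2 = (0 :: rat fps)"
    from arg_cong[OF this, of "\<lambda>f. f $ 0"] show False by simp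
  qed
  ultimately have E: "E = ?F" unfolding E_def by (metis nonzero_mult_div_cancel_right)
  have hc0: "HC_red_dim dA dG 0 m = HH_dim dA dG 0 m" if "0 < m" for m
    using HC_dim_pos[OF that] HH_dim_pos[OF that] cA_cI[OF that] by simp
  \<comment> \<open>Hence the third Hochschild dimension is \<open>cI m 2\<close> alone.\<close>
  have v: "cI m 3 = 0" if "0 < m" for m using cI_vanish[OF that] by simp
  have two: "(2 * f :: rat fps) $ m = 2 * f $ m" for f m by (simp only: mult_2 fps_add_nth)
  note nth = HH_series_def HC_red_series_def HH_red_series_def
  show "HC_red_series dA dG 0 = HH_red_series dA dG 0"
    by (rule fps_ext) (simp add: nth hc0 HC_dim_zero HH_dim_zero)
  show "HC_red_series dA dG 2 = HH_series dA dG 3"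
  proof (rule fps_ext)
    fix m
    show "HC_red_series dA dG 2 $ m = HH_series dA dG 3 $ m"
      by (cases "m = 0") (simp_all add: nth HC_dim_zero HH_dim_zero HC_dim_pos HH_dim_pos cA_cI v)
  qed
  have eu: "rat_of_nat (cI m 0) + of_nat (cI m 2) - (if even m then 3 else 2) = of_nat (cI m 1)" if "0 < m" for m
    using euler_cI[OF that] by linarith
  show "HC_red_series dA dG 1 = HH_red_series dA dG 0 + HH_series dA dG 3 - E"
  proof (rule fps_ext)
    fix m
    show "HC_red_series dA dG 1 $ m = (HH_red_series dA dG 0 + HH_series dA dG 3 - E) $ m"
      unfolding fps_sub_nth fps_add_nth two by (cases "m = 0") (use eu[of m] in \<open>simp_all add: E nth HC_dim_zero HH_dim_zero HC_dim_pos HH_dim_pos cA_cI v\<close>)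
  qed
  show "HH_series dA dG 1 = 2 * HH_red_series dA dG 0 + HH_series dA dG 3 - E"
  proof (rule fps_ext)
    fix m
    show "HH_series dA dG 1 $ m = (2 * HH_red_series dA dG 0 + HH_series dA dG 3 - E) $ m"
      unfolding fps_sub_nth fps_add_nth two by (cases "m = 0") (use eu[of m] in \<open>simp_all add: E nth HC_dim_zero HH_dim_zero HC_dim_pos HH_dim_pos cA_cI v two\<close>)
  qed
  show "HH_series dA dG 2 = HH_red_series dA dG 0 + 2 * HH_series dA dG 3 - E"
  proof (rule fps_ext)
    fix m
    show "HH_series dA dG 2 $ m = (HH_red_series dA dG 0 + 2 * HH_series dA dG 3 - E) $ m"
      unfolding fps_sub_nth fps_add_nth two by (cases "m = 0") (use eu[of m] in \<open>simp_all add: E nth HC_dim_zero HH_dim_zero HC_dim_pos HH_dim_pos cA_cI v two\<close>)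
  qed
qed

end

theorem mainTheorem5:
  fixes \<alpha> \<beta> :: "'k::field_char_0"
  assumes "(\<alpha>, \<beta>) \<noteq> (0, 0)"
    and "\<exists>r s. [:- \<beta>, - \<alpha>, 1:] = [:- r, 1:] * [:- s, 1:]"
  shows
    "let A = down_up \<alpha> \<beta>; G = down_up_grading \<alpha> \<beta>;
         E = fps_X * (2 + 3 * fps_X) / (1 - fps_X ^ 2)
     in HC_red_series A G 0 = HH_red_series A G 0 \<and>
        HC_red_series A G 1 = HH_red_series A G 0 + HH_series A G 3 - E \<and>
        HC_red_series A G 2 = HH_series A G 3 \<and>
        HH_series A G 1 = 2 * HH_red_series A G 0 + HH_series A G 3 - E \<and>
        HH_series A G 2 = HH_red_series A G 0 + 2 * HH_series A G 3 - E"
  unfolding Let_def by (intro conjI down_up_algebra.hilbert_series)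

end
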